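(* Let $p=1$. Let $\{\boldsymbol{X}_k\}$ and $\{(\boldsymbol{\sigma}_k,\boldsymbol{U}_k,\boldsymbol{V}_k)\}$ be sequences generated by the dynamic proximal gradient algorithm (DPGA) described in the context, with stepsizes $t_k,s_k$ selected by strategy (i) or by strategy (ii); let $(\bar{\boldsymbol\sigma},\bar{\boldsymbol U},\bar{\boldsymbol V})$ be the limit of $\{(\boldsymbol{\sigma}_k,\boldsymbol{U}_k,\boldsymbol{V}_k)\}$ and $\bar{\boldsymbol X}=\bar{\boldsymbol U}^\top\mathcal D(\bar{\boldsymbol\sigma})\bar{\boldsymbol V}$ the limit of $\{\boldsymbol X_k\}$. Assume that all the non-zero elements of $\bar{\boldsymbol\sigma}$ are distinct and (as the paper assumes without loss of generality) that $\bar\sigma_1>\cdots>\bar\sigma_r>\bar\sigma_{r+1}=\cdots=\bar\sigma_n=0$. Suppose that $\boldsymbol 0\in\mathrm{ri}\,\partial\mathcal F(\bar{\boldsymbol X})$, where $\mathrm{ri}$ denotes the relative interior. Then $\{\boldsymbol X_k\}$ converges linearly to $\bar{\boldsymbol X}$ and $\{\mathcal F(\boldsymbol X_k)\}$ converges linearly to $\mathcal F(\bar{\boldsymbol X})$.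
   Context: Linear convergence of a sequence $\{z_k\}$ to $\bar z$ means that there are $C>0$ and $q\in(0,1)$ with $\|z_k-\bar z\|\le Cq^k$ for all $k$. Setting. $m\ge n$ and $l$ are positive integers, $\boldsymbol b\in\mathbb R^l$, $\mathcal A:\mathbb R^{m\times n}\to\mathbb R^l$ is linear with adjoint $\mathcal A^*$, $\lambda>0$ is the regularization parameter. $\mathbb N$ is the set of nonnegative integers. $\|\cdot\|$ is the Euclidean norm (the Frobenius norm for matrices), $\langle \boldsymbol X,\boldsymbol Y\rangle=\mathrm{tr}(\boldsymbol X^\top\boldsymbol Y)$, $\|\cdot\|_F$ the Frobenius norm, $\|\cdot\|_{\rm op}$ the operator norm. $\mathcal S(n)$ and $\mathcal O(n)$ are the real skew-symmetric and orthogonal $n\times n$ matrices. $\mathcal M:=\mathbb R^n\times\mathcal S(m)\times\mathcal S(n)$ has the product inner product and norm. $\mathcal D(\boldsymbol x)\in\mathbb R^{m\times n}$ is the diagonal matrix with diagonal $\boldsymbol x\in\mathbb R^n$; $\mathrm{diag}(\cdot)$ extracts the diagonal of a matrix as a vector. $\|\boldsymbol\sigma\|_1=\sum_i|\sigma_i|$ and $\|\boldsymbol X\|_{S_1}=\sum_{i=1}^n\sigma_i(\boldsymbol X)$ (sum of singular values). Functions. $f(\boldsymbol X)=\frac12\|\mathcal A(\boldsymbol X)-\boldsymbol b\|^2$, $\nabla f(\boldsymbol X)=\mathcal A^*(\mathcal A(\boldsymbol X)-\boldsymbol b)$, $\mathcal F(\boldsymbol X)=f(\boldsymbol X)+\lambda\|\boldsymbol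 X\|_{S_1}$; $\partial\mathcal F$ is its (limiting, equivalently convex) subdifferential. For $\boldsymbol\Omega=(\boldsymbol U,\boldsymbol V)\in\mathcal O(m)\times\mathcal O(n)$ and $(\boldsymbol\sigma,\boldsymbol E,\boldsymbol F)\in\mathcal M$, $f_{\boldsymbol\Omega}(\boldsymbol\sigma,\boldsymbol E,\boldsymbol F)=f((\boldsymbol Ue^{\boldsymbol E})^\top\mathcal D(\boldsymbol\sigma)\boldsymbol Ve^{\boldsymbol F})$. With $\boldsymbol X=\boldsymbol U^\top\mathcal D(\boldsymbol\sigma)\boldsymbol V$, the partial gradients are $\nabla_{\boldsymbol\sigma}f_{\boldsymbol\Omega}(\boldsymbol\sigma,\boldsymbol 0,\boldsymbol 0)=\mathrm{diag}(\boldsymbol U\nabla f(\boldsymbol X)\boldsymbol V^\top)$, $\nabla_{\boldsymbol E}f_{\boldsymbol\Omega}(\boldsymbol\sigma,\boldsymbol 0,\boldsymbol 0)=\frac12[\boldsymbol X\nabla f(\boldsymbol X)^\top-\nabla f(\boldsymbol X)\boldsymbol X^\top]$, $\nabla_{\boldsymbol F}f_{\boldsymbol\Omega}(\boldsymbol\sigma,\boldsymbol 0,\boldsymbol 0)=\frac12[\boldsymbol X^\top\nabla f(\boldsymbol X)-\nabla f(\boldsymbol X)^\top\boldsymbol X]$. DPGA (for $p=1$). Start from $(\boldsymbol\sigma_0,\boldsymbol U_0,\boldsymbol V_0)\in\mathbb R^n\times\mathcal O(m)\times\mathcal O(n)$, $\boldsymbol X_0=\boldsymbol U_0^\top\mathcal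 D(\boldsymbol\sigma_0)\boldsymbol V_0$. For $k=0,1,2,\dots$ (no termination) set $\boldsymbol\Omega_k=(\boldsymbol U_k,\boldsymbol V_k)$, $\nabla_{\boldsymbol E}^k=\nabla_{\boldsymbol E}f_{\boldsymbol\Omega_k}(\boldsymbol\sigma_k,\boldsymbol 0,\boldsymbol 0)$, $\nabla_{\boldsymbol F}^k=\nabla_{\boldsymbol F}f_{\boldsymbol\Omega_k}(\boldsymbol\sigma_k,\boldsymbol 0,\boldsymbol 0)$; choose $t_k,s_k>0$; put $\boldsymbol E_k=-s_k\nabla_{\boldsymbol E}^k$, $\boldsymbol F_k=-s_k\nabla_{\boldsymbol F}^k$; let $\boldsymbol\sigma_{k+1}$ be the minimizer of $\boldsymbol\sigma\mapsto\frac1{2t_k}\|\boldsymbol\sigma-\boldsymbol\sigma_k+t_k\nabla_{\boldsymbol\sigma}f_{\boldsymbol\Omega_k}(\boldsymbol\sigma_k,\boldsymbol 0,\boldsymbol 0)\|^2+\lambda\|\boldsymbol\sigma\|_1$; define $\boldsymbol U_{k+1},\boldsymbol V_{k+1}$ by $(\boldsymbol I+\frac12\boldsymbol E_k)\boldsymbol U_{k+1}^\top=(\boldsymbol I-\frac12\boldsymbol E_k)\boldsymbol U_k^\top$, $(\boldsymbol I+\frac12\boldsymbol F_k)\boldsymbol V_{k+1}^\top=(\boldsymbol I-\frac12\boldsymbol F_k)\boldsymbol V_k^\top$; and $\boldsymbol X_{k+1}=\boldsymbol U_{k+1}^\top\mathcal D(\boldsymbol\sigma_{k+1})\boldsymbol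 V_{k+1}$. Stepsize strategies, at the $k$-th iteration (with $1/0=+\infty$): Strategy (i) (backtracking search, for a given $\alpha>0$): choose $\rho_t\in(0,1)$ and $\rho_s\in(0,(\max\{\|\nabla_{\boldsymbol E}^k\|,\|\nabla_{\boldsymbol F}^k\|\})^{-1})$. Set $(t_k,s_k):=\max\{(\rho_t^i,\rho_s^j): i,j\in\mathbb N,\ i\le j\le i+1\}$ such that the sufficient descent property $\mathcal F(\boldsymbol X_{k+1})+\alpha\|(\boldsymbol\sigma_{k+1}-\boldsymbol\sigma_k,\boldsymbol E_k,\boldsymbol F_k)\|^2\le\mathcal F(\boldsymbol X_k)$ holds, where $(a,b)\le(c,d)$ means $a\le c$ and $b\le d$. Strategy (ii) (explicit): choose $\mu\in(0,\frac12]$; $t_k,s_k$ are chosen to satisfy $\frac{\mu}{l_\sigma^k}\le t_k\le\frac{1-\mu}{l_\sigma^k}$ and $\min\{1,\mu\bar s_k,\frac1{\|\nabla_{\boldsymbol E}^k\|_F},\frac1{\|\nabla_{\boldsymbol F}^k\|_F}\}\le s_k\le\min\{\frac1\mu,(1-\mu)\bar s_k,\frac1{\|\nabla_{\boldsymbol E}^k\|_F},\frac1{\|\nabla_{\boldsymbol F}^k\|_F}\}$, where $\bar s_k=\frac{2}{\sqrt{(l_\Omega^k)^2+2c_k}+l_\Omega^k}$, $l_\sigma^k=\|\mathcal A^*\mathcal A\|_{\rm op}+2\|\nabla f(\boldsymbol X_k)\|_F+2\|\mathcal A^*\mathcal A\|_{\rm op}\|\boldsymbol\sigma_k\|$, $l_\Omega^k=\|\mathcal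 A^*\mathcal A\|_{\rm op}\|\boldsymbol\sigma_k\|^2+(\frac12+\|\boldsymbol\sigma_k\|)\|\nabla f(\boldsymbol X_k)\|_F+\frac12\|\boldsymbol\sigma_k\|$, $c_k=(\|\mathcal A^*\mathcal A\|_{\rm op}\|\boldsymbol\sigma_{k+1}\|^2+\|\mathcal A^*(\boldsymbol b)\|_F\|\boldsymbol\sigma_{k+1}\|)(\|\nabla_{\boldsymbol E}^k\|_F+\|\nabla_{\boldsymbol F}^k\|_F)$. The paper proves beforehand that such sequences $\{(\boldsymbol\sigma_k,\boldsymbol U_k,\boldsymbol V_k)\}$ and $\{\boldsymbol X_k\}$ converge; $(\bar{\boldsymbol\sigma},\bar{\boldsymbol U},\bar{\boldsymbol V})$ and $\bar{\boldsymbol X}$ denote the limits.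
   Formalization: The parameters ρ_t, ρ_s (strategy (i)) and μ (strategy (ii)) are fixed for the whole run, with the bound on ρ_s required at every k; if they may be chosen afresh at each iteration (e.g. ρ_t=1/(k+2)), convergence can be sublinear and the claim fails. *)

theory Defs
  imports "HOL-Analysis.Analysis"
begin

text \<open>
  A real \<open>m\<close> by \<open>n\<close> matrix is an element of \<open>real ^ 'n ^ 'm\<close>; its library norm and inner product
  are the Frobenius norm and \<open>tr (X\<^sup>T Y)\<close>. The index types are finite linear orders, so that "the
  \<open>i\<close>-th index" makes sense in both of them and rectangular diagonal matrices can be formed.
\<close>

type_synonym 'n rvec = "(real, 'n) vec"
type_synonym ('m, 'n) mat = "((real, 'n) vec, 'm) vec"

definition index_pos :: "'a::{finite,linorder} \<Rightarrow> nat"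
  where "index_pos i = card {j. j < i}"
  \<comment> \<open>positions are counted from 0\<close>

definition diag_matrix :: "'n::{finite,linorder} rvec \<Rightarrow> ('m::{finite,linorder},'n) mat"
  where "diag_matrix x = (\<chi> i j. if index_pos i = index_pos j then x $ j else 0)"

text \<open>The index \<open>i\<close> below exists and is unique when \<open>n \<le> m\<close>.\<close>

definition diag_of :: "('m::{finite,linorder},'n::{finite,linorder}) mat \<Rightarrow> 'n rvec"
  where "diag_of M = (\<chi> j. M $ (THE i. index_pos i = index_pos j) $ j)"

definition assemble ::
    "'n::{finite,linorder} rvec \<Rightarrow> ('m::{finite,linorder},'m) mat \<Rightarrow> ('n,'n) mat \<Rightarrow> ('m,'n) mat"
  where "assemble \<sigma> U V = transpose U ** diag_matrix \<sigma> ** V"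

text \<open>
  The vector of singular values in nonincreasing order, given by the singular value decomposition;
  it exists and is unique when \<open>n \<le> m\<close>.
\<close>

definition singular_values :: "('m::{finite,linorder},'n::{finite,linorder}) mat \<Rightarrow> 'n rvec"
  where "singular_values X = (THE s. (\<forall>i. 0 \<le> s $ i) \<and> (\<forall>i j. i \<le> j \<longrightarrow> s $ j \<le> s $ i) \<and>
    (\<exists>U V. orthogonal_matrix U \<and> orthogonal_matrix V \<and> X = assemble s U V))"

definition schatten1_norm :: "('m::{finite,linorder},'n::{finite,linorder}) mat \<Rightarrow> real"
  where "schatten1_norm X = (\<Sum>i\<in>UNIV. singular_values X $ i)"

definition l1_norm :: "'n::finite rvec \<Rightarrow> real"
  where "l1_norm x = (\<Sum>i\<in>UNIV. \<bar>x $ i\<bar>)"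

definition fit :: "(('m::finite,'n::finite) mat \<Rightarrow> 'l::finite rvec) \<Rightarrow> 'l rvec \<Rightarrow> ('m,'n) mat \<Rightarrow> real"
  where "fit \<A> b X = (norm (\<A> X - b))\<^sup>2 / 2"

definition grad_fit :: "(('m::finite,'n::finite) mat \<Rightarrow> 'l::finite rvec) \<Rightarrow> 'l rvec \<Rightarrow> ('m,'n) mat \<Rightarrow> ('m,'n) mat"
  where "grad_fit \<A> b X = adjoint \<A> (\<A> X - b)"

definition objective ::
    "(('m::{finite,linorder},'n::{finite,linorder}) mat \<Rightarrow> 'l::finite rvec) \<Rightarrow> 'l rvec \<Rightarrow> real
      \<Rightarrow> ('m,'n) mat \<Rightarrow> real"
  where "objective \<A> b lam X = fit \<A> b X + lam * schatten1_norm X"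

text \<open>The subdifferential of convex analysis (for convex functions it equals the limiting one).\<close>

definition subdifferential :: "('a::real_inner \<Rightarrow> real) \<Rightarrow> 'a \<Rightarrow> 'a set"
  where "subdifferential g x = {v. \<forall>y. g x + v \<bullet> (y - x) \<le> g y}"

text \<open>
  Partial gradients at \<open>(\<sigma>, 0, 0)\<close> of
  \<open>(\<sigma>, E, F) \<mapsto> f ((U exp E)\<^sup>T D(\<sigma>) (V exp F))\<close> with respect to \<open>\<sigma>\<close> and to the skew-symmetric
  matrices \<open>E\<close> and \<open>F\<close>.
\<close>

definition grad_sigma ::
    "(('m::{finite,linorder},'n::{finite,linorder}) mat \<Rightarrow> 'l::finite rvec) \<Rightarrow> 'l rvec
      \<Rightarrow> 'n rvec \<Rightarrow> ('m,'m) mat \<Rightarrow> ('n,'n) mat \<Rightarrow> 'n rvec"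
  where "grad_sigma \<A> b \<sigma> U V = diag_of (U ** grad_fit \<A> b (assemble \<sigma> U V) ** transpose V)"

definition grad_E ::
    "(('m::{finite,linorder},'n::{finite,linorder}) mat \<Rightarrow> 'l::finite rvec) \<Rightarrow> 'l rvec
      \<Rightarrow> 'n rvec \<Rightarrow> ('m,'m) mat \<Rightarrow> ('n,'n) mat \<Rightarrow> ('m,'m) mat"
  where "grad_E \<A> b \<sigma> U V = (let X = assemble \<sigma> U V; G = grad_fit \<A> b X in
    (1/2) *\<^sub>R (X ** transpose G - G ** transpose X))"

definition grad_F ::
    "(('m::{finite,linorder},'n::{finite,linorder}) mat \<Rightarrow> 'l::finite rvec) \<Rightarrow> 'l rvec
      \<Rightarrow> 'n rvec \<Rightarrow> ('m,'m) mat \<Rightarrow> ('n,'n) mat \<Rightarrow> ('n,'n) mat"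
  where "grad_F \<A> b \<sigma> U V = (let X = assemble \<sigma> U V; G = grad_fit \<A> b X in
    (1/2) *\<^sub>R (transpose X ** G - transpose G ** X))"

text \<open>
  One iteration with stepsizes \<open>t\<close>, \<open>s\<close>: a proximal gradient step for \<open>\<sigma>\<close> and Cayley-transform steps
  for \<open>U\<close>, \<open>V\<close>. The three conditions determine \<open>(\<sigma>', U', V')\<close> uniquely.
\<close>

definition dpga_step ::
    "(('m::{finite,linorder},'n::{finite,linorder}) mat \<Rightarrow> 'l::finite rvec) \<Rightarrow> 'l rvec \<Rightarrow> real
      \<Rightarrow> real \<Rightarrow> real
      \<Rightarrow> 'n rvec \<Rightarrow> ('m,'m) mat \<Rightarrow> ('n,'n) mat
      \<Rightarrow> 'n rvec \<Rightarrow> ('m,'m) mat \<Rightarrow> ('n,'n) mat \<Rightarrow> bool"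
  where "dpga_step \<A> b lam t s \<sigma> U V \<sigma>' U' V' \<longleftrightarrow>
    (let E = - (s *\<^sub>R grad_E \<A> b \<sigma> U V); F = - (s *\<^sub>R grad_F \<A> b \<sigma> U V) in
      is_arg_min
        (\<lambda>x. (norm (x - \<sigma> + t *\<^sub>R grad_sigma \<A> b \<sigma> U V))\<^sup>2 / (2 * t) + lam * l1_norm x)
        (\<lambda>x. True) \<sigma>' \<and>
      (mat 1 + (1/2) *\<^sub>R E) ** transpose U' = (mat 1 - (1/2) *\<^sub>R E) ** transpose U \<and>
      (mat 1 + (1/2) *\<^sub>R F) ** transpose V' = (mat 1 - (1/2) *\<^sub>R F) ** transpose V)"

definition dpga_sequence ::
    "(('m::{finite,linorder},'n::{finite,linorder}) mat \<Rightarrow> 'l::finite rvec) \<Rightarrow> 'l rvec \<Rightarrow> real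
      \<Rightarrow> (nat \<Rightarrow> real) \<Rightarrow> (nat \<Rightarrow> real)
      \<Rightarrow> (nat \<Rightarrow> 'n rvec) \<Rightarrow> (nat \<Rightarrow> ('m,'m) mat) \<Rightarrow> (nat \<Rightarrow> ('n,'n) mat) \<Rightarrow> bool"
  where "dpga_sequence \<A> b lam t s \<sigma> U V \<longleftrightarrow>
    orthogonal_matrix (U 0) \<and> orthogonal_matrix (V 0) \<and>
    (\<forall>k. 0 < t k \<and> 0 < s k \<and>
      dpga_step \<A> b lam (t k) (s k) (\<sigma> k) (U k) (V k) (\<sigma> (Suc k)) (U (Suc k)) (V (Suc k)))"

definition sufficient_descent ::
    "(('m::{finite,linorder},'n::{finite,linorder}) mat \<Rightarrow> 'l::finite rvec) \<Rightarrow> 'l rvec \<Rightarrow> real \<Rightarrow> real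
      \<Rightarrow> real \<Rightarrow> real \<Rightarrow> 'n rvec \<Rightarrow> ('m,'m) mat \<Rightarrow> ('n,'n) mat \<Rightarrow> bool"
  where "sufficient_descent \<A> b lam \<alpha> t s \<sigma> U V \<longleftrightarrow>
    (\<exists>\<sigma>' U' V'. dpga_step \<A> b lam t s \<sigma> U V \<sigma>' U' V' \<and>
      objective \<A> b lam (assemble \<sigma>' U' V')
        + \<alpha> * (norm (\<sigma>' - \<sigma>, - (s *\<^sub>R grad_E \<A> b \<sigma> U V), - (s *\<^sub>R grad_F \<A> b \<sigma> U V)))\<^sup>2
      \<le> objective \<A> b lam (assemble \<sigma> U V))"

text \<open>
  Strategy (i). The parameters \<open>\<rho>\<^sub>t\<close>, \<open>\<rho>\<^sub>s\<close> do not depend on the iteration; the maximum is the greatest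
  element for the componentwise order on pairs. Extended reals implement \<open>1/0 = \<infinity>\<close>.
\<close>

definition backtracking_stepsizes ::
    "(('m::{finite,linorder},'n::{finite,linorder}) mat \<Rightarrow> 'l::finite rvec) \<Rightarrow> 'l rvec \<Rightarrow> real \<Rightarrow> real
      \<Rightarrow> (nat \<Rightarrow> 'n rvec) \<Rightarrow> (nat \<Rightarrow> ('m,'m) mat) \<Rightarrow> (nat \<Rightarrow> ('n,'n) mat)
      \<Rightarrow> (nat \<Rightarrow> real) \<Rightarrow> (nat \<Rightarrow> real) \<Rightarrow> bool"
  where "backtracking_stepsizes \<A> b lam \<alpha> \<sigma> U V t s \<longleftrightarrow>
    (\<exists>\<rho>t \<rho>s. 0 < \<rho>t \<and> \<rho>t < 1 \<and> 0 < \<rho>s \<and>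
      (\<forall>k. ereal \<rho>s < 1 / ereal (max (norm (grad_E \<A> b (\<sigma> k) (U k) (V k)))
                                    (norm (grad_F \<A> b (\<sigma> k) (U k) (V k)))) \<and>
        (let P = {(\<rho>t ^ i, \<rho>s ^ j) | i j. i \<le> j \<and> j \<le> i + 1 \<and>
                    sufficient_descent \<A> b lam \<alpha> (\<rho>t ^ i) (\<rho>s ^ j) (\<sigma> k) (U k) (V k)}
         in (t k, s k) \<in> P \<and> (\<forall>(t', s') \<in> P. t' \<le> t k \<and> s' \<le> s k))))"

definition l_sigma ::
    "(('m::{finite,linorder},'n::{finite,linorder}) mat \<Rightarrow> 'l::finite rvec) \<Rightarrow> 'l rvec
      \<Rightarrow> 'n rvec \<Rightarrow> ('m,'m) mat \<Rightarrow> ('n,'n) mat \<Rightarrow> real"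
  where "l_sigma \<A> b \<sigma> U V =
    onorm (adjoint \<A> \<circ> \<A>) + 2 * norm (grad_fit \<A> b (assemble \<sigma> U V))
      + 2 * onorm (adjoint \<A> \<circ> \<A>) * norm \<sigma>"

definition l_Omega ::
    "(('m::{finite,linorder},'n::{finite,linorder}) mat \<Rightarrow> 'l::finite rvec) \<Rightarrow> 'l rvec
      \<Rightarrow> 'n rvec \<Rightarrow> ('m,'m) mat \<Rightarrow> ('n,'n) mat \<Rightarrow> real"
  where "l_Omega \<A> b \<sigma> U V =
    onorm (adjoint \<A> \<circ> \<A>) * (norm \<sigma>)\<^sup>2
      + (1/2 + norm \<sigma>) * norm (grad_fit \<A> b (assemble \<sigma> U V)) + norm \<sigma> / 2"

definition c_bound ::
    "(('m::{finite,linorder},'n::{finite,linorder}) mat \<Rightarrow> 'l::finite rvec) \<Rightarrow> 'l rvec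
      \<Rightarrow> 'n rvec \<Rightarrow> ('m,'m) mat \<Rightarrow> ('n,'n) mat \<Rightarrow> 'n rvec \<Rightarrow> real"
  where "c_bound \<A> b \<sigma> U V \<sigma>' =
    (onorm (adjoint \<A> \<circ> \<A>) * (norm \<sigma>')\<^sup>2 + norm (adjoint \<A> b) * norm \<sigma>')
      * (norm (grad_E \<A> b \<sigma> U V) + norm (grad_F \<A> b \<sigma> U V))"

definition s_bar ::
    "(('m::{finite,linorder},'n::{finite,linorder}) mat \<Rightarrow> 'l::finite rvec) \<Rightarrow> 'l rvec
      \<Rightarrow> 'n rvec \<Rightarrow> ('m,'m) mat \<Rightarrow> ('n,'n) mat \<Rightarrow> 'n rvec \<Rightarrow> ereal"
  where "s_bar \<A> b \<sigma> U V \<sigma>' =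
    2 / ereal (sqrt ((l_Omega \<A> b \<sigma> U V)\<^sup>2 + 2 * c_bound \<A> b \<sigma> U V \<sigma>') + l_Omega \<A> b \<sigma> U V)"

text \<open>Strategy (ii); \<open>\<mu>\<close> does not depend on the iteration.\<close>

definition explicit_stepsizes ::
    "(('m::{finite,linorder},'n::{finite,linorder}) mat \<Rightarrow> 'l::finite rvec) \<Rightarrow> 'l rvec
      \<Rightarrow> (nat \<Rightarrow> 'n rvec) \<Rightarrow> (nat \<Rightarrow> ('m,'m) mat) \<Rightarrow> (nat \<Rightarrow> ('n,'n) mat)
      \<Rightarrow> (nat \<Rightarrow> real) \<Rightarrow> (nat \<Rightarrow> real) \<Rightarrow> bool"
  where "explicit_stepsizes \<A> b \<sigma> U V t s \<longleftrightarrow>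
    (\<exists>\<mu>. 0 < \<mu> \<and> \<mu> \<le> 1/2 \<and>
      (\<forall>k. let l = ereal (l_sigma \<A> b (\<sigma> k) (U k) (V k));
               sb = s_bar \<A> b (\<sigma> k) (U k) (V k) (\<sigma> (Suc k));
               e = 1 / ereal (norm (grad_E \<A> b (\<sigma> k) (U k) (V k)));
               f = 1 / ereal (norm (grad_F \<A> b (\<sigma> k) (U k) (V k)))
        in ereal \<mu> / l \<le> ereal (t k) \<and> ereal (t k) \<le> ereal (1 - \<mu>) / l \<and>
           Min {1, ereal \<mu> * sb, e, f} \<le> ereal (s k) \<and>
           ereal (s k) \<le> Min {ereal (1 / \<mu>), ereal (1 - \<mu>) * sb, e, f}))"

definition converges_linearly :: "(nat \<Rightarrow> 'a::real_normed_vector) \<Rightarrow> 'a \<Rightarrow> bool"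
  where "converges_linearly z zbar \<longleftrightarrow>
    (\<exists>C q. 0 < C \<and> 0 < q \<and> q < 1 \<and> (\<forall>k. norm (z k - zbar) \<le> C * q ^ k))"

end

theory Submission
  imports Defs "HOL-Library.Landau_Symbols"
begin

text \<open>
  By the relative interior condition, \<open>- \<nabla>f\<close> at the limit is \<open>\<lambda>\<Gamma>\<close>, where in the limiting singular bases
  \<open>\<Gamma>\<close> is an identity block on the positive singular values and has norm less than 1 on the
  complementary block. Hence the proximal step eventually sets the vanishing entries of \<open>\<sigma>\<close> to zero,
  and, the positive entries being distinct, the three partial gradients control a subgradient \<open>S\<^sub>k\<close> of
  the objective at \<open>X\<^sub>k\<close>. Near the limit the solution set is the affine set of all \<open>Y\<close> with
  \<open>\<A> Y = \<A> X\<close> and \<open>Y = \<Gamma> Y\<^sup>T \<Gamma>\<close>. Since \<open>X\<^sub>k\<close> satisfies the same fixed-point equation with the dual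
  matrix \<open>\<Gamma>\<^sub>k\<close> belonging to \<open>S\<^sub>k\<close>, its distance to that set is bounded by \<open>\<parallel>S\<^sub>k\<parallel>\<close>, and by convexity the gap of the
  objective is bounded by a multiple of \<open>\<parallel>S\<^sub>k\<parallel>\<^sup>2\<close>. Together with sufficient descent this makes the gap
  decay geometrically, and the steps with it.
\<close>


section \<open>Matrices\<close>

text \<open>The description \<open>Y = \<Gamma> Y^T \<Gamma>\<close> is what makes the error bound
  elementary: it is linear in \<open>Y\<close>. The semidefiniteness that completes the description
  of the face exposed by \<open>\<Gamma>\<close> holds with a margin at the limit, so it survives
  small perturbations. The distance to the solutions is therefore the distance to the kernel of a
  linear map, and finite dimension suffices to bound it. By convexity the gap is at most
  \<open>\<parallel>S\<^sub>k\<parallel>\<close> times this distance. It becomes quadratic because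
  the distance is bounded by \<open>\<parallel>S\<^sub>k\<parallel>\<close> together with
  \<open>\<parallel>\<A> (X\<^sub>k - X)\<parallel>\<close>, \<open>X\<close> being the limit, while
  the curvature of the squared loss bounds the square of the latter by the same product; Young's
  inequality resolves the circle. The obstacle is that, before the entries of \<sigma> outside the
  limiting support are zero, \<open>S\<^sub>k\<close> is not an exact subgradient. All estimates
  therefore carry the total size \<tau> of these entries as an additional error term, which the
  analysis of the stepsizes has to dispose of.\<close>

lemma inner_mat: "(A :: real^'n^'m) \<bullet> B = (\<Sum>i\<in>UNIV. \<Sum>j\<in>UNIV. A $ i $ j * B $ i $ j)"
  by (simp add: inner_vec_def)

lemma inner_transpose [simp]: "transpose (A :: real^'n^'m) \<bullet> transpose B = A \<bullet> B"
  unfolding inner_mat by (subst sum.swap) (simp add: transpose_def)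

lemma norm_transpose [simp]: "norm (transpose (A :: real^'n^'m)) = norm A"
  by (simp add: norm_eq_sqrt_inner)

lemma transpose_add: "transpose (A + B) = transpose A + transpose (B :: real^'n^'m)"
  and transpose_diff: "transpose (A - B) = transpose A - transpose (B :: real^'n^'m)"
  and transpose_minus: "transpose (- A) = - transpose (A :: real^'n^'m)"
  and transpose_zero [simp]: "transpose (0 :: real^'n^'m) = 0"
  by (simp_all add: transpose_def vec_eq_iff)

lemma bounded_linear_transpose: "bounded_linear (transpose :: real^'n^'m \<Rightarrow> real^'m^'n)"
  by (intro linear_conv_bounded_linear[THEN iffD1] linearI) (simp_all add: transpose_add transpose_scalar)

lemma matrix_inner_left: "((M :: real^'m^'k) ** A) \<bullet> (B :: real^'n^'k) = A \<bullet> (transpose M ** B)"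
proof -
  have "(M ** A) \<bullet> B = (\<Sum>i\<in>UNIV. \<Sum>j\<in>UNIV. \<Sum>k\<in>UNIV. M $ i $ k * A $ k $ j * B $ i $ j)"
    by (simp add: inner_mat matrix_matrix_mult_def sum_distrib_right)
  also have "\<dots> = (\<Sum>i\<in>UNIV. \<Sum>k\<in>UNIV. \<Sum>j\<in>UNIV. M $ i $ k * A $ k $ j * B $ i $ j)"
    by (intro sum.cong[OF refl] sum.swap)
  also have "\<dots> = (\<Sum>k\<in>UNIV. \<Sum>i\<in>UNIV. \<Sum>j\<in>UNIV. M $ i $ k * A $ k $ j * B $ i $ j)"
    by (rule sum.swap)
  also have "\<dots> = (\<Sum>k\<in>UNIV. \<Sum>j\<in>UNIV. \<Sum>i\<in>UNIV. M $ i $ k * A $ k $ j * B $ i $ j)"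
    by (intro sum.cong[OF refl] sum.swap)
  also have "\<dots> = A \<bullet> (transpose M ** B)"
    by (simp add: inner_mat matrix_matrix_mult_def sum_distrib_left transpose_def mult_ac)
  finally show ?thesis .
qed

lemma matrix_inner_right: "((A :: real^'k^'m) ** M) \<bullet> (B :: real^'n^'m) = A \<bullet> (B ** transpose M)"
proof -
  have "(A ** M) \<bullet> B = (transpose M ** transpose A) \<bullet> transpose B"
    by (metis inner_transpose matrix_transpose_mul)
  also have "\<dots> = transpose A \<bullet> (M ** transpose B)"
    by (simp add: matrix_inner_left)
  also have "\<dots> = A \<bullet> (B ** transpose M)"
    by (metis inner_transpose matrix_transpose_mul transpose_transpose)
  finally show ?thesis .
qed

lemma norm_sq_cart: "(norm (v :: real^'n))\<^sup>2 = (\<Sum>i\<in>UNIV. (v $ i)\<^sup>2)"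
  by (simp add: norm_vec_def L2_set_def sum_nonneg)

lemma norm_mat_columns: "(norm (A :: real^'n^'m))\<^sup>2 = (\<Sum>j\<in>UNIV. (norm (column j A))\<^sup>2)"
proof -
  have "(norm A)\<^sup>2 = (\<Sum>i\<in>UNIV. \<Sum>j\<in>UNIV. A $ i $ j * A $ i $ j)"
    by (simp add: power2_norm_eq_inner inner_mat)
  also have "\<dots> = (\<Sum>j\<in>UNIV. \<Sum>i\<in>UNIV. A $ i $ j * A $ i $ j)"
    by (rule sum.swap)
  finally show ?thesis
    by (simp add: power2_norm_eq_inner inner_vec_def column_def)
qed

lemma norm_mat_entry: "\<bar>(A :: real^'n^'m) $ i $ j\<bar> \<le> norm A"
  using component_le_norm_cart[of "A $ i" j] Finite_Cartesian_Product.norm_nth_le[of A i] by linarith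

text \<open>Upper bounds on the spectral norm are kept as a predicate: such a bound passes through
  sums, products and transposes without evaluating a supremum, and "contraction" is
  \<open>op_bound 1\<close>.\<close>

definition op_bound :: "real \<Rightarrow> real^'n^'m \<Rightarrow> bool"
  where "op_bound c A \<longleftrightarrow> (\<forall>z. norm (A *v z) \<le> c * norm z)"

lemma op_boundD: "op_bound c A \<Longrightarrow> norm (A *v z) \<le> c * norm z"
  by (simp add: op_bound_def)

lemma op_bound_inner:
  assumes "op_bound c A"
  shows "x \<bullet> (A *v y) \<le> c * norm x * norm y"
proof -
  have "x \<bullet> (A *v y) \<le> norm x * norm (A *v y)"
    by (rule norm_cauchy_schwarz)
  also have "\<dots> \<le> norm x * (c * norm y)"
    using op_boundD[OF assms] by (intro mult_left_mono) auto
  finally show ?thesis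
    by (simp add: mult_ac)
qed

lemma op_bound_nonneg:
  assumes "op_bound c (A :: real^'n^'m)"
  shows "0 \<le> c"
proof -
  have "0 \<le> c * norm (axis undefined 1 :: real^'n)"
    using op_boundD[OF assms] norm_ge_zero order_trans by blast
  then show ?thesis by (simp add: norm_axis_1)
qed

lemma op_bound_transpose:
  assumes "op_bound c (A :: real^'n^'m)"
  shows "op_bound c (transpose A)"
  unfolding op_bound_def
proof
  fix z :: "real^'m"
  have "(norm (transpose A *v z))\<^sup>2 = z \<bullet> (A *v (transpose A *v z))"
    by (simp add: power2_norm_eq_inner dot_lmul_matrix)
  also have "\<dots> \<le> c * norm z * norm (transpose A *v z)"
    by (rule op_bound_inner[OF assms])
  finally have "norm (transpose A *v z) * norm (transpose A *v z) \<le> c * norm z * norm (transpose A *v z)"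
    by (simp add: power2_eq_square)
  moreover have "0 \<le> c * norm z"
    using op_bound_nonneg[OF assms] by simp
  ultimately show "norm (transpose A *v z) \<le> c * norm z"
    by (metis mult_right_le_imp_le norm_ge_zero order_le_less)
qed

lemma op_bound_mono: "op_bound c A \<Longrightarrow> c \<le> d \<Longrightarrow> op_bound d A"
  unfolding op_bound_def by (meson mult_right_mono norm_ge_zero order_trans)

lemma op_bound_add: "op_bound c A \<Longrightarrow> op_bound d B \<Longrightarrow> op_bound (c + d) (A + B)"
  unfolding op_bound_def
  by (simp add: matrix_vector_mult_add_rdistrib distrib_right) (meson add_mono norm_triangle_le)

lemma op_bound_scaleR: "op_bound c A \<Longrightarrow> op_bound (\<bar>x\<bar> * c) (x *\<^sub>R A)"
  unfolding op_bound_def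
  by (simp add: scaleR_matrix_vector_assoc[symmetric] mult.assoc mult_left_mono)

lemma op_bound_minus: "op_bound c A \<Longrightarrow> op_bound c (- A)"
  using op_bound_scaleR[of c A "-1"] by simp

lemma op_bound_mult:
  assumes "op_bound c A" "op_bound d B"
  shows "op_bound (c * d) (A ** B)"
  unfolding op_bound_def
proof
  fix z
  have "norm ((A ** B) *v z) \<le> c * norm (B *v z)"
    using op_boundD[OF assms(1)] by (simp add: matrix_vector_mul_assoc[symmetric])
  also have "\<dots> \<le> c * (d * norm z)"
    using op_boundD[OF assms(2)] op_bound_nonneg[OF assms(1)] by (intro mult_left_mono)
  finally show "norm ((A ** B) *v z) \<le> c * d * norm z"
    by (simp add: mult_ac)
qed

text \<open>The spectral bound applies to each column, and the squared Frobenius norm is the sum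
  over the columns. This mixed estimate is sharper than \<open>norm_matmul\<close> and keeps the
  constants of the descent estimate small.\<close>

lemma norm_matmul_left:
  assumes "op_bound c (A :: real^'k^'m)"
  shows "norm (A ** (B :: real^'n^'k)) \<le> c * norm B"
proof -
  have c: "0 \<le> c" by (rule op_bound_nonneg[OF assms])
  have col: "column j (A ** B) = A *v column j B" for j
    by (simp add: vec_eq_iff column_def matrix_matrix_mult_def matrix_vector_mult_def)
  have "(norm (A ** B))\<^sup>2 = (\<Sum>j\<in>UNIV. (norm (A *v column j B))\<^sup>2)"
    by (simp add: norm_mat_columns col)
  also have "\<dots> \<le> (\<Sum>j\<in>UNIV. (c * norm (column j B))\<^sup>2)"
    using op_boundD[OF assms] by (intro sum_mono power_mono) auto
  also have "\<dots> = (c * norm B)\<^sup>2"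
    by (simp add: norm_mat_columns power_mult_distrib sum_distrib_left)
  finally show ?thesis
    using c by (meson mult_nonneg_nonneg norm_ge_zero power2_le_imp_le)
qed

lemma norm_matmul_right:
  assumes "op_bound c (B :: real^'n^'k)"
  shows "norm ((A :: real^'k^'m) ** B) \<le> c * norm A"
  using norm_matmul_left[OF op_bound_transpose[OF assms], of "transpose A"]
  by (simp add: matrix_transpose_mul[symmetric])

lemma op_bound_norm: "op_bound (norm A) (A :: real^'n^'m)"
  unfolding op_bound_def
proof
  fix z :: "real^'n"
  have "(norm (A *v z))\<^sup>2 = (\<Sum>i\<in>UNIV. (A $ i \<bullet> z)\<^sup>2)"
    by (simp only: norm_sq_cart matrix_vector_mul_component)
  also have "\<dots> \<le> (\<Sum>i\<in>UNIV. (norm (A $ i))\<^sup>2 * (norm z)\<^sup>2)"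
    by (intro sum_mono) (metis Cauchy_Schwarz_ineq2 abs_le_square_iff abs_mult abs_norm_cancel power_mult_distrib)
  also have "\<dots> = (norm A * norm z)\<^sup>2"
    by (simp add: power_mult_distrib power2_norm_eq_inner inner_vec_def sum_distrib_right)
  finally show "norm (A *v z) \<le> norm A * norm z"
    by (meson mult_nonneg_nonneg norm_ge_zero power2_le_imp_le)
qed

lemma norm_matmul: "norm ((A :: real^'k^'m) ** (B :: real^'n^'k)) \<le> norm A * norm B"
  by (rule norm_matmul_left[OF op_bound_norm])

lemma matrix_diff_ldistrib: "A ** (B - C) = A ** B - A ** (C :: real^'n^'k)"
  and matrix_diff_rdistrib: "(A' - B') ** C = A' ** C - B' ** (C :: real^'n^'k)"
  and matrix_minus_left: "(- A') ** C = - (A' ** C)"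
  and matrix_minus_right: "A' ** (- C) = - (A' ** C)"
  for A :: "real^'k^'m" and A' :: "real^'k^'m"
  by (simp_all add: vec_eq_iff matrix_matrix_mult_def algebra_simps sum_subtractf sum_negf)

lemma matrix_add_rdistrib': "(A + B) ** C = A ** C + (B :: real^'k^'m) ** (C :: real^'n^'k)"
  by (simp add: vec_eq_iff matrix_matrix_mult_def algebra_simps sum.distrib)

lemma matrix_zero_left [simp]: "(0 :: real^'k^'m) ** (C :: real^'n^'k) = 0"
  and matrix_zero_right [simp]: "(A :: real^'k^'m) ** (0 :: real^'n^'k) = 0"
  by (simp_all add: vec_eq_iff matrix_matrix_mult_def)

lemma matrix_scaleR_left: "(x *\<^sub>R A) ** C = x *\<^sub>R (A ** C)"
  and matrix_scaleR_right: "A ** (x *\<^sub>R C) = x *\<^sub>R (A ** C)"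
  for A :: "real^'k^'m" and C :: "real^'n^'k"
  by (simp_all add: vec_eq_iff matrix_matrix_mult_def algebra_simps sum_distrib_left)

lemmas matrix_distribs = matrix_diff_ldistrib matrix_diff_rdistrib matrix_minus_left matrix_minus_right
  matrix_add_rdistrib' matrix_add_ldistrib matrix_scaleR_left matrix_scaleR_right

lemma bounded_bilinear_matrix: "bounded_bilinear ((**) :: real^'k^'m \<Rightarrow> real^'n^'k \<Rightarrow> real^'n^'m)"
proof (rule bounded_bilinear.intro)
  show "\<exists>K. \<forall>(a :: real^'k^'m) (b :: real^'n^'k). norm (a ** b) \<le> norm a * norm b * K"
    by (rule exI[of _ 1]) (simp add: norm_matmul)
qed (simp_all add: matrix_distribs)

lemmas tendsto_matrix [tendsto_intros] = bounded_bilinear.tendsto[OF bounded_bilinear_matrix]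
lemmas tendsto_transpose [tendsto_intros] = bounded_linear.tendsto[OF bounded_linear_transpose]
lemmas continuous_on_matrix [continuous_intros] = bounded_bilinear.continuous_on[OF bounded_bilinear_matrix]
lemmas continuous_on_transpose [continuous_intros] = bounded_linear.continuous_on[OF bounded_linear_transpose]

section \<open>Orthogonal and skew-symmetric matrices\<close>

lemma orthogonal_matrixD:
  assumes "orthogonal_matrix (U :: real^'n^'n)"
  shows "transpose U ** U = mat 1" "U ** transpose U = mat 1"
    "transpose U ** (U ** A) = A" "U ** (transpose U ** A) = A"
    "(B ** transpose U) ** U = B" "(B ** U) ** transpose U = B"
  using assms by (auto simp: orthogonal_matrix_def matrix_mul_assoc) (simp_all add: matrix_mul_assoc[symmetric])

lemma op_bound_orthogonal: "orthogonal_matrix U \<Longrightarrow> op_bound 1 U"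
  unfolding op_bound_def
  by (simp add: norm_eq_sqrt_inner) (metis dot_lmul_matrix matrix_vector_mul_assoc matrix_vector_mul_lid
    orthogonal_matrixD(1) transpose_matrix_vector order_refl)

lemma op_bound_conjugate:
  assumes "orthogonal_matrix U" "orthogonal_matrix V" "op_bound c M"
  shows "op_bound c (U ** M ** V)"
  using op_bound_mult[OF op_bound_mult[OF op_bound_orthogonal[OF assms(1)] assms(3)] op_bound_orthogonal[OF assms(2)]]
  by simp

lemma norm_orthogonal_left [simp]:
  assumes "orthogonal_matrix U"
  shows "norm (U ** (A :: real^'n^'m)) = norm A"
  using assms by (simp add: norm_eq_sqrt_inner matrix_inner_left orthogonal_matrixD)

lemma norm_orthogonal_right [simp]:
  assumes "orthogonal_matrix V"
  shows "norm ((A :: real^'n^'m) ** V) = norm A"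
  using assms by (simp add: norm_eq_sqrt_inner matrix_inner_right orthogonal_matrixD)

lemma inner_matrix_vector: "x \<bullet> (A *v y) = (\<chi> i j. x $ i * y $ j) \<bullet> (A :: real^'n^'m)"
  by (simp add: inner_vec_def matrix_vector_mult_def sum_distrib_left mult_ac)

lemma norm_outer: "norm ((\<chi> i j. x $ i * y $ j) :: real^'n^'m) = norm x * norm y"
proof -
  have "(norm ((\<chi> i j. x $ i * y $ j) :: real^'n^'m))\<^sup>2 = (norm x * norm y)\<^sup>2"
    by (simp add: power_mult_distrib power2_norm_eq_inner inner_vec_def sum_product mult_ac)
  then show ?thesis by simp
qed

text \<open>The factor \<open>1 / sqrt 2\<close> is what makes the explicit stepsizes admissible.\<close>

lemma op_bound_skew:
  assumes "transpose E = - (E :: real^'n^'n)"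
  shows "op_bound (norm E / sqrt 2) E"
  unfolding op_bound_def
proof
  fix z :: "real^'n"
  define w where "w = E *v z"
  \<comment> \<open>\<open>W\<close> is the rank-one matrix of \<open>w\<close> and
    \<open>z\<close>. Pairing with a skew matrix sees only the skew part of \<open>W\<close>, and
    \<open>W - transpose W\<close> has norm at most \<open>sqrt 2 * norm W\<close> instead of
    \<open>2 * norm W\<close>, since \<open>W \<bullet> transpose W\<close> is a square.\<close>
  define W where "W = ((\<chi> i j. w $ i * z $ j) :: real^'n^'n)"
  have tW: "transpose W = (\<chi> i j. z $ i * w $ j)"
    by (simp add: W_def transpose_def vec_eq_iff mult_ac)
  have "(norm w)\<^sup>2 = W \<bullet> E"
    by (simp add: power2_norm_eq_inner W_def inner_matrix_vector[symmetric] w_def)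
  moreover have "transpose W \<bullet> E = - (W \<bullet> E)"
    by (metis assms inner_minus_right inner_transpose transpose_transpose)
  ultimately have "2 * (norm w)\<^sup>2 = (W - transpose W) \<bullet> E"
    by (simp add: inner_diff_left)
  also have "\<dots> \<le> norm (W - transpose W) * norm E"
    by (rule norm_cauchy_schwarz)
  finally have 1: "2 * (norm w)\<^sup>2 \<le> norm (W - transpose W) * norm E" .
  have "W \<bullet> transpose W = (w \<bullet> z)\<^sup>2"
    unfolding tW by (simp add: W_def inner_mat) (simp add: inner_vec_def power2_eq_square sum_product mult_ac)
  then have "(norm (W - transpose W))\<^sup>2 \<le> 2 * (norm W)\<^sup>2"
    by (simp add: power2_norm_eq_inner inner_diff inner_commute)
  also have "\<dots> = (sqrt 2 * (norm w * norm z))\<^sup>2"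
    by (simp add: W_def norm_outer power_mult_distrib)
  finally have "norm (W - transpose W) \<le> sqrt 2 * (norm w * norm z)"
    by (rule power2_le_imp_le) auto
  with 1 have "2 * (norm w)\<^sup>2 \<le> sqrt 2 * (norm w * norm z) * norm E"
    by (meson mult_right_mono norm_ge_zero order_trans)
  then have "sqrt 2 * (norm w * (sqrt 2 * norm w)) \<le> sqrt 2 * (norm w * (norm E * norm z))"
    by (simp add: power2_eq_square mult_ac)
  then have "norm w * (sqrt 2 * norm w) \<le> norm w * (norm E * norm z)"
    by (rule mult_left_le_imp_le) simp
  then have "sqrt 2 * norm w \<le> norm E * norm z"
    by (cases "norm w = 0") (auto simp: mult_le_cancel_left)
  then show "norm (E *v z) \<le> norm E / sqrt 2 * norm z"
    by (simp add: w_def field_simps)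
qed

lemma orthogonal_matrix_limit:
  assumes "\<And>k. orthogonal_matrix (U k :: real^'n^'n)" "U \<longlonglongrightarrow> U'"
  shows "orthogonal_matrix U'"
proof -
  have "(\<lambda>k. transpose (U k) ** U k) \<longlonglongrightarrow> transpose U' ** U'"
    by (intro tendsto_intros assms)
  then show ?thesis
    by (simp add: orthogonal_matrixD(1)[OF assms(1)] LIMSEQ_const_iff orthogonal_matrix)
qed

section \<open>Rectangular diagonal matrices\<close>

lemma index_pos_less_iff: "index_pos i < index_pos j \<longleftrightarrow> i < j"
proof -
  have *: "index_pos i < index_pos j" if "i < j" for i j :: 'a
    unfolding index_pos_def using that by (intro psubset_card_mono) auto
  show ?thesis
    using *[of i j] *[of j i] by (cases i j rule: linorder_cases) auto
qed

lemma index_pos_eq_iff [simp]: "index_pos i = index_pos j \<longleftrightarrow> i = j"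
  by (metis index_pos_less_iff less_irrefl neq_iff)

lemma range_index_pos: "range (index_pos :: 'a::{finite,linorder} \<Rightarrow> nat) = {..<CARD('a)}"
proof (rule card_subset_eq)
  have "index_pos i < CARD('a)" for i :: 'a
    unfolding index_pos_def by (intro psubset_card_mono) auto
  then show "range (index_pos :: 'a \<Rightarrow> nat) \<subseteq> {..<CARD('a)}" by auto
  show "card (range (index_pos :: 'a \<Rightarrow> nat)) = card {..<CARD('a)}"
    by (simp add: card_image inj_on_def)
qed simp

text \<open>The embedding of column indices into row indices by position, so that
  \<open>(row_of j, j)\<close> are the diagonal places. It is the description inside
  \<open>diag_of\<close>, and it is meaningful once there are at least as many rows as
  columns.\<close>

definition row_of :: "'n::{finite,linorder} \<Rightarrow> 'm::{finite,linorder}"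
  where "row_of j = (THE i. index_pos i = index_pos j)"

context
  assumes nm: "CARD('n::{finite,linorder}) \<le> CARD('m::{finite,linorder})"
begin

lemma index_pos_row_of: "index_pos (row_of (j :: 'n) :: 'm) = index_pos j"
proof -
  have "index_pos j \<in> range (index_pos :: 'n \<Rightarrow> nat)"
    by simp
  then have "index_pos j \<in> range (index_pos :: 'm \<Rightarrow> nat)"
    using nm by (simp only: range_index_pos lessThan_iff)
  then obtain i :: 'm where i: "index_pos i = index_pos j" by auto
  have "(row_of j :: 'm) = i"
    unfolding row_of_def by (rule the_equality, rule i) (metis i index_pos_eq_iff)
  with i show ?thesis by simp
qed

lemma row_of_iff: "index_pos (i :: 'm) = index_pos (j :: 'n) \<longleftrightarrow> i = row_of j"
  by (simp flip: index_pos_row_of)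

lemma row_of_inject [simp]: "(row_of j :: 'm) = row_of (k :: 'n) \<longleftrightarrow> j = k"
  by (metis index_pos_row_of index_pos_eq_iff)

lemma diag_matrix_nth: "(diag_matrix x :: ('m,'n) mat) $ i $ j = (if i = row_of j then x $ j else 0)"
  by (simp add: diag_matrix_def row_of_iff)

lemma diag_of_nth: "diag_of (M :: ('m,'n) mat) $ j = M $ row_of j $ j"
  by (simp add: diag_of_def row_of_def)

lemma inner_diag: "(M :: ('m,'n) mat) \<bullet> diag_matrix x = (\<Sum>j\<in>UNIV. x $ j * M $ row_of j $ j)"
proof -
  have "M \<bullet> diag_matrix x = (\<Sum>i\<in>UNIV. \<Sum>j\<in>UNIV. if i = row_of j then x $ j * M $ i $ j else 0)"
    unfolding inner_mat by (intro sum.cong) (auto simp: diag_matrix_nth)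
  also have "\<dots> = (\<Sum>j\<in>UNIV. \<Sum>i\<in>UNIV. if i = row_of j then x $ j * M $ i $ j else 0)"
    by (rule sum.swap)
  also have "\<dots> = (\<Sum>j\<in>UNIV. x $ j * M $ row_of j $ j)"
    by simp
  finally show ?thesis .
qed

lemma norm_diag_matrix [simp]: "norm (diag_matrix x :: ('m,'n) mat) = norm x"
  by (simp add: norm_eq_sqrt_inner inner_diag diag_matrix_nth) (simp add: inner_vec_def)

lemma diag_matrix_mult_vec:
  "(diag_matrix x :: ('m,'n) mat) *v z = (\<Sum>j\<in>UNIV. (x $ j * z $ j) *\<^sub>R axis (row_of j) 1)"
  by (simp add: vec_eq_iff matrix_vector_mult_def diag_matrix_nth axis_def if_distrib if_distribR cong: if_cong)

lemma norm_diag_matrix_mult_vec: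
  "(norm ((diag_matrix x :: ('m,'n) mat) *v z))\<^sup>2 = (\<Sum>j\<in>UNIV. (x $ j * z $ j)\<^sup>2)"
proof -
  have "(norm ((diag_matrix x :: ('m,'n) mat) *v z))\<^sup>2
      = (\<Sum>j\<in>UNIV. \<Sum>k\<in>UNIV. if j = k then (x $ j * z $ j) * (x $ k * z $ k) else 0)"
    unfolding diag_matrix_mult_vec power2_norm_eq_inner inner_sum_left inner_sum_right
    by (subst sum.swap) (intro sum.cong, auto simp: inner_axis_axis)
  then show ?thesis
    by (simp add: power2_eq_square)
qed

lemma op_bound_diag_matrix:
  assumes "\<And>j. \<bar>x $ j\<bar> \<le> c"
  shows "op_bound c (diag_matrix x :: ('m,'n) mat)"
  unfolding op_bound_def
proof
  fix z :: "'n rvec"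
  have c: "0 \<le> c" using assms[of undefined] by linarith
  have "(norm ((diag_matrix x :: ('m,'n) mat) *v z))\<^sup>2 \<le> (\<Sum>j\<in>UNIV. c\<^sup>2 * (z $ j)\<^sup>2)"
    unfolding norm_diag_matrix_mult_vec power_mult_distrib
    by (intro sum_mono mult_right_mono) (use assms c abs_le_square_iff in fastforce)+
  also have "\<dots> = (c * norm z)\<^sup>2"
    by (simp add: power_mult_distrib power2_norm_eq_inner inner_vec_def sum_distrib_left)
      (simp add: power2_eq_square)
  finally show "norm ((diag_matrix x :: ('m,'n) mat) *v z) \<le> c * norm z"
    using c by (meson mult_nonneg_nonneg norm_ge_zero power2_le_imp_le)
qed

lemma diag_mult_nth:
  "((diag_matrix s :: ('m,'n) mat) ** M) $ row_of i $ j = s $ i * M $ i $ j"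
  "((M' :: ('k::finite,'m) mat) ** diag_matrix s) $ q $ i = M' $ q $ row_of i * s $ i"
  "(transpose (diag_matrix s :: ('m,'n) mat) ** M'') $ i $ j = s $ i * M'' $ row_of i $ j"
  "(K ** transpose (diag_matrix s :: ('m,'n) mat)) $ q $ p = (\<Sum>l\<in>UNIV. if p = row_of l then K $ q $ l * s $ l else 0)"
proof -
  have "((diag_matrix s :: ('m,'n) mat) ** M) $ row_of i $ j = (\<Sum>l\<in>UNIV. if l = i then s $ i * M $ i $ j else 0)"
    by (simp only: matrix_matrix_mult_def vec_lambda_beta, intro sum.cong)
      (auto simp: diag_matrix_nth)
  then show "((diag_matrix s :: ('m,'n) mat) ** M) $ row_of i $ j = s $ i * M $ i $ j" by simp
  have "((M' :: ('k::finite,'m) mat) ** diag_matrix s) $ q $ i = (\<Sum>l\<in>(UNIV :: 'm set). if l = row_of i then M' $ q $ row_of i * s $ i else 0)"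
    by (simp only: matrix_matrix_mult_def vec_lambda_beta, intro sum.cong)
      (auto simp: diag_matrix_nth)
  then show "((M' :: ('k::finite,'m) mat) ** diag_matrix s) $ q $ i = M' $ q $ row_of i * s $ i" by simp
  have "(transpose (diag_matrix s :: ('m,'n) mat) ** M'') $ i $ j = (\<Sum>l\<in>(UNIV :: 'm set). if l = row_of i then s $ i * M'' $ row_of i $ j else 0)"
    by (simp only: matrix_matrix_mult_def vec_lambda_beta, intro sum.cong)
      (auto simp: diag_matrix_nth transpose_def)
  then show "(transpose (diag_matrix s :: ('m,'n) mat) ** M'') $ i $ j = s $ i * M'' $ row_of i $ j" by simp
  show "(K ** transpose (diag_matrix s :: ('m,'n) mat)) $ q $ p = (\<Sum>l\<in>UNIV. if p = row_of l then K $ q $ l * s $ l else 0)"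
    by (simp only: matrix_matrix_mult_def vec_lambda_beta, intro sum.cong)
      (auto simp: diag_matrix_nth transpose_def)
qed

text \<open>Both rotations move to \<open>Z\<close> by adjointness, and a diagonal matrix sees only
  diagonal entries. Every duality argument below becomes a scalar sum in this way.\<close>

lemma inner_assemble:
  "(Z :: ('m,'n) mat) \<bullet> assemble s U V = (\<Sum>j\<in>UNIV. s $ j * (U ** Z ** transpose V) $ row_of j $ j)"
proof -
  have "assemble s U V \<bullet> Z = diag_matrix s \<bullet> (U ** Z ** transpose V)"
    unfolding assemble_def matrix_inner_right[of "transpose U ** diag_matrix s"] matrix_inner_left[of "transpose U"]
    by (simp add: matrix_mul_assoc)
  then have "Z \<bullet> assemble s U V = (U ** Z ** transpose V) \<bullet> diag_matrix s"
    by (simp add: inner_commute)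
  then show ?thesis by (simp add: inner_diag)
qed

end

lemma assemble_rotate:
  assumes "orthogonal_matrix U" "orthogonal_matrix V"
  shows "U ** assemble s U V ** transpose V = diag_matrix s"
  using assms by (simp add: assemble_def matrix_mul_assoc orthogonal_matrixD)

lemma rotate_eq_assemble:
  assumes "orthogonal_matrix U" "orthogonal_matrix V" "U ** X ** transpose V = diag_matrix s"
  shows "X = assemble s U V"
  unfolding assemble_def assms(3)[symmetric]
  using assms(1,2) by (simp add: orthogonal_matrixD matrix_mul_assoc)

lemma op_bound_entry: "op_bound c (A :: real^'n^'m) \<Longrightarrow> \<bar>A $ i $ j\<bar> \<le> c"
proof -
  assume A: "op_bound c A"
  have "\<bar>A $ i $ j\<bar> \<le> norm (A *v axis j 1)"
    using component_le_norm_cart[of "A *v axis j 1" i]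
    by (simp add: matrix_vector_mult_def axis_def if_distrib cong: if_cong)
  also have "\<dots> \<le> c" using op_boundD[OF A, of "axis j 1"] by (simp add: norm_axis_1)
  finally show ?thesis .
qed

section \<open>Singular value decomposition\<close>

text \<open>The infinitesimal rotation in the plane of the coordinates \<open>p\<close> and
  \<open>q\<close>; its square is minus the identity on that plane.\<close>

definition plane_skew :: "'k \<Rightarrow> 'k \<Rightarrow> real^'k^'k"
  where "plane_skew p q = (\<chi> i j. (if i = p \<and> j = q then 1 else 0) - (if i = q \<and> j = p then 1 else 0))"

lemma plane_skew_mult:
  "plane_skew p q ** A = (\<chi> i. (if i = p then A $ q else 0) - (if i = q then A $ p else 0))"
proof -
  have "(\<Sum>k\<in>UNIV. ((if i = p \<and> k = q then 1 else 0) - (if i = q \<and> k = p then 1 else 0)) * A $ k $ j)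
      = (\<Sum>k\<in>UNIV. if k = q then (if i = p then A $ k $ j else 0) else 0)
        - (\<Sum>k\<in>UNIV. if k = p then (if i = q then A $ k $ j else 0) else 0)" for i j
    unfolding sum_subtractf[symmetric] by (intro sum.cong) auto
  then show ?thesis
    by (simp add: vec_eq_iff plane_skew_def matrix_matrix_mult_def)
qed

lemma transpose_plane_skew: "transpose (plane_skew p q) = - plane_skew p q"
  by (simp add: transpose_def plane_skew_def vec_eq_iff conj_commute)

lemma plane_skew_cube:
  "p \<noteq> q \<Longrightarrow> plane_skew p q ** (plane_skew p q ** (plane_skew p q ** A)) = - (plane_skew p q ** A)"
  by (simp add: plane_skew_mult vec_eq_iff)

text \<open>The rotation by the angle with tangent of the half angle equal to \<open>u\<close>.\<close>

definition plane_rotation :: "'k \<Rightarrow> 'k \<Rightarrow> real \<Rightarrow> real^'k^'k"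
  where "plane_rotation p q u = (let K = plane_skew p q in
    mat 1 + (2 * u\<^sup>2 / (1 + u\<^sup>2)) *\<^sub>R (K ** K) + (2 * u / (1 + u\<^sup>2)) *\<^sub>R K)"

text \<open>Since the cube of \<open>K\<close> is \<open>- K\<close>, the product with the transpose
  collapses to the identity plus \<open>2 * x - x * x - y * y\<close> times \<open>K ** K\<close>.
  Here \<open>x\<close> is one minus the cosine and \<open>y\<close> the sine of the angle, so the
  coefficient is zero. The rational form keeps optimality conditions polynomial in
  \<open>u\<close>.\<close>

lemma orthogonal_plane_rotation:
  assumes "p \<noteq> q"
  shows "orthogonal_matrix (plane_rotation p q u)"
proof -
  define K where "K = plane_skew p q"
  define x where "x = 2 * u\<^sup>2 / (1 + u\<^sup>2)"
  define y where "y = 2 * u / (1 + u\<^sup>2)"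
  have "1 + u\<^sup>2 \<noteq> 0" by (metis add_nonneg_eq_0_iff zero_le_one zero_le_power2 zero_neq_one)
  then have xy: "2 * x - x * x - y * y = 0"
    unfolding x_def y_def by (simp add: divide_simps power2_eq_square) (simp add: algebra_simps)
  have cube: "K ** (K ** K) = - K"
    using plane_skew_cube[OF assms, of "mat 1"] by (simp add: K_def)
  have tK: "transpose K = - K" by (simp add: K_def transpose_plane_skew)
  have R: "plane_rotation p q u = mat 1 + x *\<^sub>R (K ** K) + y *\<^sub>R K"
    by (simp add: plane_rotation_def K_def x_def y_def Let_def)
  have tR: "transpose (plane_rotation p q u) = mat 1 + x *\<^sub>R (K ** K) - y *\<^sub>R K"
    by (simp add: R transpose_add transpose_scalar matrix_transpose_mul tK matrix_distribs)
  have "transpose (plane_rotation p q u) ** plane_rotation p q u = mat 1 + (2 * x - x * x - y * y) *\<^sub>R (K ** K)"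
    unfolding tR unfolding R
    by (simp add: matrix_distribs cube matrix_mul_assoc[symmetric] scaleR_diff_left scaleR_add_left algebra_simps)
      (simp add: vec_eq_iff)
  then show ?thesis by (simp add: orthogonal_matrix xy)
qed

lemma quadratic_nonpos_linear_zero:
  fixes a b :: real
  assumes "\<And>u. a * u\<^sup>2 + b * u \<le> 0"
  shows "b = 0"
proof (rule ccontr)
  assume b: "b \<noteq> 0"
  define t where "t = b / (\<bar>a\<bar> + 1)"
  have "a * t\<^sup>2 + b * t = (b\<^sup>2 / (\<bar>a\<bar> + 1)\<^sup>2) * (a + \<bar>a\<bar> + 1)"
  proof -
    have "\<bar>a\<bar> + 1 \<noteq> 0" by linarith
    then show ?thesis unfolding t_def by (simp add: divide_simps power2_eq_square) (simp add: algebra_simps)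
  qed
  moreover have "\<dots> > 0"
    using b by (intro mult_pos_pos divide_pos_pos) auto
  ultimately show False using assms[of t] by linarith
qed

text \<open>First-order optimality along the plane rotations: after multiplication by
  \<open>1 + u\<^sup>2\<close> the change of the objective is a quadratic in \<open>u\<close>
  without constant term, so its linear coefficient \<open>2 * ((K ** M) \<bullet> D)\<close> must
  vanish.\<close>

lemma rotation_maximal_symmetric:
  fixes M D :: "real^'n^'m"
  assumes max: "\<And>R. orthogonal_matrix R \<Longrightarrow> (R ** M) \<bullet> D \<le> M \<bullet> D"
  shows "M $ q \<bullet> D $ p = M $ p \<bullet> D $ q"
proof (cases "p = q")
  case False
  define K where "K = plane_skew p q"
  have "(2 * ((K ** K ** M) \<bullet> D)) * u\<^sup>2 + (2 * ((K ** M) \<bullet> D)) * u \<le> 0" for u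
  proof -
    have pos: "0 < 1 + u\<^sup>2" by (simp add: add_pos_nonneg)
    have "(2 * u\<^sup>2 / (1 + u\<^sup>2)) * ((K ** K ** M) \<bullet> D) + (2 * u / (1 + u\<^sup>2)) * ((K ** M) \<bullet> D) \<le> 0"
      using max[OF orthogonal_plane_rotation[OF False, of u]]
      by (simp add: plane_rotation_def Let_def matrix_distribs inner_add_left K_def)
    then have "((2 * ((K ** K ** M) \<bullet> D)) * u\<^sup>2 + (2 * ((K ** M) \<bullet> D)) * u) / (1 + u\<^sup>2) \<le> 0"
      by (simp add: add_divide_distrib mult_ac)
    then show ?thesis using pos by (simp add: divide_le_0_iff)
  qed
  then have "2 * ((K ** M) \<bullet> D) = 0"
    by (rule quadratic_nonpos_linear_zero)
  moreover have "(K ** M) \<bullet> D = M $ q \<bullet> D $ p - M $ p \<bullet> D $ q"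
  proof -
    have "(K ** M) \<bullet> D = (\<Sum>i\<in>UNIV. (if i = p then M $ q \<bullet> D $ p else 0) - (if i = q then M $ p \<bullet> D $ q else 0))"
      unfolding K_def plane_skew_mult inner_vec_def[of _ D]
      by (intro sum.cong) (auto simp: inner_diff_left)
    then show ?thesis by (simp add: sum_subtractf)
  qed
  ultimately show ?thesis by simp
qed simp

lemma compact_orthogonal: "compact {U :: real^'k^'k. orthogonal_matrix U}"
proof -
  have "closed {U :: real^'k^'k. transpose U ** U = mat 1}"
    by (intro closed_Collect_eq continuous_intros)
  moreover have "bounded {U :: real^'k^'k. transpose U ** U = mat 1}"
  proof (rule boundedI)
    fix U :: "real^'k^'k" assume "U \<in> {U. transpose U ** U = mat 1}"
    then show "norm U \<le> norm (mat 1 :: real^'k^'k)"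
      using norm_orthogonal_left[of U "mat 1"] by (simp add: orthogonal_matrix)
  qed
  ultimately show ?thesis by (simp add: orthogonal_matrix compact_eq_bounded_closed)
qed

definition perm_matrix :: "('k \<Rightarrow> 'k) \<Rightarrow> real^'k^'k"
  where "perm_matrix p = (\<chi> i j. if j = p i then 1 else 0)"

lemma perm_matrix_mult: "perm_matrix p ** A = (\<chi> i. A $ p i)"
  by (simp add: vec_eq_iff perm_matrix_def matrix_matrix_mult_def if_distrib if_distribR cong: if_cong)

lemma orthogonal_perm_matrix:
  assumes "p \<circ> p = id"
  shows "orthogonal_matrix (perm_matrix p)"
proof -
  have "p (p i) = i" for i using assms by (metis comp_apply id_apply)
  then have "transpose (perm_matrix p) = perm_matrix p" "(\<chi> i. perm_matrix p $ p i) = mat 1"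
    by (auto simp: perm_matrix_def transpose_def vec_eq_iff mat_def)
  then show ?thesis by (simp add: orthogonal_matrix perm_matrix_mult)
qed


text \<open>
  A maximizer of \<open>\<Sum>\<^sub>i w\<^sub>i (U X V\<^sup>T)\<^sub>i\<^sub>i\<close> over orthogonal \<open>U\<close>, \<open>V\<close>, for distinct positive weights
  \<open>w\<close>, diagonalizes \<open>X\<close>: stationarity under plane rotations on both sides kills the off-diagonal entries.
\<close>

theorem svd_exists:
  fixes X :: "('m::{finite,linorder},'n::{finite,linorder}) mat"
  assumes nm: "CARD('n) \<le> CARD('m)"
  shows "\<exists>s U V. (\<forall>i. 0 \<le> s $ i) \<and> (\<forall>i j. i \<le> j \<longrightarrow> s $ j \<le> s $ i) \<and>
    orthogonal_matrix U \<and> orthogonal_matrix V \<and> X = assemble s U V"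
proof -
  \<comment> \<open>Positivity of these weights will force nonnegative singular values, their strict
    decrease will force the ordering, and distinctness of their squares will force off-diagonal
    entries to vanish.\<close>
  define w :: "'n rvec" where "w = (\<chi> j. real (CARD('n) - index_pos j))"
  have bound: "index_pos j < CARD('n)" for j :: 'n
    using range_index_pos[where 'a='n] by (metis lessThan_iff rangeI)
  have w_pos: "0 < w $ j" for j
    using bound[of j] by (simp add: w_def)
  have w_less: "w $ j < w $ i" if "i < j" for i j
    using that bound[of j] index_pos_less_iff[of i j] by (simp only: w_def vec_lambda_beta of_nat_less_iff) arith
  define D where "D = (diag_matrix w :: ('m,'n) mat)"
  define S where "S = {U :: ('m,'m) mat. orthogonal_matrix U} \<times> {V :: ('n,'n) mat. orthogonal_matrix V}"
  define g where "g = (\<lambda>P :: ('m,'m) mat \<times> ('n,'n) mat. (fst P ** X ** transpose (snd P)) \<bullet> D)"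
  have "\<exists>P\<in>S. \<forall>Q\<in>S. g Q \<le> g P"
  proof (rule continuous_attains_sup)
    show "compact S" unfolding S_def by (intro compact_Times compact_orthogonal)
    have "(mat 1, mat 1) \<in> S" by (simp add: S_def orthogonal_matrix_id)
    then show "S \<noteq> {}" by blast
    show "continuous_on S g" unfolding g_def by (intro continuous_intros)
  qed
  then obtain U V where UV: "orthogonal_matrix U" "orthogonal_matrix V"
    and max: "\<And>P Q. orthogonal_matrix P \<Longrightarrow> orthogonal_matrix Q \<Longrightarrow>
      (P ** X ** transpose Q) \<bullet> D \<le> (U ** X ** transpose V) \<bullet> D"
    by (auto simp: S_def g_def)
  define M where "M = U ** X ** transpose V"
  have maxM: "(R ** M ** transpose Q) \<bullet> D \<le> M \<bullet> D" if "orthogonal_matrix R" "orthogonal_matrix Q" for R Q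
    using max[of "R ** U" "Q ** V"] that UV
    by (simp add: M_def matrix_transpose_mul matrix_mul_assoc orthogonal_matrix_mul)
  have left: "M $ q \<bullet> D $ p = M $ p \<bullet> D $ q" for p q
    by (rule rotation_maximal_symmetric) (use maxM[OF _ orthogonal_matrix_id] in simp)
  have right: "transpose M $ q \<bullet> transpose D $ p = transpose M $ p \<bullet> transpose D $ q" for p q
  proof (rule rotation_maximal_symmetric)
    fix R :: "('n,'n) mat" assume "orthogonal_matrix R"
    then have "(M ** transpose R) \<bullet> D \<le> M \<bullet> D" using maxM[OF orthogonal_matrix_id] by simp
    then show "(R ** transpose M) \<bullet> transpose D \<le> transpose M \<bullet> transpose D"
      by (metis inner_transpose matrix_transpose_mul transpose_transpose)
  qed
  have Drow: "x \<bullet> D $ row_of j = x $ j * w $ j" for x j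
    by (simp add: inner_vec_def D_def diag_matrix_nth[OF nm] row_of_inject[OF nm] if_distrib cong: if_cong)
  have Drow0: "x \<bullet> D $ p = 0" if "p \<notin> range (row_of :: 'n \<Rightarrow> 'm)" for x p
    using that by (auto simp: inner_vec_def D_def diag_matrix_nth[OF nm] intro!: sum.neutral)
  have Dcol: "x \<bullet> transpose D $ j = x $ row_of j * w $ j" for x j
    by (simp add: inner_vec_def D_def transpose_def diag_matrix_nth[OF nm] if_distrib cong: if_cong)
  have off: "M $ p $ i = 0" if p: "p \<noteq> row_of i" for p i
  proof (cases "p \<in> range (row_of :: 'n \<Rightarrow> 'm)")
    case False
    then have "M $ p $ i * w $ i = 0"
      using left[of p "row_of i"] by (simp add: Drow Drow0)
    then show ?thesis using w_pos[of i] by simp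
  next
    case True
    then obtain j :: 'n where j: "p = row_of j" by auto
    with p have "i \<noteq> j" by auto
    \<comment> \<open>Left and right stationarity are two linear equations for the same pair of
      mirrored entries. Eliminating one entry leaves the other multiplied by the difference of two
      squared weights.\<close>
    have 1: "M $ row_of j $ i * w $ i = M $ row_of i $ j * w $ j"
      using left[of "row_of j" "row_of i"] by (simp add: Drow)
    have 2: "M $ row_of j $ i * w $ j = M $ row_of i $ j * w $ i"
      using right[of i j] unfolding Dcol by (simp add: transpose_def)
    have "M $ row_of j $ i * (w $ i * w $ i - w $ j * w $ j) = 0"
      using 1 2 by algebra
    moreover have "w $ i * w $ i \<noteq> w $ j * w $ j"
      using \<open>i \<noteq> j\<close> w_less[of i j] w_less[of j i] w_pos[of i] w_pos[of j]
      by (cases i j rule: linorder_cases) (auto simp: square_eq_iff)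
    ultimately show ?thesis by (simp add: j)
  qed
  define s where "s = (\<chi> j. M $ row_of j $ j)"
  have M: "M = diag_matrix s"
    using off by (auto simp: vec_eq_iff diag_matrix_nth[OF nm] s_def)
  have X: "X = assemble s U V"
    by (rule rotate_eq_assemble) (use UV M M_def in auto)
  have MD: "M \<bullet> D = (\<Sum>j\<in>UNIV. w $ j * s $ j)"
    by (simp add: D_def inner_diag[OF nm] s_def)
  have nonneg: "0 \<le> s $ i" for i
  proof -
    \<comment> \<open>Flipping the sign of column \<open>i\<close> is orthogonal and would increase
      the objective if \<open>s $ i\<close> were negative.\<close>
    define Q :: "('n,'n) mat" where "Q = (\<chi> a b. if a = b then (if a = i then -1 else 1) else 0)"
    have tQ: "transpose Q = Q" by (auto simp: Q_def transpose_def vec_eq_iff)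
    have MQ: "(A ** Q) $ a $ b = (if b = i then - A $ a $ b else A $ a $ b)" for A :: "('k::finite,'n) mat" and a b
    proof -
      have "(A ** Q) $ a $ b = (\<Sum>k\<in>UNIV. if k = b then (if b = i then - A $ a $ b else A $ a $ b) else 0)"
        by (simp only: matrix_matrix_mult_def vec_lambda_beta, intro sum.cong) (auto simp: Q_def)
      then show ?thesis by simp
    qed
    have "Q ** Q = mat 1"
      by (simp add: vec_eq_iff MQ) (simp add: Q_def mat_def)
    then have "orthogonal_matrix Q" by (simp add: orthogonal_matrix tQ)
    then have "(M ** Q) \<bullet> D \<le> M \<bullet> D" using maxM[OF orthogonal_matrix_id, of Q] tQ by simp
    moreover have "(M ** Q) \<bullet> D = (\<Sum>j\<in>UNIV. w $ j * s $ j - (if j = i then 2 * (w $ j * s $ j) else 0))"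
      unfolding D_def inner_diag[OF nm] MQ by (intro sum.cong) (auto simp: s_def)
    ultimately have "0 \<le> w $ i * s $ i" by (simp add: MD sum_subtractf mult.commute)
    then show ?thesis using w_pos[of i] by (simp add: zero_le_mult_iff)
  qed
  have sorted: "s $ j \<le> s $ i" if "i < j" for i j
  proof -
    \<comment> \<open>Swapping \<open>i\<close> and \<open>j\<close> among rows and columns at once
      exchanges two diagonal entries; by the rearrangement inequality this would help if they were
      in the wrong order.\<close>
    define p where "p = id(i := j, j := i)"
    define p' :: "'m \<Rightarrow> 'm" where "p' = id(row_of i := row_of j, row_of j := row_of i)"
    have pp: "p \<circ> p = id" by (auto simp: p_def fun_eq_iff)
    have pp': "p' \<circ> p' = id" by (auto simp: p'_def fun_eq_iff)
    have p'p: "p' (row_of k) = row_of (p k)" for k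
      by (auto simp: p_def p'_def row_of_inject[OF nm])
    have "(perm_matrix p' ** M ** transpose (perm_matrix p)) $ row_of k $ k = s $ p k" for k
    proof -
      have "perm_matrix p' ** M ** transpose (perm_matrix p)
          = transpose (perm_matrix p ** transpose (perm_matrix p' ** M))"
        by (simp add: matrix_transpose_mul)
      then show ?thesis by (simp add: perm_matrix_mult transpose_def p'p s_def)
    qed
    then have "(\<Sum>k\<in>UNIV. w $ k * s $ p k) \<le> (\<Sum>k\<in>UNIV. w $ k * s $ k)"
      using maxM[OF orthogonal_perm_matrix[OF pp'] orthogonal_perm_matrix[OF pp]]
      unfolding MD by (simp add: D_def inner_diag[OF nm])
    moreover have "(\<Sum>k\<in>UNIV. w $ k * s $ p k) = (\<Sum>k\<in>UNIV. w $ k * s $ k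
        + ((if k = i then w $ i * (s $ j - s $ i) else 0) + (if k = j then w $ j * (s $ i - s $ j) else 0)))"
      using that by (intro sum.cong) (auto simp: p_def algebra_simps)
    ultimately have "w $ i * (s $ j - s $ i) + w $ j * (s $ i - s $ j) \<le> 0"
      by (simp add: sum.distrib)
    then have "(w $ i - w $ j) * (s $ j - s $ i) \<le> 0" by (simp add: algebra_simps)
    then show ?thesis using w_less[OF that] by (simp add: mult_le_0_iff)
  qed
  show ?thesis
    using nonneg sorted UV X by (metis order_le_less order_refl)
qed

text \<open>A Ky Fan inequality. The arithmetic-geometric mean bounds the products of entries of
  \<open>P\<close> and \<open>Q\<close> by the matrix \<open>x\<close>, whose row and column sums
  are at most 1 by orthogonality. The weights \<open>c\<close> thus lie between 0 and 1 with total
  at most \<open>card {..a}\<close>, and such weights do best on the largest entries.\<close>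

lemma diag_sum_le_singular_sum:
  fixes P :: "('m::{finite,linorder},'m) mat" and Q :: "('n::{finite,linorder},'n) mat"
  assumes nm: "CARD('n) \<le> CARD('m)" and "orthogonal_matrix P" "orthogonal_matrix Q"
    and nonneg: "\<And>i. 0 \<le> s $ i" and sorted: "\<And>i j. i \<le> j \<Longrightarrow> s $ j \<le> s $ i"
  shows "(\<Sum>i\<in>{..a}. (P ** diag_matrix s ** Q) $ row_of i $ i) \<le> (\<Sum>i\<in>{..a}. s $ i)"
proof -
  define x where "x = (\<lambda>i j. (1/2) * ((P $ row_of i $ row_of j)\<^sup>2 + (Q $ j $ i)\<^sup>2))"
  define c where "c = (\<lambda>j. \<Sum>i\<in>{..a}. x i j)"
  have x0: "0 \<le> x i j" for i j by (simp add: x_def)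
  have unit: "norm (A $ i) = 1" "norm (column i A) = 1" if "orthogonal_matrix A" for A :: "real^'k^'k" and i
    using that orthogonal_matrix_orthonormal_rows[of A] orthogonal_matrix_orthonormal_columns[of A]
    by (simp_all add: row_def)
  have rows: "(\<Sum>k\<in>(UNIV :: 'n set). (v $ row_of k)\<^sup>2) \<le> (norm v)\<^sup>2" for v :: "'m rvec"
  proof -
    have "(\<Sum>k\<in>(UNIV :: 'n set). (v $ row_of k)\<^sup>2) = (\<Sum>p\<in>range (row_of :: 'n \<Rightarrow> 'm). (v $ p)\<^sup>2)"
      by (subst sum.reindex) (auto simp: inj_on_def row_of_inject[OF nm])
    also have "\<dots> \<le> (\<Sum>p\<in>UNIV. (v $ p)\<^sup>2)" by (intro sum_mono2) auto
    finally show ?thesis by (simp add: norm_sq_cart)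
  qed
  have row_sum: "(\<Sum>j\<in>UNIV. x i j) \<le> 1" for i
    using rows[of "P $ row_of i"] norm_sq_cart[of "column i Q"] unit[OF assms(2)] unit[OF assms(3)]
    by (simp add: x_def sum.distrib column_def add_divide_distrib flip: sum_divide_distrib)
  have col_sum: "c j \<le> 1" for j
  proof -
    have "c j \<le> (\<Sum>i\<in>UNIV. x i j)" unfolding c_def by (intro sum_mono2) (auto simp: x0)
    also have "\<dots> \<le> 1"
      using rows[of "column (row_of j) P"] norm_sq_cart[of "Q $ j"] unit[OF assms(2)] unit[OF assms(3)]
      by (simp add: x_def sum.distrib column_def add_divide_distrib flip: sum_divide_distrib)
    finally show ?thesis .
  qed
  have c0: "0 \<le> c j" for j unfolding c_def by (intro sum_nonneg x0)
  have c_sum: "(\<Sum>j\<in>UNIV. c j) \<le> card {..a}"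
  proof -
    have "(\<Sum>j\<in>UNIV. c j) = (\<Sum>i\<in>{..a}. \<Sum>j\<in>UNIV. x i j)" unfolding c_def by (rule sum.swap)
    also have "\<dots> \<le> (\<Sum>i\<in>{..a}. 1)" by (intro sum_mono row_sum)
    finally show ?thesis by simp
  qed
  have entry: "(P ** diag_matrix s ** Q) $ row_of i $ i \<le> (\<Sum>j\<in>UNIV. s $ j * x i j)" for i
  proof -
    have "(P ** diag_matrix s) $ p $ j = P $ p $ row_of j * s $ j" for p j
      by (simp add: matrix_matrix_mult_def diag_matrix_nth[OF nm] if_distrib cong: if_cong)
    then have "(P ** diag_matrix s ** Q) $ row_of i $ i = (\<Sum>j\<in>UNIV. s $ j * (P $ row_of i $ row_of j * Q $ j $ i))"
      unfolding matrix_matrix_mult_def[of "P ** diag_matrix s"] by (simp add: mult_ac)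
    also have "\<dots> \<le> (\<Sum>j\<in>UNIV. s $ j * x i j)"
    proof (intro sum_mono mult_left_mono nonneg)
      show "P $ row_of i $ row_of j * Q $ j $ i \<le> x i j" for j
        using sum_squares_bound[of "P $ row_of i $ row_of j" "Q $ j $ i"] by (simp add: x_def)
    qed
    finally show ?thesis .
  qed
  have "(\<Sum>i\<in>{..a}. (P ** diag_matrix s ** Q) $ row_of i $ i) \<le> (\<Sum>i\<in>{..a}. \<Sum>j\<in>UNIV. s $ j * x i j)"
    by (intro sum_mono entry)
  also have "\<dots> = (\<Sum>j\<in>UNIV. s $ j * c j)"
    unfolding c_def sum_distrib_left by (rule sum.swap)
  \<comment> \<open>Subtracting \<open>s $ a\<close> fixes the sign of each term: up to
    \<open>a\<close> the factor is nonnegative and \<open>c j \<le> 1\<close> is used, beyond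
    \<open>a\<close> it is nonpositive and \<open>0 \<le> c j\<close> is used.\<close>
  also have "\<dots> = (\<Sum>j\<in>UNIV. (s $ j - s $ a) * c j) + s $ a * (\<Sum>j\<in>UNIV. c j)"
    by (simp add: sum_distrib_left algebra_simps flip: sum.distrib)
  also have "\<dots> \<le> (\<Sum>j\<in>UNIV. if j \<in> {..a} then s $ j - s $ a else 0) + s $ a * card {..a}"
  proof (intro add_mono sum_mono mult_left_mono c_sum nonneg)
    fix j
    show "(s $ j - s $ a) * c j \<le> (if j \<in> {..a} then s $ j - s $ a else 0)"
    proof (cases "j \<le> a")
      case True
      then show ?thesis using sorted[of j a] col_sum[of j] by (simp add: mult_left_le)
    next
      case False
      then show ?thesis using sorted[of a j] c0[of j] by (simp add: mult_nonpos_nonneg)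
    qed
  qed
  also have "\<dots> = (\<Sum>i\<in>{..a}. s $ i)"
    by (simp add: sum.If_cases sum_subtractf atMost_def)
  finally show ?thesis .
qed

text \<open>Each decomposition is a rotation of the other, so the Ky Fan inequality in both
  directions equates all partial sums; entries are recovered as their differences.\<close>

lemma svd_unique:
  fixes U :: "('m::{finite,linorder},'m) mat" and V :: "('n::{finite,linorder},'n) mat"
  assumes nm: "CARD('n) \<le> CARD('m)"
    and o: "orthogonal_matrix U" "orthogonal_matrix V" "orthogonal_matrix U'" "orthogonal_matrix V'"
    and eq: "assemble s U V = assemble s' U' V'"
    and s: "\<And>i. 0 \<le> s $ i" "\<And>i j. i \<le> j \<Longrightarrow> s $ j \<le> s $ i"
    and s': "\<And>i. 0 \<le> s' $ i" "\<And>i j. i \<le> j \<Longrightarrow> s' $ j \<le> s' $ i"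
  shows "s = s'"
proof -
  have le: "(\<Sum>i\<in>{..a}. s' $ i) \<le> (\<Sum>i\<in>{..a}. s $ i)"
    if o: "orthogonal_matrix U" "orthogonal_matrix V" "orthogonal_matrix U'" "orthogonal_matrix V'"
      and eq: "assemble s U V = assemble s' U' V'"
      and s: "\<And>i. 0 \<le> s $ i" "\<And>i j. i \<le> j \<Longrightarrow> s $ j \<le> s $ i"
    for s s' :: "'n rvec" and U U' :: "('m,'m) mat" and V V' :: "('n,'n) mat" and a
  proof -
    have "diag_matrix s' = (U' ** transpose U) ** diag_matrix s ** (V ** transpose V')"
      using assemble_rotate[OF o(3,4), of s'] unfolding eq[symmetric] by (simp add: assemble_def matrix_mul_assoc)
    moreover have "orthogonal_matrix (U' ** transpose U)" "orthogonal_matrix (V ** transpose V')"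
      using o by (simp_all add: orthogonal_matrix_mul)
    ultimately have "(\<Sum>i\<in>{..a}. (diag_matrix s' :: ('m,'n) mat) $ row_of i $ i) \<le> (\<Sum>i\<in>{..a}. s $ i)"
      using diag_sum_le_singular_sum[OF nm, of "U' ** transpose U" "V ** transpose V'" s a] s by simp
    then show ?thesis by (simp add: diag_matrix_nth[OF nm])
  qed
  have sums: "(\<Sum>i\<in>{..a}. s $ i) = (\<Sum>i\<in>{..a}. s' $ i)" for a
    using le[OF o eq s, of a] le[OF o(3,4,1,2) eq[symmetric] s', of a] by linarith
  have "s $ a = s' $ a" for a
  proof (induction a rule: measure_induct_rule[of index_pos])
    case (less a)
    have "(\<Sum>i\<in>{..<a}. s $ i) = (\<Sum>i\<in>{..<a}. s' $ i)"
      using less by (intro sum.cong) (auto simp: index_pos_less_iff)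
    moreover have "{..a} = insert a {..<a}" by auto
    ultimately show ?case using sums[of a] by simp
  qed
  then show ?thesis by (simp add: vec_eq_iff)
qed

section \<open>The Schatten norm\<close>

context
  assumes nm: "CARD('n::{finite,linorder}) \<le> CARD('m::{finite,linorder})"
begin

lemma singular_values_svd:
  "(\<forall>i. 0 \<le> singular_values (X :: ('m,'n) mat) $ i) \<and>
    (\<exists>U V. orthogonal_matrix U \<and> orthogonal_matrix V \<and> X = assemble (singular_values X) U V)"
proof -
  let ?P = "\<lambda>s. (\<forall>i. 0 \<le> s $ i) \<and> (\<forall>i j. i \<le> j \<longrightarrow> s $ j \<le> s $ i) \<and>
    (\<exists>U V. orthogonal_matrix U \<and> orthogonal_matrix V \<and> X = assemble s U V)"
  obtain s U V where s: "?P s" using svd_exists[OF nm, of X] by blast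
  have "?P (THE s. ?P s)"
  proof (rule theI)
    show "?P s" by (rule s)
    show "s' = s" if "?P s'" for s'
    proof -
      obtain U V U' V' where "orthogonal_matrix U" "orthogonal_matrix V" "X = assemble s U V"
        "orthogonal_matrix U'" "orthogonal_matrix V'" "X = assemble s' U' V'"
        using s \<open>?P s'\<close> by blast
      then show ?thesis
        using svd_unique[OF nm, of U' V' U V s' s] s that by simp
    qed
  qed
  then have "?P (singular_values X)"
    unfolding singular_values_def .
  then show ?thesis by (elim conjE) (intro conjI)
qed

text \<open>One half of the duality with the spectral norm: in singular bases a contraction has
  diagonal entries at most 1. With \<open>schatten1_attained\<close> it replaces the definite
  description of the singular values in all that follows.\<close>

lemma schatten1_ge:
  assumes "op_bound 1 (Z :: ('m,'n) mat)"
  shows "Z \<bullet> X \<le> schatten1_norm X"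
proof -
  obtain U V where UV: "orthogonal_matrix U" "orthogonal_matrix V" "X = assemble (singular_values X) U V"
    and pos: "\<And>i. 0 \<le> singular_values X $ i"
    using singular_values_svd[of X] by blast
  have "op_bound 1 (U ** Z ** transpose V)"
    using UV assms by (intro op_bound_conjugate) auto
  then have "\<bar>(U ** Z ** transpose V) $ i $ j\<bar> \<le> 1" for i j
    by (simp add: op_bound_entry)
  then have "(U ** Z ** transpose V) $ i $ j \<le> 1" for i j
    by (meson abs_le_D1)
  then have "Z \<bullet> assemble (singular_values X) U V \<le> schatten1_norm X"
    unfolding inner_assemble[OF nm] schatten1_norm_def
    by (intro sum_mono mult_left_le pos)
  with UV(3) show ?thesis by simp
qed

lemma schatten1_attained: "\<exists>Z. op_bound 1 Z \<and> Z \<bullet> (X :: ('m,'n) mat) = schatten1_norm X"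
proof -
  obtain U V where UV: "orthogonal_matrix U" "orthogonal_matrix V" "X = assemble (singular_values X) U V"
    using singular_values_svd[of X] by blast
  define Z :: "('m,'n) mat" where "Z = assemble (\<chi> i. 1) U V"
  have "op_bound 1 Z"
    unfolding Z_def assemble_def
    using UV by (intro op_bound_conjugate op_bound_diag_matrix[OF nm]) auto
  moreover have "Z \<bullet> assemble (singular_values X) U V = schatten1_norm X"
    unfolding inner_assemble[OF nm] Z_def schatten1_norm_def
    by (simp add: assemble_rotate UV(1,2) diag_matrix_nth[OF nm])
  ultimately show ?thesis using UV(3) by auto
qed

text \<open>The entries of \<open>s\<close> may have any sign and order, as those of the iterates
  do. The upper bound tests an optimal contraction; the lower bound uses the contraction built from
  the signs of \<open>s\<close>.\<close>

lemma schatten1_assemble: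
  assumes "orthogonal_matrix U" "orthogonal_matrix V"
  shows "schatten1_norm (assemble s U V :: ('m,'n) mat) = l1_norm s"
proof (rule antisym)
  obtain Z :: "('m,'n) mat" where Z: "op_bound 1 Z" "Z \<bullet> assemble s U V = schatten1_norm (assemble s U V :: ('m,'n) mat)"
    using schatten1_attained by blast
  have "op_bound 1 (U ** Z ** transpose V)"
    using Z assms by (intro op_bound_conjugate) auto
  then have "\<bar>(U ** Z ** transpose V) $ i $ j\<bar> \<le> 1" for i j
    by (simp add: op_bound_entry)
  then have "\<bar>s $ j * (U ** Z ** transpose V) $ row_of j $ j\<bar> \<le> \<bar>s $ j\<bar>" for j
    by (simp add: abs_mult mult_left_le)
  then have "s $ j * (U ** Z ** transpose V) $ row_of j $ j \<le> \<bar>s $ j\<bar>" for j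
    by (rule order_trans[OF abs_ge_self])
  then have "Z \<bullet> assemble s U V \<le> l1_norm s"
    unfolding inner_assemble[OF nm] l1_norm_def by (intro sum_mono)
  with Z show "schatten1_norm (assemble s U V :: ('m,'n) mat) \<le> l1_norm s" by simp
next
  define Z :: "('m,'n) mat" where "Z = assemble (\<chi> i. sgn (s $ i)) U V"
  have "op_bound 1 Z"
    unfolding Z_def assemble_def
    using assms by (intro op_bound_conjugate op_bound_diag_matrix[OF nm]) (auto simp: abs_sgn_eq)
  then have "Z \<bullet> assemble s U V \<le> schatten1_norm (assemble s U V :: ('m,'n) mat)"
    by (rule schatten1_ge)
  moreover have "Z \<bullet> assemble s U V = l1_norm s"
    unfolding inner_assemble[OF nm] Z_def l1_norm_def
    by (simp add: assemble_rotate assms diag_matrix_nth[OF nm] abs_sgn)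
  ultimately show "l1_norm s \<le> schatten1_norm (assemble s U V :: ('m,'n) mat)" by simp
qed

lemma schatten1_triangle: "schatten1_norm (X + Y) \<le> schatten1_norm X + schatten1_norm (Y :: ('m,'n) mat)"
  using schatten1_attained[of "X + Y"] schatten1_ge by (metis add_mono inner_add_right)

lemma schatten1_scaleR_le:
  assumes "0 \<le> c"
  shows "schatten1_norm (c *\<^sub>R X) \<le> c * schatten1_norm (X :: ('m,'n) mat)"
proof -
  obtain Z where "op_bound 1 Z" "Z \<bullet> (c *\<^sub>R X) = schatten1_norm (c *\<^sub>R X)"
    using schatten1_attained[of "c *\<^sub>R X"] by blast
  then show ?thesis using mult_left_mono[OF schatten1_ge[of Z X] assms] by simp
qed

end

section \<open>Optimality and strict complementarity\<close>

text \<open>Rows and columns of a contraction have norm at most 1, so a unit entry exhausts both its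
  row and its column.\<close>

lemma contraction_unit_entry:
  assumes "op_bound 1 (M :: real^'n^'m)" "M $ p $ q = 1"
  shows "p' \<noteq> p \<Longrightarrow> M $ p' $ q = 0" "q' \<noteq> q \<Longrightarrow> M $ p $ q' = 0"
proof -
  have *: "B $ p' $ q = 0" if B: "op_bound 1 B" "B $ p $ q = 1" "p' \<noteq> p"
    for B :: "real^'i::finite^'j::finite" and p p' q
  proof -
    have "(B $ p $ q)\<^sup>2 + (B $ p' $ q)\<^sup>2 = (\<Sum>k\<in>{p, p'}. (B $ k $ q)\<^sup>2)"
      using B(3) by simp
    also have "\<dots> \<le> (\<Sum>k\<in>UNIV. (B $ k $ q)\<^sup>2)"
      by (intro sum_mono2) auto
    also have "\<dots> = (norm (B *v axis q 1))\<^sup>2"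
      by (simp add: norm_sq_cart matrix_vector_mult_basis column_def)
    also have "\<dots> \<le> 1"
      using op_boundD[OF B(1), of "axis q 1"] by (simp add: norm_axis_1 power_le_one)
    finally show ?thesis using B(2) by simp
  qed
  show "p' \<noteq> p \<Longrightarrow> M $ p' $ q = 0"
    using *[of M p q p'] assms by blast
  show "q' \<noteq> q \<Longrightarrow> M $ p $ q' = 0"
    using *[of "transpose M" q p q'] op_bound_transpose[OF assms(1)] assms(2) by (simp add: transpose_def)
qed

lemma op_boundI_inner:
  assumes "\<And>u w. u \<bullet> (M *v w) \<le> c * norm u * norm w" and "0 \<le> c"
  shows "op_bound c M"
  unfolding op_bound_def
proof
  fix z
  have "norm (M *v z) * norm (M *v z) \<le> norm (M *v z) * (c * norm z)"
    using assms(1)[of "M *v z" z] by (simp add: power2_norm_eq_inner[symmetric] power2_eq_square mult_ac)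
  then show "norm (M *v z) \<le> c * norm z"
    using assms(2) by (cases "norm (M *v z) = 0") (auto simp: mult_le_cancel_left)
qed

lemma convex_subdifferential: "convex (subdifferential g x)"
  unfolding convex_def
proof (intro ballI allI impI)
  fix v w and s t :: real
  assume v: "v \<in> subdifferential g x" and w: "w \<in> subdifferential g x" and st: "0 \<le> s" "0 \<le> t" "s + t = 1"
  show "s *\<^sub>R v + t *\<^sub>R w \<in> subdifferential g x"
    unfolding subdifferential_def
  proof (intro CollectI allI)
    fix y
    have "s * (g x + v \<bullet> (y - x)) + t * (g x + w \<bullet> (y - x)) \<le> s * g y + t * g y"
      using v w st by (intro add_mono mult_left_mono) (auto simp: subdifferential_def)
    moreover have "s * g x + t * g x = g x" "s * g y + t * g y = g y"
      using st(3) by (metis distrib_right mult_1)+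
    ultimately show "g x + (s *\<^sub>R v + t *\<^sub>R w) \<bullet> (y - x) \<le> g y"
      by (simp add: inner_add_left distrib_left)
  qed
qed

lemma power2_norm_add: "(norm (u + w))\<^sup>2 = (norm u)\<^sup>2 + 2 * (u \<bullet> w) + (norm w)\<^sup>2"
  for u w :: "'a::real_inner"
  by (simp add: power2_norm_eq_inner inner_add_left inner_add_right inner_commute)

lemma le_limit_at_zero:
  fixes a k c :: real
  assumes "\<And>\<tau>. 0 < \<tau> \<Longrightarrow> \<tau> \<le> 1 \<Longrightarrow> a \<le> \<tau> * c + k"
  shows "a \<le> k"
proof (rule field_le_epsilon)
  fix e :: real assume e: "0 < e"
  define \<tau> where "\<tau> = min 1 (e / (\<bar>c\<bar> + 1))"
  have "\<tau> \<le> e / (\<bar>c\<bar> + 1)" by (simp add: \<tau>_def)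
  then have "\<tau> * (\<bar>c\<bar> + 1) \<le> e"
    by (simp only: pos_le_divide_eq add_nonneg_pos[OF abs_ge_zero zero_less_one])
  then have \<tau>: "0 < \<tau>" "\<tau> \<le> 1" "\<tau> * (\<bar>c\<bar> + 1) \<le> e"
    using e by (auto simp: \<tau>_def intro!: divide_pos_pos)
  have "\<tau> * c \<le> \<tau> * (\<bar>c\<bar> + 1)" using \<tau>(1) by (intro mult_left_mono) auto
  then show "a \<le> k + e" using assms[of \<tau>] \<tau> by linarith
qed

locale ls_problem =
  fixes \<A> :: "('m::{finite,linorder},'n::{finite,linorder}) mat \<Rightarrow> 'l::finite rvec"
    and b :: "'l rvec" and lam :: real
  assumes nm: "CARD('n) \<le> CARD('m)" and lin: "linear \<A>" and lam: "0 < lam"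
begin

abbreviation obj where "obj \<equiv> objective \<A> b lam"

lemma inner_grad_fit: "grad_fit \<A> b X \<bullet> H = (\<A> X - b) \<bullet> \<A> H"
  by (simp add: grad_fit_def inner_commute adjoint_works[OF lin])

lemma fit_expand: "fit \<A> b Y = fit \<A> b X + grad_fit \<A> b X \<bullet> (Y - X) + (norm (\<A> (Y - X)))\<^sup>2 / 2"
proof -
  have *: "\<A> Y - b = (\<A> X - b) + \<A> (Y - X)" by (simp add: linear_diff[OF lin])
  show ?thesis
    unfolding fit_def inner_grad_fit * power2_norm_add by (simp add: add_divide_distrib)
qed

lemma fit_convex: "fit \<A> b X + grad_fit \<A> b X \<bullet> (Y - X) \<le> fit \<A> b Y"
  by (simp add: fit_expand[of Y X])

lemma objective_assemble:
  assumes "orthogonal_matrix U" "orthogonal_matrix V"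
  shows "obj (assemble s U V) = fit \<A> b (assemble s U V) + lam * l1_norm s"
  by (simp add: objective_def schatten1_assemble[OF nm assms])

text \<open>Along \<open>X + \<tau> *\<^sub>R H\<close> the quadratic remainder of the loss is of
  order \<tau> squared, while convexity bounds the increment of the Schatten norm by \<tau> times
  the full increment. Division by \<tau> and \<tau> tending to 0 make \<open>\<Gamma>\<close> a
  subgradient of the norm; rank-one directions give the contraction property, and
  \<open>H = - X\<close> gives equality in the pairing.\<close>

lemma subdifferential_contraction:
  assumes v: "v \<in> subdifferential obj X"
  defines "\<Gamma> \<equiv> (1 / lam) *\<^sub>R (v - grad_fit \<A> b X)"
  shows "op_bound 1 \<Gamma>" "\<Gamma> \<bullet> X = schatten1_norm X"
proof -
  have key: "\<Gamma> \<bullet> H \<le> schatten1_norm (X + H) - schatten1_norm X" for H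
  proof -
    have "(v - grad_fit \<A> b X) \<bullet> H \<le> lam * (schatten1_norm (X + H) - schatten1_norm X)"
    proof (rule le_limit_at_zero)
      fix \<tau> :: real assume \<tau>: "0 < \<tau>" "\<tau> \<le> 1"
      have "schatten1_norm ((1 - \<tau>) *\<^sub>R X + \<tau> *\<^sub>R (X + H)) \<le> (1 - \<tau>) * schatten1_norm X + \<tau> * schatten1_norm (X + H)"
        using \<tau> by (intro order_trans[OF schatten1_triangle[OF nm]] add_mono schatten1_scaleR_le[OF nm]) auto
      then have "lam * schatten1_norm (X + \<tau> *\<^sub>R H) \<le> lam * ((1 - \<tau>) * schatten1_norm X + \<tau> * schatten1_norm (X + H))"
        using lam by (intro mult_left_mono) (auto simp: algebra_simps)
      moreover have "obj X + v \<bullet> (X + \<tau> *\<^sub>R H - X) \<le> obj (X + \<tau> *\<^sub>R H)"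
        using v unfolding subdifferential_def by blast
      ultimately have "\<tau> * ((v - grad_fit \<A> b X) \<bullet> H) \<le> \<tau> * (\<tau> * ((norm (\<A> H))\<^sup>2 / 2) + lam * (schatten1_norm (X + H) - schatten1_norm X))"
        using \<tau> by (simp add: objective_def fit_expand[of "X + \<tau> *\<^sub>R H" X] linear_scale[OF lin] inner_diff_left power2_eq_square algebra_simps)
      then show "(v - grad_fit \<A> b X) \<bullet> H \<le> \<tau> * ((norm (\<A> H))\<^sup>2 / 2) + lam * (schatten1_norm (X + H) - schatten1_norm X)"
        using \<tau>(1) by (rule mult_left_le_imp_le)
    qed
    then show ?thesis unfolding \<Gamma>_def inner_scaleR_left using lam by (simp add: field_simps)
  qed
  show op: "op_bound 1 \<Gamma>"
  proof (rule op_boundI_inner)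
    fix u w
    let ?H = "(\<chi> i j. u $ i * w $ j) :: ('m,'n) mat"
    obtain Z where Z: "op_bound 1 Z" "Z \<bullet> ?H = schatten1_norm ?H"
      using schatten1_attained[OF nm] by blast
    have "\<Gamma> \<bullet> ?H \<le> schatten1_norm ?H"
      using key[of ?H] schatten1_triangle[OF nm, of X ?H] by linarith
    also have "\<dots> \<le> norm u * norm w"
      using op_bound_inner[OF Z(1), of u w] Z(2) by (simp add: inner_matrix_vector inner_commute)
    finally show "u \<bullet> (\<Gamma> *v w) \<le> 1 * norm u * norm w"
      by (simp add: inner_matrix_vector inner_commute)
  qed simp
  have "schatten1_norm (0 :: ('m,'n) mat) = 0"
    using schatten1_attained[OF nm, of 0] by auto
  then show "\<Gamma> \<bullet> X = schatten1_norm X"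
    using key[of "- X"] schatten1_ge[OF nm op, of X] by simp
qed

definition indicator_vec :: "'n set \<Rightarrow> 'n rvec"
  where "indicator_vec I = (\<chi> i. if i \<in> I then 1 else 0)"

text \<open>\<open>v0\<close> is the subgradient whose dual matrix has zero complementary block.
  Relative interiority of 0 allows the segment from \<open>v0\<close> to 0 to be prolonged by a
  factor \<epsilon> inside the subdifferential. The dual matrix at the prolonged point is again a
  contraction, and its complementary block is \<open>(1 + \<epsilon>) *\<^sub>R N\<close>; this
  yields \<theta> = 1 / (1 + \<epsilon>).\<close>

lemma strict_complementarity:
  assumes ri: "0 \<in> rel_interior (subdifferential obj (assemble s U V))"
    and UV: "orthogonal_matrix U" "orthogonal_matrix V"
    and s: "\<And>i. i \<in> I \<Longrightarrow> 0 < s $ i" "\<And>i. i \<notin> I \<Longrightarrow> s $ i = 0"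
  shows "\<exists>\<theta> N. \<theta> < 1 \<and> op_bound \<theta> N \<and> (\<forall>i\<in>I. \<forall>j. N $ row_of i $ j = 0) \<and> (\<forall>i\<in>I. \<forall>p. N $ p $ i = 0) \<and>
    U ** grad_fit \<A> b (assemble s U V) ** transpose V = - (lam *\<^sub>R (diag_matrix (indicator_vec I) + N))"
proof -
  let ?X = "assemble s U V"
  let ?S = "subdifferential obj ?X"
  define G where "G = grad_fit \<A> b ?X"
  define \<Gamma> where "\<Gamma> = (1 / lam) *\<^sub>R (0 - G)"
  define \<Gamma>0 where "\<Gamma>0 = assemble (indicator_vec I) U V"
  define v0 where "v0 = G + lam *\<^sub>R \<Gamma>0"
  have zero: "0 \<in> ?S" using ri rel_interior_subset by blast
  have \<Gamma>: "op_bound 1 \<Gamma>" "\<Gamma> \<bullet> ?X = schatten1_norm ?X"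
    using subdifferential_contraction[OF zero] by (simp_all add: \<Gamma>_def G_def)
  have s0: "0 \<le> s $ i" for i using s[of i] by force
  have l1: "schatten1_norm ?X = (\<Sum>i\<in>UNIV. s $ i)"
    by (simp add: schatten1_assemble[OF nm UV] l1_norm_def s0)
  have op0: "op_bound 1 \<Gamma>0"
    unfolding \<Gamma>0_def assemble_def indicator_vec_def
    using UV by (intro op_bound_conjugate op_bound_diag_matrix[OF nm]) auto
  have "v0 \<in> ?S"
    unfolding subdifferential_def
  proof (intro CollectI allI)
    fix Y
    have "\<Gamma>0 \<bullet> ?X = (\<Sum>i\<in>UNIV. s $ i)"
      unfolding inner_assemble[OF nm] \<Gamma>0_def
      by (intro sum.cong) (auto simp: assemble_rotate UV diag_matrix_nth[OF nm] indicator_vec_def s)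
    moreover have "\<Gamma>0 \<bullet> Y \<le> schatten1_norm Y" by (rule schatten1_ge[OF nm op0])
    ultimately have "lam * schatten1_norm ?X + lam * (\<Gamma>0 \<bullet> (Y - ?X)) \<le> lam * schatten1_norm Y"
      using lam by (simp add: l1 inner_diff_right flip: distrib_left)
    then show "obj ?X + v0 \<bullet> (Y - ?X) \<le> obj Y"
      using fit_convex[of ?X Y] by (simp add: objective_def v0_def G_def inner_add_left)
  qed
  then obtain e where e: "1 < e" "(1 - e) *\<^sub>R v0 + e *\<^sub>R 0 \<in> ?S"
    using convex_rel_interior_if[OF convex_subdifferential ri] hull_inc by (metis order_refl)
  define \<epsilon> where "\<epsilon> = e - 1"
  have \<epsilon>: "0 < \<epsilon>" and mem: "- (\<epsilon> *\<^sub>R v0) \<in> ?S"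
    using e by (simp_all add: \<epsilon>_def algebra_simps)
  define \<Gamma>' where "\<Gamma>' = (1 + \<epsilon>) *\<^sub>R \<Gamma> - \<epsilon> *\<^sub>R \<Gamma>0"
  have "\<Gamma>' = (1 / lam) *\<^sub>R (- (\<epsilon> *\<^sub>R v0) - G)"
    using lam by (simp add: \<Gamma>'_def \<Gamma>_def v0_def vec_eq_iff field_simps)
  then have \<Gamma>': "op_bound 1 \<Gamma>'"
    using subdifferential_contraction(1)[OF mem] by (simp add: G_def)
  define rot where "rot = (\<lambda>M. U ** M ** transpose V)"
  have rot_op: "op_bound 1 (rot M)" if "op_bound 1 M" for M
    unfolding rot_def using UV that by (intro op_bound_conjugate) auto
  \<comment> \<open>The pairing with the limit equals the sum of the \<open>s $ j\<close> although
    no diagonal entry exceeds 1; hence each entry weighted by a positive \<open>s $ j\<close> equals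
    1.\<close>
  have diag1: "rot \<Gamma> $ row_of i $ i = 1" if "i \<in> I" for i
  proof -
    have le: "rot \<Gamma> $ row_of j $ j \<le> 1" for j
      using op_bound_entry[OF rot_op[OF \<Gamma>(1)]] abs_le_D1 by blast
    have "(\<Sum>j\<in>UNIV. s $ j * (1 - rot \<Gamma> $ row_of j $ j)) = 0"
      using \<Gamma>(2) unfolding inner_assemble[OF nm] l1 rot_def by (simp add: right_diff_distrib sum_subtractf)
    moreover have "\<forall>j\<in>UNIV. 0 \<le> s $ j * (1 - rot \<Gamma> $ row_of j $ j)"
      using s0 le by (intro ballI mult_nonneg_nonneg) (auto simp: diff_ge_0_iff_ge)
    ultimately have "s $ i * (1 - rot \<Gamma> $ row_of i $ i) = 0"
      by (subst (asm) sum_nonneg_eq_0_iff) auto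
    then show ?thesis using s(1)[OF that] by simp
  qed
  define N where "N = rot \<Gamma> - diag_matrix (indicator_vec I)"
  have N_row: "N $ row_of i $ j = 0" if "i \<in> I" for i j
    using contraction_unit_entry(2)[OF rot_op[OF \<Gamma>(1)] diag1[OF that], of j] diag1[OF that] that
    by (cases "j = i") (auto simp: N_def diag_matrix_nth[OF nm] row_of_inject[OF nm] indicator_vec_def)
  have N_col: "N $ p $ i = 0" if "i \<in> I" for i p
    using contraction_unit_entry(1)[OF rot_op[OF \<Gamma>(1)] diag1[OF that], of p] diag1[OF that] that
    by (cases "p = row_of i") (auto simp: N_def diag_matrix_nth[OF nm] indicator_vec_def)
  have "op_bound (1 / (1 + \<epsilon>)) N"
    unfolding op_bound_def
  proof
    fix z :: "'n rvec"
    \<comment> \<open>\<open>N\<close> ignores the coordinates in \<open>I\<close>, and on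
      \<open>y\<close> the identity block vanishes, so that the contraction
      \<open>rot \<Gamma>'\<close> acts as \<open>(1 + \<epsilon>) *\<^sub>R N\<close>
      there.\<close>
    define y where "y = (\<chi> i. if i \<in> I then 0 else z $ i)"
    have y: "norm y \<le> norm z"
      by (rule norm_le_componentwise_cart) (simp add: y_def)
    have Ny: "N *v z = N *v y"
      by (simp add: vec_eq_iff matrix_vector_mult_def, intro allI sum.cong) (auto simp: y_def N_col)
    have Dy: "(diag_matrix (indicator_vec I) :: ('m,'n) mat) *v y = 0"
      by (simp add: vec_eq_iff matrix_vector_mult_def diag_matrix_nth[OF nm])
        (auto simp: y_def indicator_vec_def intro!: sum.neutral)
    have rot0: "rot \<Gamma>0 = diag_matrix (indicator_vec I)"
      by (simp add: rot_def \<Gamma>0_def assemble_rotate UV)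
    have "rot \<Gamma>' = (1 + \<epsilon>) *\<^sub>R rot \<Gamma> - \<epsilon> *\<^sub>R rot \<Gamma>0"
      by (simp add: rot_def \<Gamma>'_def matrix_distribs)
    also have "\<dots> = (1 + \<epsilon>) *\<^sub>R N + diag_matrix (indicator_vec I)"
      unfolding rot0 N_def by (simp add: algebra_simps)
    finally have "rot \<Gamma>' *v y = (1 + \<epsilon>) *\<^sub>R (N *v y)"
      by (simp add: matrix_vector_mult_add_rdistrib Dy scaleR_matrix_vector_assoc)
    then have "(1 + \<epsilon>) * norm (N *v y) \<le> norm z"
      using op_boundD[OF rot_op[OF \<Gamma>'], of y] y \<epsilon> by simp
    then show "norm (N *v z) \<le> 1 / (1 + \<epsilon>) * norm z"
      using \<epsilon> by (simp add: Ny field_simps)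
  qed
  moreover have "1 / (1 + \<epsilon>) < 1" using \<epsilon> by simp
  moreover have "rot G = - (lam *\<^sub>R (diag_matrix (indicator_vec I) + N))"
  proof -
    have "G = - (lam *\<^sub>R \<Gamma>)" using lam by (simp add: \<Gamma>_def)
    then show ?thesis by (simp add: rot_def N_def matrix_distribs)
  qed
  ultimately show ?thesis
    using N_row N_col unfolding rot_def G_def by blast
qed

end

section \<open>Cayley steps and descent\<close>

lemma skew_inner_zero:
  assumes "transpose E = - (E :: real^'k^'k)"
  shows "z \<bullet> (E *v z) = 0"
proof -
  have minus: "(- E) *v z = - (E *v z)" by (simp add: vec_eq_iff matrix_vector_mult_def sum_negf)
  have "z \<bullet> (E *v z) = (transpose E *v z) \<bullet> z" by (simp add: dot_lmul_matrix)
  also have "\<dots> = - (z \<bullet> (E *v z))"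
    unfolding assms minus by (simp add: inner_commute)
  finally show ?thesis by simp
qed

text \<open>Skewness makes \<open>z\<close> and \<open>E *v z\<close> orthogonal; hence
  \<open>mat 1 + (1/2) *\<^sub>R E\<close> is injective and the Cayley transform \<open>C\<close>
  preserves norms. The identities \<open>C1\<close> and \<open>C2\<close> express its first- and
  second-order errors through \<open>E\<close> and \<open>C\<close>. The equivalence in the
  conclusion records existence and uniqueness of the step at once.\<close>

lemma cayley_exists:
  assumes E: "transpose E = - (E :: real^'k^'k)" and op: "op_bound c E"
  obtains C where "orthogonal_matrix C"
    and "\<And>Y Z :: real^'n^'k. (mat 1 + (1/2) *\<^sub>R E) ** Y = (mat 1 - (1/2) *\<^sub>R E) ** Z \<longleftrightarrow> Y = C ** Z"
    and "op_bound c (C - mat 1)" and "op_bound (c\<^sup>2 / 2) (C - mat 1 + E)"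
proof -
  let ?P = "mat 1 + (1/2) *\<^sub>R E" and ?M = "mat 1 - (1/2) *\<^sub>R E"
  have vec: "?P *v z = z + (1/2) *\<^sub>R (E *v z)" "?M *v z = z - (1/2) *\<^sub>R (E *v z)" for z
    by (simp_all add: matrix_vector_mult_add_rdistrib matrix_vector_mult_diff_rdistrib scaleR_matrix_vector_assoc)
  have "\<forall>z. ?P *v z = 0 \<longrightarrow> z = 0"
  proof (intro allI impI)
    fix z assume "?P *v z = 0"
    then have "z \<bullet> (z + (1/2) *\<^sub>R (E *v z)) = 0" by (simp add: vec)
    then show "z = 0" by (simp add: inner_add_right skew_inner_zero[OF E])
  qed
  then obtain B where B: "B ** ?P = mat 1" using matrix_left_invertible_ker[of ?P] by blast
  then have B': "?P ** B = mat 1" by (simp add: matrix_left_right_inverse)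
  define C where "C = B ** ?M"
  have PC: "?P ** C = ?M" unfolding C_def by (simp only: matrix_mul_assoc B' matrix_mul_lid)
  have iff: "?P ** Y = ?M ** Z \<longleftrightarrow> Y = C ** Z" for Y Z :: "real^'n^'k"
  proof
    assume "?P ** Y = ?M ** Z"
    then have "B ** (?P ** Y) = B ** (?M ** Z)" by (rule arg_cong)
    then show "Y = C ** Z" by (simp only: matrix_mul_assoc B C_def matrix_mul_lid)
  next
    show "Y = C ** Z \<Longrightarrow> ?P ** Y = ?M ** Z" by (simp only: matrix_mul_assoc PC)
  qed
  have norm: "norm (C *v z) = norm z" for z
  proof -
    define y where "y = C *v z"
    have "?P *v y = ?M *v z" unfolding y_def by (simp only: matrix_vector_mul_assoc PC)
    then have "y - z = - ((1/2) *\<^sub>R (E *v (y + z)))"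
      by (simp add: vec matrix_vector_right_distrib scaleR_matrix_vector_assoc algebra_simps)
    then have "(y + z) \<bullet> (y - z) = 0"
      by (simp add: skew_inner_zero[OF E])
    moreover have "(y + z) \<bullet> (y - z) = y \<bullet> y - z \<bullet> z"
      by (simp add: inner_add_left inner_add_right inner_diff_left inner_diff_right inner_commute)
    ultimately show ?thesis
      by (simp add: y_def[symmetric] norm_eq)
  qed
  then have C: "orthogonal_matrix C"
    using orthogonal_transformation_matrix[of "(*v) C"] by (simp add: orthogonal_transformation)
  have C1: "C - mat 1 = - (1/2) *\<^sub>R (E ** (mat 1 + C))"
    and C2: "C - mat 1 + E = (1/2) *\<^sub>R (E ** (- (C - mat 1)))"
  proof -
    have entry: "C $ i $ j + (E ** C) $ i $ j / 2 = mat 1 $ i $ j - E $ i $ j / 2" for i j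
      using arg_cong[OF PC, of "\<lambda>M. M $ i $ j"] by (simp add: matrix_distribs)
    show "C - mat 1 = - (1/2) *\<^sub>R (E ** (mat 1 + C))"
      unfolding vec_eq_iff
    proof (intro allI)
      show "(C - mat 1) $ i $ j = (- (1/2) *\<^sub>R (E ** (mat 1 + C))) $ i $ j" for i j
        using entry[of i j] by (simp add: matrix_distribs field_simps)
    qed
    show "C - mat 1 + E = (1/2) *\<^sub>R (E ** (- (C - mat 1)))"
      unfolding vec_eq_iff
    proof (intro allI)
      show "(C - mat 1 + E) $ i $ j = ((1/2) *\<^sub>R (E ** (- (C - mat 1)))) $ i $ j" for i j
        using entry[of i j] by (simp add: matrix_distribs field_simps)
    qed
  qed
  have op1: "op_bound c (C - mat 1)"
  proof -
    have "op_bound (\<bar>- (1/2)\<bar> * (c * (1 + 1))) (- (1/2) *\<^sub>R (E ** (mat 1 + C)))"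
      by (intro op_bound_scaleR op_bound_mult op_bound_add op op_bound_orthogonal C orthogonal_matrix_id)
    then show ?thesis by (simp only: C1) simp
  qed
  have "op_bound (\<bar>1/2\<bar> * (c * c)) ((1/2) *\<^sub>R (E ** (- (C - mat 1))))"
    by (intro op_bound_scaleR op_bound_mult op op_bound_minus op1)
  then have "op_bound (c\<^sup>2 / 2) (C - mat 1 + E)"
    by (simp only: C2) (simp add: power2_eq_square)
  with that[OF C iff op1] show ?thesis by blast
qed

lemma assemble_diff:
  "assemble (s - s') U V = assemble s U V - (assemble s' U V :: ('m::{finite,linorder},'n::{finite,linorder}) mat)"
proof -
  have "diag_matrix (s - s') = diag_matrix s - (diag_matrix s' :: ('m,'n) mat)"
    by (auto simp: diag_matrix_def vec_eq_iff)
  then show ?thesis by (simp add: assemble_def matrix_distribs)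
qed

lemma norm_assemble:
  assumes "CARD('n) \<le> CARD('m)" "orthogonal_matrix U" "orthogonal_matrix V"
  shows "norm (assemble s U V :: ('m::{finite,linorder},'n::{finite,linorder}) mat) = norm s"
  using assms by (simp add: assemble_def)

context ls_problem
begin

definition lip :: real
  where "lip = onorm (adjoint \<A> \<circ> \<A>)"

lemma lin_gram: "bounded_linear (adjoint \<A> \<circ> \<A>)"
  using linear_compose[OF lin adjoint_linear[OF lin]] by (simp add: linear_conv_bounded_linear)

lemma lip_nonneg: "0 \<le> lip"
  unfolding lip_def by (rule onorm_pos_le[OF lin_gram])

lemma norm_A_sq: "(norm (\<A> Z))\<^sup>2 \<le> lip * (norm Z)\<^sup>2"
proof -
  have "(norm (\<A> Z))\<^sup>2 = Z \<bullet> (adjoint \<A> \<circ> \<A>) Z"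
    by (simp add: adjoint_works[OF lin] power2_norm_eq_inner)
  also have "\<dots> \<le> norm Z * norm ((adjoint \<A> \<circ> \<A>) Z)" by (rule norm_cauchy_schwarz)
  also have "\<dots> \<le> norm Z * (lip * norm Z)"
    unfolding lip_def by (intro mult_left_mono onorm[OF lin_gram]) auto
  finally show ?thesis by (simp add: power2_eq_square mult_ac)
qed

lemma transpose_grad_E: "transpose (grad_E \<A> b \<sigma> U V) = - grad_E \<A> b \<sigma> U V"
  and transpose_grad_F: "transpose (grad_F \<A> b \<sigma> U V) = - grad_F \<A> b \<sigma> U V"
  by (simp_all add: grad_E_def grad_F_def Let_def transpose_scalar transpose_diff matrix_transpose_mul
      flip: scaleR_minus_right)

text \<open>To first order a Cayley step sends \<open>X\<close> to
  \<open>X + X ** F - E ** X\<close>. With the next two lemmas this identifies the partial gradients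
  with derivatives of the loss along such moves; the minus sign is that of \<open>E ** X\<close>.
  Only the skew part of the product of gradient and \<open>X\<close> survives the pairing.\<close>

lemma grad_E_inner:
  assumes "transpose E = - E"
  shows "grad_E \<A> b \<sigma> U V \<bullet> E = - (grad_fit \<A> b (assemble \<sigma> U V) \<bullet> (E ** assemble \<sigma> U V))"
proof -
  define X where "X = assemble \<sigma> U V"
  define G where "G = grad_fit \<A> b X"
  have 1: "G \<bullet> (E ** X) = (G ** transpose X) \<bullet> E"
    by (metis inner_commute matrix_inner_right)
  have "(X ** transpose G) \<bullet> E = (G ** transpose X) \<bullet> transpose E"
    by (metis inner_transpose matrix_transpose_mul transpose_transpose)
  then have "(X ** transpose G) \<bullet> E = - ((G ** transpose X) \<bullet> E)" by (simp add: assms)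
  then show ?thesis
    by (simp add: grad_E_def Let_def inner_diff_left flip: X_def G_def 1)
qed

lemma grad_F_inner:
  assumes "transpose F = - F"
  shows "grad_F \<A> b \<sigma> U V \<bullet> F = grad_fit \<A> b (assemble \<sigma> U V) \<bullet> (assemble \<sigma> U V ** F)"
proof -
  define X where "X = assemble \<sigma> U V"
  define G where "G = grad_fit \<A> b X"
  have 1: "G \<bullet> (X ** F) = (transpose X ** G) \<bullet> F"
    by (metis inner_commute matrix_inner_left)
  have "(transpose G ** X) \<bullet> F = (transpose X ** G) \<bullet> transpose F"
    by (metis inner_transpose matrix_transpose_mul transpose_transpose)
  then have "(transpose G ** X) \<bullet> F = - ((transpose X ** G) \<bullet> F)" by (simp add: assms)
  then show ?thesis
    by (simp add: grad_F_def Let_def inner_diff_left flip: X_def G_def 1)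
qed

lemma grad_sigma_inner:
  "grad_sigma \<A> b \<sigma> U V \<bullet> d = grad_fit \<A> b (assemble \<sigma> U V) \<bullet> assemble d U V"
  unfolding inner_assemble[OF nm] grad_sigma_def
  by (simp add: inner_vec_def diag_of_nth[OF nm] mult.commute)

text \<open>The displacement is split into \<open>Y\<close> (change of \<sigma>), \<open>T\<close>
  (first-order rotation) and \<open>R\<close> (higher order), and inserted into the exact quadratic
  expansion of the loss. Of the coefficients of \<open>q\<^sup>2\<close>, those that persist for
  vanishing steps go into \<open>l_Omega\<close>; the bracket in the last summand tends to 0 with
  \<open>\<delta>\<close> and \<open>\<nu>\<close>.\<close>

lemma descent:
  fixes \<sigma> \<sigma>' :: "'n rvec"
  assumes UV: "orthogonal_matrix U" "orthogonal_matrix V"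
    and E: "transpose E = - E" and F: "transpose F = - F"
    and U': "(mat 1 + (1/2) *\<^sub>R E) ** transpose U' = (mat 1 - (1/2) *\<^sub>R E) ** transpose U"
    and V': "(mat 1 + (1/2) *\<^sub>R F) ** transpose V' = (mat 1 - (1/2) *\<^sub>R F) ** transpose V"
  defines "\<delta> \<equiv> norm (\<sigma>' - \<sigma>)" and "q \<equiv> norm (E, F)" and "x \<equiv> norm \<sigma>"
    and "\<gamma> \<equiv> norm (grad_fit \<A> b (assemble \<sigma> U V))"
  defines "\<nu> \<equiv> \<delta> + q * norm \<sigma>' / 2"
  shows "orthogonal_matrix U'" "orthogonal_matrix V'"
    and "norm (assemble \<sigma>' U' V' - assemble \<sigma> U V) \<le> \<delta> + (x + \<nu>) * q"
    and "fit \<A> b (assemble \<sigma>' U' V') \<le> fit \<A> b (assemble \<sigma> U V)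
      + grad_sigma \<A> b \<sigma> U V \<bullet> (\<sigma>' - \<sigma>) + grad_E \<A> b \<sigma> U V \<bullet> E + grad_F \<A> b \<sigma> U V \<bullet> F
      + l_sigma \<A> b \<sigma> U V * \<delta>\<^sup>2 + l_Omega \<A> b \<sigma> U V * q\<^sup>2
      + (\<gamma> * \<delta> / 2 + lip * (2 * x * \<nu> + \<nu>\<^sup>2)) * q\<^sup>2"
proof -
  define e where "e = norm E / sqrt 2"
  define p where "p = norm F / sqrt 2"
  have e: "op_bound e E" "0 \<le> e" and p: "op_bound p F" "0 \<le> p"
    by (simp_all add: e_def p_def op_bound_skew E F)
  obtain C where C: "orthogonal_matrix C" "transpose U' = C ** transpose U"
    and C_op: "op_bound e (C - mat 1)" "op_bound (e\<^sup>2 / 2) (C - mat 1 + E)"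
    using cayley_exists[OF E e(1)] U' by metis
  obtain K where K: "orthogonal_matrix K" "transpose V' = K ** transpose V"
    and K_op: "op_bound p (K - mat 1)" "op_bound (p\<^sup>2 / 2) (K - mat 1 + F)"
    using cayley_exists[OF F p(1)] V' by metis
  have Ue: "U' = U ** transpose C" and Ve: "V' = V ** transpose K"
    using arg_cong[OF C(2), of transpose] arg_cong[OF K(2), of transpose]
    by (simp_all add: matrix_transpose_mul)
  show "orthogonal_matrix U'" "orthogonal_matrix V'"
    using UV C K by (auto simp: Ue Ve intro!: orthogonal_matrix_mul)
  have e_eq: "(norm E)\<^sup>2 = 2 * e\<^sup>2" and p_eq: "(norm F)\<^sup>2 = 2 * p\<^sup>2"
    by (simp_all add: e_def p_def power_divide)
  have q_sq: "q\<^sup>2 = (norm E)\<^sup>2 + (norm F)\<^sup>2" by (simp add: q_def norm_Pair)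
  \<comment> \<open>The factors \<open>1 / sqrt 2\<close> in \<open>e\<close> and \<open>p\<close>
    pay exactly for passing from the sum of the two bounds to the joint norm
    \<open>q\<close>.\<close>
  have "(e + p)\<^sup>2 \<le> q\<^sup>2"
    using sum_squares_bound[of e p] by (simp add: q_sq e_eq p_eq power2_sum)
  then have ep: "e + p \<le> q" by (rule power2_le_imp_le) (simp add: q_def)
  have q0: "0 \<le> q" and d0: "0 \<le> \<delta>" and x0: "0 \<le> x" and g0: "0 \<le> \<gamma>"
    by (simp_all add: q_def \<delta>_def x_def \<gamma>_def)
  have nu0: "0 \<le> \<nu>" using d0 q0 by (simp add: \<nu>_def)
  define X where "X = assemble \<sigma> U V"
  define X1 where "X1 = assemble \<sigma>' U V"
  define X' where "X' = assemble \<sigma>' U' V'"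
  define Y where "Y = assemble (\<sigma>' - \<sigma>) U V"
  have norms: "norm X = x" "norm X1 = norm \<sigma>'" "norm Y = \<delta>"
    by (simp_all add: X_def X1_def Y_def x_def \<delta>_def norm_assemble nm UV)
  have Y: "X1 = X + Y" by (simp add: X_def X1_def Y_def assemble_diff)
  have X': "X' = C ** X1 ** transpose K"
    by (simp add: X'_def X1_def assemble_def C(2) Ve matrix_mul_assoc)
  define T where "T = X ** F - E ** X"
  define R where "R = Y ** F - E ** Y + (C - mat 1 + E) ** X1 + X1 ** transpose (K - mat 1 + F)
    + (C - mat 1) ** X1 ** transpose (K - mat 1)"
  have diff: "X' - X = Y + T + R"
    unfolding X' T_def R_def Y by (simp add: F transpose_add transpose_diff matrix_distribs)
  have "norm T \<le> x * p + e * x"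
    unfolding T_def
    by (rule order_trans[OF norm_triangle_ineq4])
      (use norm_matmul_right[OF p(1), of X] norm_matmul_left[OF e(1), of X] in \<open>simp add: norms mult_ac\<close>)
  also have "\<dots> = x * (e + p)" by (simp add: algebra_simps)
  also have "\<dots> \<le> x * q" by (intro mult_left_mono ep x0)
  finally have T: "norm T \<le> x * q" .
  have "norm R \<le> p * \<delta> + e * \<delta> + e\<^sup>2 / 2 * norm \<sigma>' + p\<^sup>2 / 2 * norm \<sigma>' + p * (e * norm \<sigma>')"
  proof -
    have "norm (Y ** F - E ** Y) \<le> p * \<delta> + e * \<delta>"
      by (rule order_trans[OF norm_triangle_ineq4])
        (use norm_matmul_right[OF p(1), of Y] norm_matmul_left[OF e(1), of Y] in \<open>simp add: norms\<close>)
    moreover have "norm ((C - mat 1 + E) ** X1) \<le> e\<^sup>2 / 2 * norm \<sigma>'"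
      using norm_matmul_left[OF C_op(2), of X1] by (simp add: norms)
    moreover have "norm (X1 ** transpose (K - mat 1 + F)) \<le> p\<^sup>2 / 2 * norm \<sigma>'"
      using norm_matmul_right[OF op_bound_transpose[OF K_op(2)], of X1] by (simp add: norms)
    moreover have "norm ((C - mat 1) ** X1 ** transpose (K - mat 1)) \<le> p * (e * norm \<sigma>')"
      by (rule order_trans[OF norm_matmul_right[OF op_bound_transpose[OF K_op(1)]]])
        (use norm_matmul_left[OF C_op(1), of X1] p(2) in \<open>simp add: norms mult_left_mono\<close>)
    ultimately show ?thesis
      unfolding R_def by (intro norm_triangle_le add_mono) auto
  qed
  also have "\<dots> = (e + p) * \<delta> + (e + p)\<^sup>2 / 2 * norm \<sigma>'" by (simp add: power2_sum field_simps)
  also have "\<dots> \<le> q * \<delta> + q\<^sup>2 / 2 * norm \<sigma>'"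
    using ep e p d0 \<open>(e + p)\<^sup>2 \<le> q\<^sup>2\<close> by (intro add_mono mult_right_mono divide_right_mono) auto
  also have "\<dots> = \<nu> * q" by (simp add: \<nu>_def field_simps power2_eq_square)
  finally have R: "norm R \<le> \<nu> * q" .
  have "norm (Y + T + R) \<le> \<delta> + x * q + \<nu> * q"
    using T R norms by (intro norm_triangle_le add_mono) auto
  then have dist: "norm (X' - X) \<le> \<delta> + (x + \<nu>) * q" by (simp add: diff distrib_right)
  then show "norm (assemble \<sigma>' U' V' - assemble \<sigma> U V) \<le> \<delta> + (x + \<nu>) * q"
    by (simp add: X'_def X_def)
  define G where "G = grad_fit \<A> b X"
  have g: "\<gamma> = norm G" by (simp add: \<gamma>_def G_def X_def)
  have GY: "G \<bullet> Y = grad_sigma \<A> b \<sigma> U V \<bullet> (\<sigma>' - \<sigma>)"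
    by (simp add: grad_sigma_inner G_def Y_def X_def)
  have GT: "G \<bullet> T = grad_E \<A> b \<sigma> U V \<bullet> E + grad_F \<A> b \<sigma> U V \<bullet> F"
    by (simp add: grad_E_inner[OF E] grad_F_inner[OF F] G_def X_def T_def inner_diff_right)
  have GR: "G \<bullet> R \<le> \<gamma> * (\<nu> * q)"
    using norm_cauchy_schwarz[of G R] mult_left_mono[OF R g0] by (simp add: g)
  have AX: "(norm (\<A> (X' - X)))\<^sup>2 / 2 \<le> lip * (\<delta>\<^sup>2 + (x + \<nu>)\<^sup>2 * q\<^sup>2)"
  proof -
    have "(norm (\<A> (X' - X)))\<^sup>2 \<le> lip * (\<delta> + (x + \<nu>) * q)\<^sup>2"
      by (rule order_trans[OF norm_A_sq]) (intro mult_left_mono power_mono dist norm_ge_zero lip_nonneg)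
    also have "\<dots> \<le> lip * (2 * (\<delta>\<^sup>2 + ((x + \<nu>) * q)\<^sup>2))"
      using sum_squares_bound[of \<delta> "(x + \<nu>) * q"]
      by (intro mult_left_mono lip_nonneg) (simp add: power2_sum)
    finally show ?thesis by (simp add: power_mult_distrib distrib_left)
  qed
  \<comment> \<open>The product \<open>\<delta> * q\<close> hidden in \<open>\<nu> * q\<close> is
    divided evenly between the two squares, which is the origin of the term 1/2 in
    \<open>l_Omega\<close>.\<close>
  have ge: "\<gamma> * (\<nu> * q) \<le> \<gamma> * (\<delta>\<^sup>2 / 2 + q\<^sup>2 / 2 + (x + \<delta>) / 2 * q\<^sup>2)"
  proof (rule mult_left_mono[OF _ g0])
    have "norm \<sigma>' \<le> x + \<delta>" unfolding x_def \<delta>_def by (rule norm_triangle_sub)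
    then have "norm \<sigma>' / 2 * q\<^sup>2 \<le> (x + \<delta>) / 2 * q\<^sup>2" by (intro mult_right_mono) auto
    then show "\<nu> * q \<le> \<delta>\<^sup>2 / 2 + q\<^sup>2 / 2 + (x + \<delta>) / 2 * q\<^sup>2"
      using sum_squares_bound[of \<delta> q] by (simp add: \<nu>_def power2_eq_square field_simps)
  qed
  have "fit \<A> b X' = fit \<A> b X + (G \<bullet> Y + G \<bullet> T + G \<bullet> R) + (norm (\<A> (X' - X)))\<^sup>2 / 2"
    unfolding fit_expand[of X' X] diff by (simp add: G_def inner_add_right)
  also have "\<dots> \<le> fit \<A> b X + (G \<bullet> Y + G \<bullet> T + \<gamma> * (\<delta>\<^sup>2 / 2 + q\<^sup>2 / 2 + (x + \<delta>) / 2 * q\<^sup>2))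
      + lip * (\<delta>\<^sup>2 + (x + \<nu>)\<^sup>2 * q\<^sup>2)"
    using GR AX ge by linarith
  also have "\<dots> = fit \<A> b X + G \<bullet> Y + G \<bullet> T + (lip + \<gamma> / 2) * \<delta>\<^sup>2 + (lip * x\<^sup>2 + (1/2 + x / 2) * \<gamma>) * q\<^sup>2
      + (\<gamma> * \<delta> / 2 + lip * (2 * x * \<nu> + \<nu>\<^sup>2)) * q\<^sup>2"
    by (simp add: power2_sum algebra_simps)
  also have "\<dots> \<le> fit \<A> b X + G \<bullet> Y + G \<bullet> T + l_sigma \<A> b \<sigma> U V * \<delta>\<^sup>2 + l_Omega \<A> b \<sigma> U V * q\<^sup>2
      + (\<gamma> * \<delta> / 2 + lip * (2 * x * \<nu> + \<nu>\<^sup>2)) * q\<^sup>2"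
  proof -
    have "0 \<le> lip * x" "0 \<le> x * \<gamma>" using lip_nonneg x0 g0 by simp_all
    then have "lip + \<gamma> / 2 \<le> l_sigma \<A> b \<sigma> U V"
      "lip * x\<^sup>2 + (1/2 + x / 2) * \<gamma> \<le> l_Omega \<A> b \<sigma> U V"
      using g0 x0 unfolding l_sigma_def l_Omega_def lip_def[symmetric] x_def[symmetric] \<gamma>_def[symmetric]
      by (simp_all add: algebra_simps)
    from mult_right_mono[OF this(1), of "\<delta>\<^sup>2"] mult_right_mono[OF this(2), of "q\<^sup>2"]
    show ?thesis by simp
  qed
  finally show "fit \<A> b (assemble \<sigma>' U' V') \<le> fit \<A> b (assemble \<sigma> U V)
      + grad_sigma \<A> b \<sigma> U V \<bullet> (\<sigma>' - \<sigma>) + grad_E \<A> b \<sigma> U V \<bullet> E + grad_F \<A> b \<sigma> U V \<bullet> F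
      + l_sigma \<A> b \<sigma> U V * \<delta>\<^sup>2 + l_Omega \<A> b \<sigma> U V * q\<^sup>2
      + (\<gamma> * \<delta> / 2 + lip * (2 * x * \<nu> + \<nu>\<^sup>2)) * q\<^sup>2"
    by (simp add: X'_def X_def GY GT)
qed

end

section \<open>Geometry of the solution set\<close>

text \<open>On the orthogonal complement of its kernel a linear map between Euclidean spaces is
  bounded below. The component of \<open>z\<close> in the kernel is the witness
  \<open>y\<close>.\<close>

lemma kernel_distance_bound:
  fixes f :: "'a::euclidean_space \<Rightarrow> 'b::euclidean_space"
  assumes f: "linear f"
  obtains C where "0 < C" "\<And>z. \<exists>y. f y = 0 \<and> norm (z - y) \<le> C * norm (f z)"
proof -
  define K where "K = {x. f x = 0}"
  define L where "L = {y. \<forall>x\<in>K. orthogonal x y}"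
  have K: "subspace K" unfolding K_def by (rule linear_subspace_kernel[OF f])
  have L: "subspace L" unfolding L_def by (rule subspace_orthogonal_to_vectors)
  have "\<forall>x\<in>L. f x = 0 \<longrightarrow> x = 0"
  proof (intro ballI impI)
    fix x assume "x \<in> L" "f x = 0"
    then have "orthogonal x x" unfolding L_def K_def by blast
    then show "x = 0" by (simp add: orthogonal_self)
  qed
  then obtain e where e: "0 < e" "\<And>x. x \<in> L \<Longrightarrow> norm (f x) \<ge> e * norm x"
    using injective_imp_isometric[OF closed_subspace[OF L] L linear_conv_bounded_linear[THEN iffD1, OF f]]
    by blast
  show thesis
  proof (rule that)
    show "0 < 1 / e" using e by simp
    show "\<exists>y. f y = 0 \<and> norm (z - y) \<le> 1 / e * norm (f z)" for z
    proof -
      obtain y w where yw: "y \<in> span K" "\<And>v. v \<in> span K \<Longrightarrow> orthogonal w v" "z = y + w"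
        using orthogonal_subspace_decomp_exists[of K z] by metis
      have y: "f y = 0" using yw(1) K by (simp add: span_eq_iff[THEN iffD2] K_def)
      have "w \<in> L" unfolding L_def using yw(2) span_base by (auto simp: orthogonal_commute)
      then have "e * norm w \<le> norm (f w)" by (rule e(2))
      then show ?thesis
        using y yw(3) e(1) by (intro exI[of _ y]) (simp add: linear_add[OF f] field_simps)
    qed
  qed
qed

text \<open>
  A symmetric diagonally dominant matrix with nonnegative diagonal is a nonnegative combination of
  the matrices \<open>v v\<^sup>T\<close> with \<open>v\<close> a unit vector or \<open>v = e\<^sub>i \<plusminus> e\<^sub>j\<close>; so its inner product with a
  contraction is at most its trace.
\<close>

lemma diagonally_dominant_trace:
  fixes S z :: "'i \<Rightarrow> 'i \<Rightarrow> real"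
  assumes I: "finite I"
    and sym: "\<And>i j. i \<in> I \<Longrightarrow> j \<in> I \<Longrightarrow> S i j = S j i"
    and dom: "\<And>i. i \<in> I \<Longrightarrow> (\<Sum>j\<in>I - {i}. \<bar>S i j\<bar>) \<le> S i i"
    and z1: "\<And>i. i \<in> I \<Longrightarrow> z i i \<le> 1"
    and z2: "\<And>i j. i \<in> I \<Longrightarrow> j \<in> I \<Longrightarrow> i \<noteq> j \<Longrightarrow> \<bar>z i j + z j i\<bar> \<le> 2 - z i i - z j j"
  shows "(\<Sum>i\<in>I. \<Sum>j\<in>I. z i j * S i j) \<le> (\<Sum>i\<in>I. S i i)"
proof -
  define w where "w = (\<lambda>i j. if i = j then 0 else \<bar>S i j\<bar>)"
  have wsym: "w i j = w j i" if "i \<in> I" "j \<in> I" for i j using sym[OF that] by (simp add: w_def)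
  have wsum: "(\<Sum>j\<in>I. w i j) \<le> S i i" if "i \<in> I" for i
  proof -
    have "(\<Sum>j\<in>I. w i j) = (\<Sum>j\<in>I - {i}. \<bar>S i j\<bar>)"
      by (subst sum.remove[OF I that], simp add: w_def) (intro sum.cong, auto simp: w_def)
    with dom[OF that] show ?thesis by simp
  qed
  have "(\<Sum>i\<in>I. \<Sum>j\<in>I. z i j * S i j) = (\<Sum>i\<in>I. \<Sum>j\<in>I. z j i * S i j)"
    by (subst sum.swap) (intro sum.cong refl, simp add: sym)
  then have "2 * (\<Sum>i\<in>I. \<Sum>j\<in>I. z i j * S i j) = (\<Sum>i\<in>I. \<Sum>j\<in>I. (z i j + z j i) * S i j)"
    by (simp add: distrib_right sum.distrib)
  also have "\<dots> \<le> (\<Sum>i\<in>I. \<Sum>j\<in>I. (if i = j then 2 * (z i i * S i i) else 0) + (w i j * (1 - z i i) + w i j * (1 - z j j)))"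
  proof (intro sum_mono)
    fix i j assume ij: "i \<in> I" "j \<in> I"
    show "(z i j + z j i) * S i j \<le> (if i = j then 2 * (z i i * S i i) else 0) + (w i j * (1 - z i i) + w i j * (1 - z j j))"
    proof (cases "i = j")
      case False
      have "(z i j + z j i) * S i j \<le> \<bar>z i j + z j i\<bar> * \<bar>S i j\<bar>" by (metis abs_ge_self abs_mult)
      also have "\<dots> \<le> (2 - z i i - z j j) * \<bar>S i j\<bar>" using z2[OF ij False] by (intro mult_right_mono) auto
      finally show ?thesis using False by (simp add: w_def algebra_simps)
    qed (simp add: w_def)
  qed
  also have "\<dots> = (\<Sum>i\<in>I. 2 * (z i i * S i i)) + ((\<Sum>i\<in>I. \<Sum>j\<in>I. w i j * (1 - z i i)) + (\<Sum>i\<in>I. \<Sum>j\<in>I. w i j * (1 - z j j)))"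
    using I by (simp add: sum.distrib)
  also have "(\<Sum>i\<in>I. \<Sum>j\<in>I. w i j * (1 - z j j)) = (\<Sum>i\<in>I. \<Sum>j\<in>I. w i j * (1 - z i i))"
    by (subst sum.swap) (intro sum.cong refl, simp add: wsym)
  also have "(\<Sum>i\<in>I. 2 * (z i i * S i i)) + ((\<Sum>i\<in>I. \<Sum>j\<in>I. w i j * (1 - z i i)) + (\<Sum>i\<in>I. \<Sum>j\<in>I. w i j * (1 - z i i)))
      = 2 * (\<Sum>i\<in>I. z i i * S i i + (\<Sum>j\<in>I. w i j) * (1 - z i i))"
    by (simp add: sum.distrib sum_distrib_left sum_distrib_right)
  \<comment> \<open>Dominance enters here: the row sums of \<open>w\<close> multiply the nonnegative
    numbers \<open>1 - z i i\<close>, so they may be replaced by \<open>S i i\<close>, after which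
    \<open>z\<close> cancels.\<close>
  also have "\<dots> \<le> 2 * (\<Sum>i\<in>I. z i i * S i i + S i i * (1 - z i i))"
    using wsum z1 by (intro mult_left_mono sum_mono add_left_mono mult_right_mono) auto
  finally show ?thesis by (simp add: algebra_simps)
qed

text \<open>Test \<open>Z\<close> on the sum and on the difference of two coordinate vectors on each
  side; these have norm \<open>sqrt 2\<close>, so the pairing is at most 2.\<close>

lemma contraction_symmetric_entries:
  assumes Z: "op_bound 1 (Z :: real^'n^'m)" and ne: "p \<noteq> p'" "q \<noteq> q'"
  shows "\<bar>Z $ p $ q' + Z $ p' $ q\<bar> \<le> 2 - Z $ p $ q - Z $ p' $ q'"
proof -
  have "Z $ p $ q + Z $ p' $ q' + c * (Z $ p $ q' + Z $ p' $ q) \<le> 2" if c: "c\<^sup>2 = 1" for c :: real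
  proof -
    let ?u = "axis p 1 + c *\<^sub>R axis p' 1 :: real^'m" and ?v = "axis q 1 + c *\<^sub>R axis q' 1 :: real^'n"
    have norm: "norm (axis i 1 + c *\<^sub>R axis i' 1 :: (real,'k) vec) = sqrt 2" if "i \<noteq> i'" for i i' :: "'k::finite"
      using c that by (simp add: norm_eq_sqrt_inner inner_add_left inner_add_right inner_axis_axis power2_eq_square)
    have entry: "axis i 1 \<bullet> (Z *v axis j 1) = Z $ i $ j" for i j
      by (simp add: matrix_vector_mult_basis column_def inner_axis')
    have "?u \<bullet> (Z *v ?v) \<le> 1 * norm ?u * norm ?v" by (rule op_bound_inner[OF Z])
    then have "?u \<bullet> (Z *v ?v) \<le> 2" by (simp add: norm ne)
    moreover have "?u \<bullet> (Z *v ?v) = Z $ p $ q + c * Z $ p $ q' + (c * Z $ p' $ q + c * c * Z $ p' $ q')"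
      by (simp add: inner_add_left inner_add_right matrix_vector_right_distrib matrix_vector_mult_scaleR entry algebra_simps)
    ultimately show ?thesis using c by (simp add: power2_eq_square distrib_left)
  qed
  from this[of 1] this[of "-1"] show ?thesis by simp
qed

section \<open>The face exposed by an identity block with a strict contraction\<close>

context
  fixes I :: "'n::{finite,linorder} set"
  assumes nm: "CARD('n) \<le> CARD('m::{finite,linorder})"
begin

definition off_block :: "('m,'n) mat \<Rightarrow> bool"
  where "off_block N \<longleftrightarrow> (\<forall>i\<in>I. \<forall>j. N $ row_of i $ j = 0) \<and> (\<forall>i\<in>I. \<forall>p. N $ p $ i = 0)"

definition unit_block :: "('m,'n) mat"
  where "unit_block = diag_matrix (\<chi> i. if i \<in> I then 1 else 0)"

text \<open>\<open>col_off\<close> and \<open>row_off\<close> are the coordinate projections onto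
  the columns and rows that \<open>unit_block\<close> does not use. Membership in the complementary
  block becomes an algebraic identity with them.\<close>

definition col_off :: "('n,'n) mat"
  where "col_off = (\<chi> i j. if i = j \<and> i \<notin> I then 1 else 0)"

definition row_off :: "('m,'m) mat"
  where "row_off = (\<chi> p q. if p = q \<and> p \<notin> row_of ` I then 1 else 0)"

lemma transpose_off [simp]: "transpose col_off = col_off" "transpose row_off = row_off"
  by (auto simp: transpose_def col_off_def row_off_def vec_eq_iff)

lemma mult_col_off: "((M :: ('k::finite,'n) mat) ** col_off) $ p $ j = (if j \<in> I then 0 else M $ p $ j)"
proof -
  have "(M ** col_off) $ p $ j = (\<Sum>k\<in>UNIV. if k = j then (if j \<in> I then 0 else M $ p $ j) else 0)"
    by (simp only: matrix_matrix_mult_def vec_lambda_beta, intro sum.cong) (auto simp: col_off_def)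
  then show ?thesis by simp
qed

lemma mult_row_off: "(row_off ** (M :: ('m,'k::finite) mat)) $ p $ j = (if p \<in> row_of ` I then 0 else M $ p $ j)"
proof -
  have "(row_off ** M) $ p $ j = (\<Sum>k\<in>UNIV. if k = p then (if p \<in> row_of ` I then 0 else M $ p $ j) else 0)"
    by (simp only: matrix_matrix_mult_def vec_lambda_beta, intro sum.cong) (auto simp: row_off_def)
  then show ?thesis by simp
qed

lemma unit_block_off: "unit_block ** col_off = 0" "row_off ** unit_block = 0"
  by (auto simp: vec_eq_iff mult_col_off mult_row_off unit_block_def diag_matrix_nth[OF nm])

lemma off_block_off: "off_block N \<Longrightarrow> N ** col_off = N" "off_block N \<Longrightarrow> row_off ** N = N"
  by (auto simp: vec_eq_iff mult_col_off mult_row_off off_block_def)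

text \<open>The two summands have orthogonal ranges and read disjoint sets of coordinates, so
  Pythagoras applies on both sides.\<close>

lemma unit_block_contraction:
  assumes N: "off_block N" "op_bound 1 N"
  shows "op_bound 1 (unit_block + N)"
  unfolding op_bound_def
proof
  fix z :: "'n rvec"
  define y where "y = (\<chi> i. if i \<in> I then 0 else z $ i)"
  have Ny: "N *v z = N *v y"
    using N(1) by (simp add: vec_eq_iff matrix_vector_mult_def, intro allI sum.cong) (auto simp: y_def off_block_def)
  have "(unit_block *v z) \<bullet> (N *v z) = (transpose N ** unit_block *v z) \<bullet> z"
    unfolding matrix_vector_mul_assoc[symmetric] by (simp add: dot_lmul_matrix)
  also have "transpose N ** unit_block = transpose (row_off ** N) ** unit_block"
    by (simp add: off_block_off N)
  also have "\<dots> = 0"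
    by (simp add: matrix_transpose_mul unit_block_off flip: matrix_mul_assoc)
  finally have orth: "(unit_block *v z) \<bullet> (N *v z) = 0" by simp
  have "(norm (unit_block *v z))\<^sup>2 = (\<Sum>j\<in>UNIV. (if j \<in> I then z $ j else 0)\<^sup>2)"
    unfolding unit_block_def norm_diag_matrix_mult_vec[OF nm] by (intro sum.cong) auto
  moreover have "(norm (N *v z))\<^sup>2 \<le> (norm y)\<^sup>2"
    using op_boundD[OF N(2), of y] by (simp add: Ny power_mono)
  ultimately have "(norm ((unit_block + N) *v z))\<^sup>2 \<le> (\<Sum>j\<in>UNIV. (if j \<in> I then z $ j else 0)\<^sup>2 + (y $ j)\<^sup>2)"
    by (simp add: matrix_vector_mult_add_rdistrib power2_norm_add orth sum.distrib norm_sq_cart[of y])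
  also have "\<dots> = (norm z)\<^sup>2"
    unfolding norm_sq_cart by (intro sum.cong) (auto simp: y_def)
  finally have "(norm ((unit_block + N) *v z))\<^sup>2 \<le> (norm z)\<^sup>2" .
  from power2_le_imp_le[OF this norm_ge_zero] show "norm ((unit_block + N) *v z) \<le> 1 * norm z"
    by simp
qed

text \<open>The matrices \<open>Y\<close> fixed by \<open>Y \<mapsto> \<Gamma> Y\<^sup>T \<Gamma>\<close> span the face exposed by \<open>\<Gamma>\<close>.\<close>

lemma fixed_point_block:
  assumes N: "off_block N" "op_bound \<theta> N" "\<theta> < 1"
    and Y: "Y = (unit_block + N) ** transpose Y ** (unit_block + N)"
  shows "p \<notin> row_of ` I \<Longrightarrow> Y $ p $ j = 0" "j \<notin> I \<Longrightarrow> Y $ p $ j = 0"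
    "i \<in> I \<Longrightarrow> j \<in> I \<Longrightarrow> Y $ row_of i $ j = Y $ row_of j $ i"
proof -
  let ?D = "unit_block + N"
  have op: "op_bound 1 ?D"
    by (rule unit_block_contraction[OF N(1) op_bound_mono[OF N(2)]]) (use N(3) in simp)
  have th: "0 \<le> \<theta>" by (rule op_bound_nonneg[OF N(2)])
  have DP: "?D ** col_off = N" and QD: "row_off ** ?D = N"
    by (simp_all add: matrix_distribs unit_block_off off_block_off N)
  have YtN: "transpose Y ** N = transpose (row_off ** Y) ** N"
    by (simp add: matrix_transpose_mul off_block_off N flip: matrix_mul_assoc)
  have NYt: "N ** transpose Y = N ** transpose (Y ** col_off)"
    by (simp add: matrix_transpose_mul off_block_off N matrix_mul_assoc)
  have YP: "Y ** col_off = ?D ** (transpose (row_off ** Y) ** N)"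
  proof -
    have "Y ** col_off = ?D ** transpose Y ** ?D ** col_off" using Y by simp
    also have "\<dots> = ?D ** (transpose Y ** N)" by (simp add: DP flip: matrix_mul_assoc)
    finally show ?thesis by (simp only: YtN)
  qed
  have QY: "row_off ** Y = N ** transpose (Y ** col_off) ** ?D"
  proof -
    have "row_off ** Y = row_off ** (?D ** transpose Y ** ?D)" using Y by simp
    also have "\<dots> = N ** transpose Y ** ?D" by (simp add: QD matrix_mul_assoc)
    finally show ?thesis by (simp only: NYt)
  qed
  \<comment> \<open>The parts of \<open>Y\<close> outside the block bound each other, each time with
    a factor \<theta> contributed by \<open>N\<close>; since \<theta> squared is below 1, both
    vanish.\<close>
  have "norm (Y ** col_off) \<le> \<theta> * norm (row_off ** Y)"
    using norm_matmul_left[OF op, of "transpose (row_off ** Y) ** N"] norm_matmul_right[OF N(2), of "transpose (row_off ** Y)"]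
    by (simp add: YP[symmetric])
  moreover have "norm (row_off ** Y) \<le> \<theta> * norm (Y ** col_off)"
    using norm_matmul_right[OF op, of "N ** transpose (Y ** col_off)"] norm_matmul_left[OF N(2), of "transpose (Y ** col_off)"]
    by (simp add: QY[symmetric])
  ultimately have "norm (Y ** col_off) \<le> \<theta> * (\<theta> * norm (Y ** col_off))"
    using th by (meson mult_left_mono order_trans)
  moreover have "\<theta> * \<theta> < 1"
    using mult_left_le[of \<theta> \<theta>] th N(3) by linarith
  ultimately have "(1 - \<theta> * \<theta>) * norm (Y ** col_off) \<le> 0" "0 < 1 - \<theta> * \<theta>"
    by (simp_all add: algebra_simps)
  then have YP0: "Y ** col_off = 0"
    by (simp add: mult_le_0_iff)
  then have QY0: "row_off ** Y = 0" by (simp add: QY)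
  show "p \<notin> row_of ` I \<Longrightarrow> Y $ p $ j = 0"
    using mult_row_off[of Y p j] QY0 by simp
  show "j \<notin> I \<Longrightarrow> Y $ p $ j = 0"
    using mult_col_off[of Y p j] YP0 by simp
  assume ij: "i \<in> I" "j \<in> I"
  \<comment> \<open>With both outer parts gone \<open>N\<close> drops out of the equation, and what
    remains is symmetry of the block.\<close>
  have "transpose Y ** N = 0" "N ** transpose Y = 0" by (simp_all add: YtN NYt QY0 YP0)
  then have Y': "Y = unit_block ** transpose Y ** unit_block"
    using Y by (simp add: matrix_distribs flip: matrix_mul_assoc)
  have "Y $ row_of i $ j = (unit_block ** (transpose Y ** unit_block)) $ row_of i $ j"
    using Y' by (simp add: matrix_mul_assoc)
  also have "\<dots> = Y $ row_of j $ i"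
    unfolding unit_block_def diag_mult_nth[OF nm] using ij by (simp add: transpose_def)
  finally show "Y $ row_of i $ j = Y $ row_of j $ i" .
qed

lemma diag_off_block:
  assumes N: "off_block N" and s: "\<And>i. i \<notin> I \<Longrightarrow> s $ i = 0"
  shows "transpose (diag_matrix s) ** N = 0" "N ** transpose (diag_matrix s :: ('m,'n) mat) = 0"
proof -
  let ?S = "diag_matrix s :: ('m,'n) mat"
  have QS: "row_off ** ?S = 0" and SP: "?S ** col_off = 0"
    by (auto simp: vec_eq_iff mult_col_off mult_row_off diag_matrix_nth[OF nm] intro!: s)
  have "transpose ?S ** N = transpose (row_off ** ?S) ** N"
    by (simp add: matrix_transpose_mul off_block_off N flip: matrix_mul_assoc)
  moreover have "N ** transpose ?S = N ** transpose (?S ** col_off)"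
    by (simp add: matrix_transpose_mul off_block_off N matrix_mul_assoc)
  ultimately show "transpose ?S ** N = 0" "N ** transpose ?S = 0" by (simp_all add: QS SP)
qed

text \<open>\<open>N\<close> annihilates a diagonal matrix supported on \<open>I\<close> from both
  sides, and the identity block reproduces it.\<close>

lemma diag_fixed:
  assumes N: "off_block N" and s: "\<And>i. i \<notin> I \<Longrightarrow> s $ i = 0"
  shows "diag_matrix s = (unit_block + N) ** transpose (diag_matrix s) ** (unit_block + N)"
proof -
  let ?S = "diag_matrix s :: ('m,'n) mat"
  note 0 = diag_off_block[OF N s]
  have "transpose ?S ** unit_block = (\<chi> i j. if i = j then s $ j else 0)"
    by (simp add: vec_eq_iff diag_mult_nth(3)[OF nm] unit_block_def diag_matrix_nth[OF nm] row_of_inject[OF nm] s)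
  moreover have "unit_block ** (\<chi> i j. if i = j then s $ j else 0) = ?S"
  proof -
    have "(unit_block ** (\<chi> i j. if i = j then s $ j else 0)) $ p $ j = (\<Sum>l\<in>UNIV. if l = j then ?S $ p $ j else 0)" for p j
      by (simp only: matrix_matrix_mult_def vec_lambda_beta, intro sum.cong)
        (auto simp: unit_block_def diag_matrix_nth[OF nm] s)
    then show ?thesis by (simp add: vec_eq_iff)
  qed
  ultimately show ?thesis
    using 0 by (simp add: matrix_distribs flip: matrix_mul_assoc)
qed

end

section \<open>The error bound\<close>

lemma norm_mat_le_sum: "norm (M :: real^'n^'m) \<le> (\<Sum>p\<in>UNIV. \<Sum>j\<in>UNIV. \<bar>M $ p $ j\<bar>)"
proof -
  have "norm M \<le> (\<Sum>p\<in>UNIV. norm (M $ p))"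
    unfolding norm_vec_def[of M] by (rule L2_set_le_sum) simp
  also have "\<dots> \<le> (\<Sum>p\<in>UNIV. \<Sum>j\<in>UNIV. \<bar>M $ p $ j\<bar>)"
    by (intro sum_mono norm_le_l1_cart)
  finally show ?thesis .
qed

text \<open>Cramer's rule up to constants: the determinant \<open>c\<close> has a nonzero limit, so
  the quotients \<open>x k / c k\<close> and \<open>y k / c k\<close> are bounded.\<close>

lemma bigo_solve_quotient:
  fixes f u v g x y c :: "nat \<Rightarrow> real"
  assumes eq: "\<And>k. c k * f k = x k * u k + y k * v k"
    and lims: "c \<longlonglongrightarrow> c'" "c' \<noteq> 0" "x \<longlonglongrightarrow> x'" "y \<longlonglongrightarrow> y'"
    and O: "u \<in> O(g)" "v \<in> O(g)"
  shows "f \<in> O(g)"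
proof -
  have 1: "(\<lambda>k. x k / c k) \<in> O(\<lambda>_. 1)" "(\<lambda>k. y k / c k) \<in> O(\<lambda>_. 1)"
    using lims by (auto intro!: bigoI_tendsto tendsto_divide)
  have "(\<lambda>k. x k / c k * u k + y k / c k * v k) \<in> O(g)"
    using landau_o.big.mult[OF 1(1) O(1)] landau_o.big.mult[OF 1(2) O(2)] by (intro sum_in_bigo) simp_all
  moreover have "eventually (\<lambda>k. x k / c k * u k + y k / c k * v k = f k) sequentially"
    using tendsto_imp_eventually_ne[OF lims(1,2)]
  proof eventually_elim
    case (elim k)
    then show ?case using eq[of k] by (simp add: field_simps)
  qed
  ultimately show ?thesis by (simp add: landau_o.big.in_cong)
qed

lemma conjugate_fixed:
  assumes "orthogonal_matrix U" "orthogonal_matrix V"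
  shows "(transpose U ** (M :: real^'n^'m) ** V) ** transpose (transpose U ** Y ** V) ** (transpose U ** M ** V)
    = transpose U ** (M ** transpose Y ** M) ** V"
  using assms by (simp add: matrix_transpose_mul matrix_mul_assoc orthogonal_matrixD)

lemma inner_rotate:
  assumes "orthogonal_matrix U" "orthogonal_matrix V"
  shows "(U ** A ** transpose V) \<bullet> (U ** B ** transpose V) = A \<bullet> (B :: real^'n^'m)"
proof -
  have "(U ** A ** transpose V) \<bullet> (U ** B ** transpose V) = A \<bullet> (transpose U ** (U ** B ** transpose V ** V))"
    unfolding matrix_inner_right[of "U ** A"] matrix_inner_left[of U A] by simp
  also have "transpose U ** (U ** B ** transpose V ** V) = B"
    using assms by (simp add: orthogonal_matrixD flip: matrix_mul_assoc)
  finally show ?thesis .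
qed

text \<open>No stepsizes occur here: the estimates must hold for trial steps of the backtracking as
  well as for accepted ones. \<open>\<theta>\<close> and \<open>N\<close> are the data produced by
  \<open>strict_complementarity\<close>.\<close>

locale dpga_limit = ls_problem \<A> b lam
  for \<A> :: "('m::{finite,linorder},'n::{finite,linorder}) mat \<Rightarrow> 'l::finite rvec"
    and b :: "'l rvec" and lam :: real +
  fixes \<sigma> :: "nat \<Rightarrow> 'n rvec" and U :: "nat \<Rightarrow> ('m,'m) mat" and V :: "nat \<Rightarrow> ('n,'n) mat"
    and \<sigma>b :: "'n rvec" and Ub :: "('m,'m) mat" and Vb :: "('n,'n) mat"
    and I :: "'n set" and \<theta> :: real and N :: "('m,'n) mat"
  assumes orth: "\<And>k. orthogonal_matrix (U k)" "\<And>k. orthogonal_matrix (V k)"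
    and lims: "\<sigma> \<longlonglongrightarrow> \<sigma>b" "U \<longlonglongrightarrow> Ub" "V \<longlonglongrightarrow> Vb"
    and \<sigma>b: "\<And>i. i \<in> I \<Longrightarrow> 0 < \<sigma>b $ i" "\<And>i. i \<notin> I \<Longrightarrow> \<sigma>b $ i = 0" "inj_on (($) \<sigma>b) I"
    and minimal: "\<And>Y. obj (assemble \<sigma>b Ub Vb) \<le> obj Y"
    and N: "off_block I N" "op_bound \<theta> N" "\<theta> < 1"
    and grad_limit: "Ub ** grad_fit \<A> b (assemble \<sigma>b Ub Vb) ** transpose Vb = - (lam *\<^sub>R (unit_block I + N))"
begin

section \<open>Gradients in the moving singular bases\<close>

lemma orth_limit: "orthogonal_matrix Ub" "orthogonal_matrix Vb"
  using orthogonal_matrix_limit orth lims by blast+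

definition X where "X k = assemble (\<sigma> k) (U k) (V k)"
definition Xb where "Xb = assemble \<sigma>b Ub Vb"
definition G where "G k = grad_fit \<A> b (X k)"
definition Gb where "Gb = grad_fit \<A> b Xb"
definition Gr where "Gr k = U k ** G k ** transpose (V k)"
definition gE where "gE k = grad_E \<A> b (\<sigma> k) (U k) (V k)"
definition gF where "gF k = grad_F \<A> b (\<sigma> k) (U k) (V k)"
definition g where "g k = grad_sigma \<A> b (\<sigma> k) (U k) (V k)"
text \<open>Entries in \<open>I\<close> are eventually positive, where the absolute value has slope
  1; thus \<open>a\<close> is the gradient in \<sigma> of the whole objective on the
  support.\<close>

definition a where "a k = (\<chi> i. if i \<in> I then g k $ i + lam else 0)"
definition \<beta> where "\<beta> k = norm (gE k, gF k)"
definition \<tau> where "\<tau> k = (\<Sum>i\<in>- I. \<bar>\<sigma> k $ i\<bar>)"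
text \<open>Chosen such that \<open>Sr\<close> vanishes identically on the complementary block; only
  entries in a row or column belonging to \<open>I\<close> remain to be estimated.\<close>

definition Nk :: "nat \<Rightarrow> ('m,'n) mat" where "Nk k = (\<chi> p j. if p \<in> row_of ` I \<or> j \<in> I then 0 else - (1 / lam) * Gr k $ p $ j)"
definition Sr where "Sr k = Gr k + lam *\<^sub>R (unit_block I + Nk k)"

lemma diag_lim: "s \<longlonglongrightarrow> s' \<Longrightarrow> (\<lambda>k. diag_matrix (s k) :: ('m,'n) mat) \<longlonglongrightarrow> diag_matrix s'"
  by (intro vec_tendstoI) (auto simp: diag_matrix_def intro!: tendsto_intros)

lemma X_lim: "X \<longlonglongrightarrow> Xb"
  unfolding X_def Xb_def assemble_def by (intro tendsto_intros diag_lim lims)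

lemma A_lim: "Y \<longlonglongrightarrow> Y' \<Longrightarrow> (\<lambda>k. \<A> (Y k)) \<longlonglongrightarrow> \<A> Y'"
  by (rule bounded_linear.tendsto[OF linear_conv_bounded_linear[THEN iffD1, OF lin]])

lemma bl_adj: "bounded_linear (adjoint \<A>)"
  using adjoint_linear[OF lin] by (simp add: linear_conv_bounded_linear)

lemma G_lim: "G \<longlonglongrightarrow> Gb"
  unfolding G_def Gb_def grad_fit_def
  by (intro bounded_linear.tendsto[OF bl_adj] tendsto_intros A_lim X_lim)

lemma Gr_lim: "Gr \<longlonglongrightarrow> - (lam *\<^sub>R (unit_block I + N))"
  unfolding Gr_def grad_limit[symmetric]
  by (intro tendsto_intros lims G_lim[unfolded Gb_def Xb_def])

lemma \<sigma>_lim: "(\<lambda>k. \<sigma> k $ i) \<longlonglongrightarrow> \<sigma>b $ i"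
  by (intro tendsto_intros lims)

lemma unit_block_nth: "(unit_block I :: ('m,'n) mat) $ p $ j = (if p = row_of j \<and> j \<in> I then 1 else 0)"
  by (simp add: unit_block_def[OF nm] diag_matrix_nth[OF nm])

lemma Nk_lim: "Nk \<longlonglongrightarrow> N"
proof (intro vec_tendstoI)
  fix p j
  show "(\<lambda>k. Nk k $ p $ j) \<longlonglongrightarrow> N $ p $ j"
  proof (cases "p \<in> row_of ` I \<or> j \<in> I")
    case True
    then show ?thesis using N(1) by (auto simp: Nk_def off_block_def[OF nm])
  next
    case False
    have "(\<lambda>k. - (1 / lam) * Gr k $ p $ j) \<longlonglongrightarrow> - (1 / lam) * (- (lam *\<^sub>R (unit_block I + N))) $ p $ j"
      by (intro tendsto_intros Gr_lim)
    also have "- (1 / lam) * (- (lam *\<^sub>R (unit_block I + N))) $ p $ j = N $ p $ j"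
      using False lam by (simp add: unit_block_nth)
    finally show ?thesis using False by (simp add: Nk_def)
  qed
qed

lemma Nk_off: "off_block I (Nk k)"
  by (simp add: off_block_def[OF nm] Nk_def)

text \<open>The strict inequality \<theta> < 1 leaves room for the distance of \<open>Nk k\<close>
  from its limit. Eventually \<open>\<Gamma> k\<close> is therefore an admissible dual
  matrix.\<close>

lemma Nk_contraction: "\<forall>\<^sub>F k in sequentially. op_bound 1 (unit_block I + Nk k)"
proof -
  have "(\<lambda>k. \<theta> + norm (Nk k - N)) \<longlonglongrightarrow> \<theta> + norm (N - N)"
    by (intro tendsto_intros Nk_lim)
  then have "\<forall>\<^sub>F k in sequentially. \<theta> + norm (Nk k - N) < 1"
    using N(3) by (intro order_tendstoD) auto
  then show ?thesis
  proof eventually_elim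
    case (elim k)
    have "op_bound (\<theta> + norm (Nk k - N)) (N + (Nk k - N))"
      by (intro op_bound_add N op_bound_norm)
    then show ?case
      using elim by (intro unit_block_contraction[OF nm Nk_off]) (auto intro: op_bound_mono)
  qed
qed

lemma g_nth: "g k $ i = Gr k $ row_of i $ i"
  by (simp add: g_def grad_sigma_def diag_of_nth[OF nm] Gr_def G_def X_def)

text \<open>In its own bases \<open>X k\<close> is diagonal, so each entry of a rotated skew
  gradient involves at most two entries of \<open>Gr k\<close>.\<close>

lemma gE_rot: "U k ** gE k ** transpose (U k)
    = (1/2) *\<^sub>R (diag_matrix (\<sigma> k) ** transpose (Gr k) - Gr k ** transpose (diag_matrix (\<sigma> k)))"
  using orth by (simp add: gE_def grad_E_def Let_def Gr_def G_def X_def assemble_def matrix_distribs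
      matrix_transpose_mul matrix_mul_assoc orthogonal_matrixD)

lemma gF_rot: "V k ** gF k ** transpose (V k)
    = (1/2) *\<^sub>R (transpose (diag_matrix (\<sigma> k)) ** Gr k - transpose (Gr k) ** diag_matrix (\<sigma> k))"
  using orth by (simp add: gF_def grad_F_def Let_def Gr_def G_def X_def assemble_def matrix_distribs
      matrix_transpose_mul matrix_mul_assoc orthogonal_matrixD)

lemma gE_entry: "(U k ** gE k ** transpose (U k)) $ row_of i $ row_of j
    = (\<sigma> k $ i * Gr k $ row_of j $ i - Gr k $ row_of i $ j * \<sigma> k $ j) / 2"
  unfolding gE_rot by (simp add: diag_mult_nth[OF nm] row_of_inject[OF nm]) (simp add: transpose_def)

lemma gE_entry_off: "p \<notin> range (row_of :: 'n \<Rightarrow> 'm) \<Longrightarrow>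
    (U k ** gE k ** transpose (U k)) $ row_of i $ p = \<sigma> k $ i * Gr k $ p $ i / 2"
proof -
  assume p: "p \<notin> range (row_of :: 'n \<Rightarrow> 'm)"
  have "(Gr k ** transpose (diag_matrix (\<sigma> k))) $ row_of i $ p = 0"
    unfolding diag_mult_nth[OF nm] using p by (auto intro!: sum.neutral)
  then show ?thesis
    unfolding gE_rot by (simp add: diag_mult_nth(1)[OF nm]) (simp add: transpose_def)
qed

lemma gF_entry: "(V k ** gF k ** transpose (V k)) $ i $ j
    = (\<sigma> k $ i * Gr k $ row_of i $ j - Gr k $ row_of j $ i * \<sigma> k $ j) / 2"
  unfolding gF_rot by (simp add: diag_mult_nth[OF nm]) (simp add: transpose_def)

lemma \<beta>_bounds: "norm (gE k) \<le> \<beta> k" "norm (gF k) \<le> \<beta> k" "0 \<le> \<beta> k"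
  by (simp_all add: \<beta>_def norm_Pair real_sqrt_le_iff sqrt_sum_squares_le_sum add_increasing add_increasing2 real_le_rsqrt)

definition res where "res k = norm (a k) + \<beta> k"

lemma res_bounds: "norm (a k) \<le> res k" "\<beta> k \<le> res k" "0 \<le> res k"
  by (simp_all add: res_def \<beta>_bounds)

lemma gE_bigo: "(\<lambda>k. (U k ** gE k ** transpose (U k)) $ p $ q) \<in> O(res)"
proof (rule bigoI[of _ 1], intro always_eventually allI)
  fix k
  have "\<bar>(U k ** gE k ** transpose (U k)) $ p $ q\<bar> \<le> norm (U k ** gE k ** transpose (U k))"
    by (rule norm_mat_entry)
  also have "\<dots> = norm (gE k)" by (simp add: orth)
  finally show "norm ((U k ** gE k ** transpose (U k)) $ p $ q) \<le> 1 * norm (res k)"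
    using \<beta>_bounds[of k] res_bounds[of k] by simp
qed

lemma gF_bigo: "(\<lambda>k. (V k ** gF k ** transpose (V k)) $ p $ q) \<in> O(res)"
proof (rule bigoI[of _ 1], intro always_eventually allI)
  fix k
  have "\<bar>(V k ** gF k ** transpose (V k)) $ p $ q\<bar> \<le> norm (V k ** gF k ** transpose (V k))"
    by (rule norm_mat_entry)
  also have "\<dots> = norm (gF k)" by (simp add: orth)
  finally show "norm ((V k ** gF k ** transpose (V k)) $ p $ q) \<le> 1 * norm (res k)"
    using \<beta>_bounds[of k] res_bounds[of k] by simp
qed

text \<open>
  Distinctness of the positive entries of the limit enters here: the off-diagonal entries of the
  rotated gradient are recovered from those of the two skew-symmetric gradients by solving a linear
  system of two equations with determinant \<open>\<sigma>\<^sub>j\<^sup>2 - \<sigma>\<^sub>i\<^sup>2\<close>.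
\<close>

lemma square_gap: "i \<in> I \<Longrightarrow> j \<noteq> i \<Longrightarrow> \<sigma>b $ i * \<sigma>b $ i - \<sigma>b $ j * \<sigma>b $ j \<noteq> 0"
proof -
  assume i: "i \<in> I" and ji: "j \<noteq> i"
  have "\<sigma>b $ i \<noteq> \<sigma>b $ j"
    using i ji \<sigma>b(1)[OF i] \<sigma>b(2)[of j] \<sigma>b(3) by (cases "j \<in> I") (auto dest: inj_onD)
  moreover have "0 < \<sigma>b $ i" "0 \<le> \<sigma>b $ j" using \<sigma>b(1)[OF i] \<sigma>b(1,2)[of j] by force+
  ultimately show ?thesis by (auto simp: square_eq_iff)
qed

text \<open>The index \<open>j\<close> may lie outside \<open>I\<close>: its limiting entry is then
  0, and the determinant stays away from zero because that of \<open>i\<close> is positive.\<close>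

lemma Gr_off_diagonal:
  assumes i: "i \<in> I" "j \<noteq> i"
  shows "(\<lambda>k. Gr k $ row_of i $ j) \<in> O(res)" "(\<lambda>k. Gr k $ row_of j $ i) \<in> O(res)"
proof -
  have lim: "(\<lambda>k. \<sigma> k $ i * \<sigma> k $ i - \<sigma> k $ j * \<sigma> k $ j) \<longlonglongrightarrow> \<sigma>b $ i * \<sigma>b $ i - \<sigma>b $ j * \<sigma>b $ j"
    by (intro tendsto_intros lims)
  show "(\<lambda>k. Gr k $ row_of i $ j) \<in> O(res)"
  proof (rule bigo_solve_quotient[OF _ lim square_gap[OF i] _ _ gF_bigo gE_bigo])
    show "(\<sigma> k $ i * \<sigma> k $ i - \<sigma> k $ j * \<sigma> k $ j) * Gr k $ row_of i $ j
      = (2 * \<sigma> k $ i) * (V k ** gF k ** transpose (V k)) $ i $ j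
        + (2 * \<sigma> k $ j) * (U k ** gE k ** transpose (U k)) $ row_of i $ row_of j" for k
      unfolding gE_entry gF_entry by (simp add: field_simps)
  qed (rule tendsto_intros \<sigma>_lim)+
  show "(\<lambda>k. Gr k $ row_of j $ i) \<in> O(res)"
  proof (rule bigo_solve_quotient[OF _ lim square_gap[OF i] _ _ gE_bigo gF_bigo])
    show "(\<sigma> k $ i * \<sigma> k $ i - \<sigma> k $ j * \<sigma> k $ j) * Gr k $ row_of j $ i
      = (2 * \<sigma> k $ i) * (U k ** gE k ** transpose (U k)) $ row_of i $ row_of j
        + (2 * \<sigma> k $ j) * (V k ** gF k ** transpose (V k)) $ i $ j" for k
      unfolding gE_entry gF_entry by (simp add: field_simps)
  qed (rule tendsto_intros \<sigma>_lim)+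
qed

text \<open>A row without diagonal place has no mirrored entry, so the gradient in \<open>E\<close>
  alone determines it, with the positive limit of \<open>\<sigma> k $ i\<close> as divisor.\<close>

lemma Gr_off_range:
  assumes i: "i \<in> I" and p: "p \<notin> range (row_of :: 'n \<Rightarrow> 'm)"
  shows "(\<lambda>k. Gr k $ p $ i) \<in> O(res)"
proof (rule bigo_solve_quotient[OF _ \<sigma>_lim _ _ _ gE_bigo gE_bigo])
  show "\<sigma> k $ i * Gr k $ p $ i = 2 * (U k ** gE k ** transpose (U k)) $ row_of i $ p
      + 0 * (U k ** gE k ** transpose (U k)) $ row_of i $ p" for k
    unfolding gE_entry_off[OF p] by simp
  show "\<sigma>b $ i \<noteq> 0" using \<sigma>b(1)[OF i] by simp
qed (rule tendsto_intros)+

text \<open>Diagonal entries on the support are those of \<open>a\<close>, the other entries in rows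
  or columns of the support come from the skew gradients, and the rest vanish by the choice of
  \<open>Nk\<close>.\<close>

lemma Sr_bigo: "(\<lambda>k. norm (Sr k)) \<in> O(res)"
proof -
  have entry: "(\<lambda>k. Sr k $ p $ j) \<in> O(res)" for p j
  proof (cases "j \<in> I")
    case jI: True
    show ?thesis
    proof (cases "p \<in> range (row_of :: 'n \<Rightarrow> 'm)")
      case True
      then obtain i :: 'n where p: "p = row_of i" by auto
      show ?thesis
      proof (cases "i = j")
        case True
        have "Sr k $ p $ j = a k $ j" for k
          using jI by (simp add: Sr_def p True unit_block_nth Nk_def a_def g_nth)
        moreover have "\<bar>a k $ j\<bar> \<le> \<bar>res k\<bar>" for k
          using component_le_norm_cart[of "a k" j] res_bounds[of k] by simp
        ultimately show ?thesis by (intro bigoI[of _ 1] always_eventually) simp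
      next
        case False
        then have "Sr k $ p $ j = Gr k $ row_of i $ j" for k
          using jI by (simp add: Sr_def p unit_block_nth Nk_def row_of_inject[OF nm])
        then show ?thesis using Gr_off_diagonal(2)[OF jI False] by simp
      qed
    next
      case False
      then have "Sr k $ p $ j = Gr k $ p $ j" for k
        using jI by (auto simp: Sr_def unit_block_nth Nk_def)
      then show ?thesis using Gr_off_range[OF jI False] by simp
    qed
  next
    case jI: False
    show ?thesis
    proof (cases "p \<in> row_of ` I")
      case True
      then obtain i where p: "p = row_of i" and i: "i \<in> I" by auto
      then have "Sr k $ p $ j = Gr k $ row_of i $ j" for k
        using jI by (simp add: Sr_def unit_block_nth Nk_def)
      then show ?thesis using Gr_off_diagonal(1)[OF i, of j] i jI by auto
    next
      case False
      then have "Sr k $ p $ j = 0" for k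
        using jI lam by (simp add: Sr_def unit_block_nth Nk_def)
      then show ?thesis by simp
    qed
  qed
  have "(\<lambda>k. \<Sum>p\<in>UNIV. \<Sum>j\<in>UNIV. \<bar>Sr k $ p $ j\<bar>) \<in> O(res)"
    using entry by (intro big_sum_in_bigo) simp
  moreover have "(\<lambda>k. norm (Sr k)) \<in> O(\<lambda>k. \<Sum>p\<in>UNIV. \<Sum>j\<in>UNIV. \<bar>Sr k $ p $ j\<bar>)"
    by (intro bigoI[of _ 1] always_eventually allI)
      (use norm_mat_le_sum in \<open>simp add: sum_nonneg\<close>)
  ultimately show ?thesis using landau_o.big.trans by blast
qed

section \<open>Solutions near the limit\<close>

definition \<Gamma>b where "\<Gamma>b = transpose Ub ** (unit_block I + N) ** Vb"
definition \<Gamma> where "\<Gamma> k = transpose (U k) ** (unit_block I + Nk k) ** V k"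

lemma op_\<Gamma>b: "op_bound 1 \<Gamma>b"
  unfolding \<Gamma>b_def using orth_limit N
  by (intro op_bound_conjugate unit_block_contraction[OF nm]) (auto intro: op_bound_mono)

lemma op_\<Gamma>: "op_bound 1 (unit_block I + Nk k) \<Longrightarrow> op_bound 1 (\<Gamma> k)"
  unfolding \<Gamma>_def using orth by (intro op_bound_conjugate) auto

lemma Gb_eq: "Gb = - (lam *\<^sub>R \<Gamma>b)"
proof -
  have "transpose Ub ** (Ub ** Gb ** transpose Vb) ** Vb = Gb"
    using orth_limit by (simp add: orthogonal_matrixD flip: matrix_mul_assoc)
  then show ?thesis
    using grad_limit by (simp add: Gb_def Xb_def \<Gamma>b_def matrix_distribs)
qed

lemma G_eq: "G k = transpose (U k) ** Sr k ** V k - lam *\<^sub>R \<Gamma> k"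
proof -
  have "transpose (U k) ** Gr k ** V k = G k"
    using orth by (simp add: Gr_def orthogonal_matrixD flip: matrix_mul_assoc)
  then show ?thesis by (simp add: Sr_def \<Gamma>_def matrix_distribs)
qed

definition T where "T Y = Y - \<Gamma>b ** transpose Y ** \<Gamma>b"

lemma linear_T: "linear T"
  by (rule linearI) (simp_all add: T_def transpose_add transpose_scalar matrix_distribs algebra_simps)

lemma T_Xb: "T Xb = 0"
proof -
  have "diag_matrix \<sigma>b = (unit_block I + N) ** transpose (diag_matrix \<sigma>b) ** (unit_block I + N)"
    by (rule diag_fixed[OF nm N(1) \<sigma>b(2)])
  then show ?thesis
    by (simp add: T_def Xb_def assemble_def \<Gamma>b_def conjugate_fixed orth_limit)
qed

lemma block_sum:
  assumes "\<And>p j. p \<notin> row_of ` I \<Longrightarrow> (M :: ('m,'n) mat) $ p $ j = 0" "\<And>p j. j \<notin> I \<Longrightarrow> M $ p $ j = 0"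
  shows "Z \<bullet> M = (\<Sum>i\<in>I. \<Sum>j\<in>I. Z $ row_of i $ j * M $ row_of i $ j)"
proof -
  have "Z \<bullet> M = (\<Sum>p\<in>row_of ` I. \<Sum>j\<in>UNIV. Z $ p $ j * M $ p $ j)"
    unfolding inner_mat by (rule sum.mono_neutral_right) (auto simp: assms intro!: sum.neutral)
  also have "\<dots> = (\<Sum>p\<in>row_of ` I. \<Sum>j\<in>I. Z $ p $ j * M $ p $ j)"
    by (intro sum.cong refl sum.mono_neutral_right) (auto simp: assms)
  also have "\<dots> = (\<Sum>i\<in>I. \<Sum>j\<in>I. Z $ row_of i $ j * M $ row_of i $ j)"
    by (subst sum.reindex) (auto simp: inj_on_def row_of_inject[OF nm])
  finally show ?thesis .
qed

text \<open>In the limiting bases \<open>Xb + Y\<close> is a symmetric block, and for small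
  \<open>Y\<close> it inherits diagonal dominance from the positive entries of the limit. Its
  Schatten norm is then at most its trace, which is the pairing with \<open>\<Gamma>b\<close> and
  has the same value at \<open>Xb\<close>.\<close>

lemma nearby_solutions:
  obtains \<epsilon> where "0 < \<epsilon>"
    and "\<And>Y. \<A> Y = 0 \<Longrightarrow> T Y = 0 \<Longrightarrow> norm Y \<le> \<epsilon> \<Longrightarrow> obj (Xb + Y) \<le> obj Xb"
proof -
  \<comment> \<open>A row of the block has fewer than \<open>CARD('n)\<close> off-diagonal entries.
    Together with the change of the diagonal entry they cost at most \<open>CARD('n)\<close> times
    \<epsilon>, which the smallest positive entry covers.\<close>
  define \<epsilon> where "\<epsilon> = (if I = {} then 1 else Min ((($) \<sigma>b) ` I) / real (CARD('n)))"
  have pos: "0 < \<epsilon>"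
    using \<sigma>b(1) by (auto simp: \<epsilon>_def intro!: divide_pos_pos)
  have small: "real CARD('n) * \<epsilon> \<le> \<sigma>b $ i" if "i \<in> I" for i
    using that by (auto simp: \<epsilon>_def)
  have "obj (Xb + Y) \<le> obj Xb"
    if Y: "\<A> Y = 0" "T Y = 0" "norm Y \<le> \<epsilon>" for Y
  proof -
    define Yr where "Yr = Ub ** Y ** transpose Vb"
    have Y_eq: "Y = transpose Ub ** Yr ** Vb"
      unfolding Yr_def using orth_limit by (simp add: orthogonal_matrixD flip: matrix_mul_assoc)
    have "Y = \<Gamma>b ** transpose Y ** \<Gamma>b" using Y(2) by (simp add: T_def)
    also have "\<dots> = transpose Ub ** ((unit_block I + N) ** transpose Yr ** (unit_block I + N)) ** Vb"
      unfolding \<Gamma>b_def Y_eq by (simp only: conjugate_fixed orth_limit)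
    finally have "Ub ** Y ** transpose Vb = (unit_block I + N) ** transpose Yr ** (unit_block I + N)"
      using orth_limit by (simp add: orthogonal_matrixD matrix_mul_assoc)
    then have fixed: "Yr = (unit_block I + N) ** transpose Yr ** (unit_block I + N)" by (simp add: Yr_def)
    note block = fixed_point_block[OF nm N fixed]
    define S where "S = diag_matrix \<sigma>b + Yr"
    have S_rot: "S = Ub ** (Xb + Y) ** transpose Vb"
      by (simp add: S_def Yr_def Xb_def matrix_distribs assemble_rotate orth_limit)
    have S0: "p \<notin> row_of ` I \<Longrightarrow> S $ p $ j = 0" "j \<notin> I \<Longrightarrow> S $ p $ j = 0" for p j
      using block(1,2)[of _ _] \<sigma>b(2)[of j] by (auto simp: S_def diag_matrix_nth[OF nm])
    have S_nth: "S $ row_of i $ j = (if i = j then \<sigma>b $ i else 0) + Yr $ row_of i $ j" for i j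
      by (auto simp: S_def diag_matrix_nth[OF nm] row_of_inject[OF nm])
    have "norm Yr = norm Y" by (simp add: Yr_def orth_limit)
    then have Yr_le: "\<bar>Yr $ p $ j\<bar> \<le> \<epsilon>" for p j
      using norm_mat_entry[of Yr p j] Y(3) by linarith
    obtain Z :: "('m,'n) mat" where Z: "op_bound 1 Z" "Z \<bullet> (Xb + Y) = schatten1_norm (Xb + Y)"
      using schatten1_attained[OF nm] by blast
    define Zr where "Zr = Ub ** Z ** transpose Vb"
    have Zr: "op_bound 1 Zr"
      unfolding Zr_def using orth_limit Z(1) by (intro op_bound_conjugate) auto
    have "schatten1_norm (Xb + Y) = Zr \<bullet> S"
      unfolding Zr_def S_rot inner_rotate[OF orth_limit] Z(2) ..
    also have "\<dots> = (\<Sum>i\<in>I. \<Sum>j\<in>I. Zr $ row_of i $ j * S $ row_of i $ j)"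
      by (rule block_sum[OF S0])
    also have "\<dots> \<le> (\<Sum>i\<in>I. S $ row_of i $ i)"
    proof (rule diagonally_dominant_trace)
      show "S $ row_of i $ j = S $ row_of j $ i" if "i \<in> I" "j \<in> I" for i j
        using block(3)[OF that] by (simp add: S_nth)
      show "(\<Sum>j\<in>I - {i}. \<bar>S $ row_of i $ j\<bar>) \<le> S $ row_of i $ i" if "i \<in> I" for i
      proof -
        have "(\<Sum>j\<in>I - {i}. \<bar>S $ row_of i $ j\<bar>) \<le> (\<Sum>j\<in>I - {i}. \<epsilon>)"
          by (intro sum_mono) (auto simp: S_nth Yr_le)
        also have "\<dots> \<le> (real CARD('n) - 1) * \<epsilon>"
        proof -
          have "card (I - {i}) < CARD('n)" by (intro psubset_card_mono) auto
          then show ?thesis using pos by (simp add: mult_right_mono)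
        qed
        also have "\<dots> \<le> \<sigma>b $ i - \<epsilon>" using small[OF that] by (simp add: left_diff_distrib)
        also have "\<dots> \<le> S $ row_of i $ i" using Yr_le[of "row_of i" i] by (simp add: S_nth)
        finally show ?thesis .
      qed
      show "Zr $ row_of i $ i \<le> 1" for i using op_bound_entry[OF Zr] abs_le_D1 by blast
      show "\<bar>Zr $ row_of i $ j + Zr $ row_of j $ i\<bar> \<le> 2 - Zr $ row_of i $ i - Zr $ row_of j $ j" if "i \<noteq> j" for i j
        using contraction_symmetric_entries[OF Zr, of "row_of i" "row_of j" i j] that by (simp add: row_of_inject[OF nm])
    qed simp
    also have "\<dots> = (\<Sum>i\<in>I. \<Sum>j\<in>I. (unit_block I + N) $ row_of i $ j * S $ row_of i $ j)"
    proof (intro sum.cong refl)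
      fix i assume "i \<in> I"
      then have "(\<Sum>j\<in>I. (unit_block I + N) $ row_of i $ j * S $ row_of i $ j) = (\<Sum>j\<in>I. if j = i then S $ row_of i $ i else 0)"
        using N(1) by (intro sum.cong) (auto simp: unit_block_nth row_of_inject[OF nm] off_block_def[OF nm])
      then show "S $ row_of i $ i = (\<Sum>j\<in>I. (unit_block I + N) $ row_of i $ j * S $ row_of i $ j)"
        using \<open>i \<in> I\<close> by simp
    qed
    also have "\<dots> = (unit_block I + N) \<bullet> S" by (rule block_sum[OF S0, symmetric])
    also have "unit_block I + N = Ub ** \<Gamma>b ** transpose Vb"
      unfolding \<Gamma>b_def using orth_limit by (simp add: orthogonal_matrixD flip: matrix_mul_assoc)
    also have "\<dots> \<bullet> S = \<Gamma>b \<bullet> Xb + \<Gamma>b \<bullet> Y"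
      unfolding S_rot inner_rotate[OF orth_limit] by (rule inner_add_right)
    \<comment> \<open>\<open>\<Gamma>b\<close> is a multiple of the gradient, which lies in the
      range of the adjoint and is thus orthogonal to the kernel of \<open>\<A>\<close>.\<close>
    also have "\<Gamma>b \<bullet> Y = 0"
    proof -
      have "Gb \<bullet> Y = 0" by (simp add: Gb_def inner_grad_fit Y(1))
      then show ?thesis using lam by (simp add: Gb_eq)
    qed
    also have "\<Gamma>b \<bullet> Xb + 0 \<le> schatten1_norm Xb"
      using schatten1_ge[OF nm op_\<Gamma>b] by simp
    finally have "lam * schatten1_norm (Xb + Y) \<le> lam * schatten1_norm Xb"
      using lam by (intro mult_left_mono) auto
    moreover have "fit \<A> b (Xb + Y) = fit \<A> b Xb"
      by (simp add: fit_def linear_add[OF lin] Y(1))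
    ultimately show ?thesis by (simp add: objective_def)
  qed
  with pos that show ?thesis by blast
qed

end

text \<open>Here \<open>e\<close> is the size of the approximate subgradient, \<open>d\<close> the
  distance to a solution and \<open>\<alpha>\<close> the change of the image under
  \<open>\<A>\<close>. The hypotheses bound \<open>d\<close> through \<open>\<alpha>\<close> and
  \<open>\<alpha>\<close> through the product \<open>e * d\<close>.\<close>

lemma error_bound_arith:
  fixes e d \<alpha> \<tau> c l :: real
  assumes nonneg: "0 \<le> e" "0 \<le> d" "0 \<le> \<alpha>" "0 \<le> \<tau>" "\<tau> \<le> 1"
    and d: "d \<le> c * (\<alpha> + e + \<tau>)" and \<alpha>: "\<alpha>\<^sup>2 \<le> 2 * (e * d) + 4 * l * \<tau>"
  shows "e * d + 2 * l * \<tau> \<le> (1/2 + 18 * c ^ 4 + 3 * c\<^sup>2) * e\<^sup>2 + (3 * c\<^sup>2 * (4 * l + 1) + 2 * l) * \<tau>"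
proof -
  have "d\<^sup>2 \<le> (c * (\<alpha> + e + \<tau>))\<^sup>2" using d nonneg by (intro power_mono) auto
  also have "\<dots> = c\<^sup>2 * (\<alpha> + e + \<tau>)\<^sup>2" by (simp add: power_mult_distrib)
  also have "\<dots> \<le> c\<^sup>2 * (3 * (\<alpha>\<^sup>2 + e\<^sup>2 + \<tau>\<^sup>2))"
  proof (intro mult_left_mono zero_le_power2)
    show "(\<alpha> + e + \<tau>)\<^sup>2 \<le> 3 * (\<alpha>\<^sup>2 + e\<^sup>2 + \<tau>\<^sup>2)"
      using sum_squares_bound[of \<alpha> e] sum_squares_bound[of \<alpha> \<tau>] sum_squares_bound[of e \<tau>]
      by (simp add: power2_eq_square algebra_simps)
  qed
  also have "\<dots> \<le> c\<^sup>2 * (3 * (2 * (e * d) + 4 * l * \<tau> + e\<^sup>2 + \<tau>))"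
  proof (intro mult_left_mono zero_le_power2)
    have "\<tau>\<^sup>2 \<le> \<tau>" using nonneg by (simp add: power2_eq_square mult_left_le)
    then show "\<alpha>\<^sup>2 + e\<^sup>2 + \<tau>\<^sup>2 \<le> 2 * (e * d) + 4 * l * \<tau> + e\<^sup>2 + \<tau>"
      using \<alpha> by linarith
  qed simp_all
  finally have 1: "d\<^sup>2 \<le> 2 * (3 * c\<^sup>2 * e) * d + c\<^sup>2 * (3 * (4 * l * \<tau> + e\<^sup>2 + \<tau>))"
    by (simp add: algebra_simps)
  \<comment> \<open>The weight is twice that of the linear term in the preceding bound, so half of
    \<open>d\<^sup>2\<close> is absorbed on the left.\<close>
  have "2 * (6 * c\<^sup>2 * e) * d \<le> (6 * c\<^sup>2 * e)\<^sup>2 + d\<^sup>2" by (rule sum_squares_bound)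
  then have "d\<^sup>2 \<le> 36 * c ^ 4 * e\<^sup>2 + 2 * (c\<^sup>2 * (3 * (4 * l * \<tau> + e\<^sup>2 + \<tau>)))"
    using 1 by (simp add: power_mult_distrib flip: power_mult)
  moreover have "2 * e * d \<le> e\<^sup>2 + d\<^sup>2" by (rule sum_squares_bound)
  ultimately show ?thesis by (simp add: algebra_simps)
qed

section \<open>The gap bounded by the squared residual\<close>

context dpga_limit
begin

text \<open>The part of \<sigma> on \<open>I\<close> solves the fixed-point equation exactly. The
  rest has norm at most \<open>\<tau> k\<close> and enters twice, once through a product with
  contractions.\<close>

lemma fixed_point_defect:
  assumes "op_bound 1 (unit_block I + Nk k)"
  shows "norm (X k - \<Gamma> k ** transpose (X k) ** \<Gamma> k) \<le> 2 * \<tau> k"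
proof -
  let ?M = "unit_block I + Nk k"
  define s1 where "s1 = (\<chi> i. if i \<in> I then \<sigma> k $ i else 0)"
  define s2 where "s2 = (\<chi> i. if i \<in> I then 0 else \<sigma> k $ i)"
  define D2 where "D2 = (diag_matrix s2 :: ('m,'n) mat)"
  have fixed: "diag_matrix s1 = ?M ** transpose (diag_matrix s1) ** ?M"
    by (rule diag_fixed[OF nm Nk_off]) (simp add: s1_def)
  have "diag_matrix (\<sigma> k) = diag_matrix s1 + D2"
    by (auto simp: D2_def diag_matrix_def s1_def s2_def vec_eq_iff)
  then have "diag_matrix (\<sigma> k) - ?M ** transpose (diag_matrix (\<sigma> k)) ** ?M
      = diag_matrix s1 + D2 - (?M ** transpose (diag_matrix s1) ** ?M + ?M ** transpose D2 ** ?M)"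
    by (simp only: transpose_add matrix_add_ldistrib matrix_add_rdistrib' add_ac)
  also have "\<dots> = D2 - ?M ** transpose D2 ** ?M" by (simp only: fixed[symmetric]) simp
  finally have eq: "diag_matrix (\<sigma> k) - ?M ** transpose (diag_matrix (\<sigma> k)) ** ?M = D2 - ?M ** transpose D2 ** ?M" .
  have "X k - \<Gamma> k ** transpose (X k) ** \<Gamma> k
      = transpose (U k) ** (diag_matrix (\<sigma> k) - ?M ** transpose (diag_matrix (\<sigma> k)) ** ?M) ** V k"
    unfolding X_def assemble_def \<Gamma>_def conjugate_fixed[OF orth]
    by (simp only: matrix_diff_ldistrib matrix_diff_rdistrib)
  then have "norm (X k - \<Gamma> k ** transpose (X k) ** \<Gamma> k) = norm (D2 - ?M ** transpose D2 ** ?M)"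
    by (simp add: eq orth)
  also have "\<dots> \<le> norm D2 + norm (?M ** transpose D2 ** ?M)" by (rule norm_triangle_ineq4)
  also have "norm (?M ** transpose D2 ** ?M) \<le> norm D2"
    using norm_matmul_right[OF assms, of "?M ** transpose D2"] norm_matmul_left[OF assms, of "transpose D2"] by simp
  also have "norm D2 \<le> \<tau> k"
  proof -
    have "norm s2 \<le> (\<Sum>i\<in>UNIV. \<bar>s2 $ i\<bar>)" by (rule norm_le_l1_cart)
    also have "\<dots> = \<tau> k" unfolding \<tau>_def by (intro sum.mono_neutral_cong_right) (auto simp: s2_def)
    finally show ?thesis by (simp add: D2_def norm_diag_matrix[OF nm])
  qed
  finally show ?thesis by simp
qed

lemma \<tau>_nonneg: "0 \<le> \<tau> k" by (simp add: \<tau>_def sum_nonneg)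

lemma \<tau>_lim: "\<tau> \<longlonglongrightarrow> 0"
proof -
  have "(\<lambda>k. \<Sum>i\<in>- I. \<bar>\<sigma> k $ i\<bar>) \<longlonglongrightarrow> (\<Sum>i\<in>- I. \<bar>\<sigma>b $ i\<bar>)"
    by (intro tendsto_intros lims)
  then show ?thesis unfolding \<tau>_def[abs_def] by (simp add: \<sigma>b(2))
qed

lemma \<sigma>_pos_eventually: "\<forall>\<^sub>F k in sequentially. \<forall>i\<in>I. \<sigma>b $ i / 2 < \<sigma> k $ i"
proof (rule eventually_ball_finite)
  show "\<forall>i\<in>I. \<forall>\<^sub>F k in sequentially. \<sigma>b $ i / 2 < \<sigma> k $ i"
    using \<sigma>b(1) by (intro ballI order_tendstoD(1)[OF \<sigma>_lim]) simp
qed simp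

text \<open>Pairing with \<open>\<Gamma> k\<close> is exact on the positive entries in
  \<open>I\<close>; each other entry loses at most twice its absolute value.\<close>

lemma schatten_gap:
  assumes op: "op_bound 1 (unit_block I + Nk k)" and pos: "\<And>i. i \<in> I \<Longrightarrow> 0 < \<sigma> k $ i"
  shows "schatten1_norm (X k) \<le> \<Gamma> k \<bullet> X k + 2 * \<tau> k"
proof -
  let ?M = "unit_block I + Nk k"
  have rot: "U k ** \<Gamma> k ** transpose (V k) = ?M"
    unfolding \<Gamma>_def using orth by (simp add: orthogonal_matrixD flip: matrix_mul_assoc)
  have "\<bar>\<sigma> k $ j\<bar> - \<sigma> k $ j * ?M $ row_of j $ j \<le> (if j \<in> I then 0 else 2 * \<bar>\<sigma> k $ j\<bar>)" for j
  proof (cases "j \<in> I")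
    case True
    then show ?thesis using pos[OF True] Nk_off[of k] by (simp add: unit_block_nth Nk_def)
  next
    case False
    have "\<bar>\<sigma> k $ j * ?M $ row_of j $ j\<bar> \<le> \<bar>\<sigma> k $ j\<bar>"
      using op_bound_entry[OF op, of "row_of j" j] by (simp add: abs_mult mult_left_le)
    then show ?thesis using False by simp
  qed
  then have "(\<Sum>j\<in>UNIV. \<bar>\<sigma> k $ j\<bar> - \<sigma> k $ j * ?M $ row_of j $ j) \<le> (\<Sum>j\<in>UNIV. if j \<in> I then 0 else 2 * \<bar>\<sigma> k $ j\<bar>)"
    by (rule sum_mono)
  also have "\<dots> = 2 * \<tau> k" by (simp add: \<tau>_def sum.If_cases sum_distrib_left Compl_eq)
  finally have "l1_norm (\<sigma> k) - (\<Sum>j\<in>UNIV. \<sigma> k $ j * ?M $ row_of j $ j) \<le> 2 * \<tau> k"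
    by (simp add: l1_norm_def sum_subtractf)
  moreover have "\<Gamma> k \<bullet> X k = (\<Sum>j\<in>UNIV. \<sigma> k $ j * ?M $ row_of j $ j)"
    unfolding X_def inner_assemble[OF nm] rot ..
  ultimately show ?thesis by (simp add: X_def schatten1_assemble[OF nm orth])
qed

text \<open>\<open>kernel_distance_bound\<close> is applied to the pair of \<open>\<A>\<close> and
  \<open>T\<close>. The defect of \<open>X k\<close> under \<open>T\<close> comes from replacing
  \<open>\<Gamma> k\<close> by \<open>\<Gamma>b\<close>; their difference is controlled by the
  subgradient and by the change of the gradient, hence by \<open>e\<close> and
  \<open>\<alpha>\<close>.\<close>

theorem error_bound:
  obtains C where "0 < C"
    "\<forall>\<^sub>F k in sequentially. obj (X k) - obj Xb \<le> C * ((res k)\<^sup>2 + \<tau> k)"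
proof -
  define \<Phi> where "\<Phi> Y = (\<A> Y, T Y)" for Y
  have \<Phi>: "linear \<Phi>"
    unfolding \<Phi>_def
    by (rule linearI) (simp_all add: linear_add[OF lin] linear_scale[OF lin] linear_add[OF linear_T] linear_scale[OF linear_T])
  obtain c1 where c1: "0 < c1" "\<And>z. \<exists>y. \<Phi> y = 0 \<and> norm (z - y) \<le> c1 * norm (\<Phi> z)"
    using kernel_distance_bound[OF \<Phi>] by blast
  obtain K where K: "0 \<le> K" "\<And>y. norm (adjoint \<A> y) \<le> norm y * K"
    using bounded_linear.nonneg_bounded[OF bl_adj] by blast
  obtain \<epsilon> where \<epsilon>: "0 < \<epsilon>"
    "\<And>Y. \<A> Y = 0 \<Longrightarrow> T Y = 0 \<Longrightarrow> norm Y \<le> \<epsilon> \<Longrightarrow> obj (Xb + Y) \<le> obj Xb"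
    using nearby_solutions by blast
  define B where "B = norm Xb + 1"
  define c where "c = c1 * (1 + 2 * B / lam * (1 + K) + 2)"
  have B: "0 < B" by (simp add: B_def add_nonneg_pos)
  have ev1: "\<forall>\<^sub>F k in sequentially. norm (X k) < B"
    by (rule order_tendstoD(2)[OF tendsto_norm[OF X_lim]]) (simp add: B_def)
  have ev2: "\<forall>\<^sub>F k in sequentially. norm (X k - Xb) + c1 * norm (\<Phi> (X k - Xb)) < \<epsilon>"
  proof (rule order_tendstoD(2))
    have "(\<lambda>k. \<Phi> (X k - Xb)) \<longlonglongrightarrow> \<Phi> (Xb - Xb)"
      by (intro bounded_linear.tendsto[OF linear_conv_bounded_linear[THEN iffD1, OF \<Phi>]] tendsto_intros X_lim)
    then have "(\<lambda>k. norm (X k - Xb) + c1 * norm (\<Phi> (X k - Xb))) \<longlonglongrightarrow> norm (Xb - Xb) + c1 * norm (\<Phi> (Xb - Xb))"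
      by (intro tendsto_intros X_lim)
    then show "(\<lambda>k. norm (X k - Xb) + c1 * norm (\<Phi> (X k - Xb))) \<longlonglongrightarrow> 0"
      by (simp add: linear_0[OF \<Phi>])
  qed (rule \<epsilon>)
  have ev3: "\<forall>\<^sub>F k in sequentially. \<tau> k < 1" by (rule order_tendstoD(2)[OF \<tau>_lim]) simp
  define C1 where "C1 = (1/2 + 18 * c ^ 4 + 3 * c\<^sup>2)"
  define C2 where "C2 = 3 * c\<^sup>2 * (4 * lam + 1) + 2 * lam"
  obtain C3 where C3: "0 < C3" "\<forall>\<^sub>F k in sequentially. norm (norm (Sr k)) \<le> C3 * norm (res k)"
    using landau_o.bigE[OF Sr_bigo] by blast
  define C where "C = C1 * C3\<^sup>2 + C2"
  have C1: "0 < C1" and C2: "0 < C2"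
    using lam unfolding C1_def C2_def by (intro add_pos_nonneg, simp_all) (intro add_nonneg_pos, simp_all)
  have "0 < C" using C1 C2 C3 by (simp add: C_def add_pos_pos)
  moreover have "\<forall>\<^sub>F k in sequentially. obj (X k) - obj Xb \<le> C * ((res k)\<^sup>2 + \<tau> k)"
    using ev1 ev2 ev3 C3(2) \<sigma>_pos_eventually Nk_contraction
  proof eventually_elim
    case (elim k)
    note op = elim(6)
    have pos: "0 < \<sigma> k $ i" if "i \<in> I" for i using elim(5) \<sigma>b(1)[OF that] that by force
    define e where "e = norm (Sr k)"
    define \<alpha> where "\<alpha> = norm (\<A> (X k - Xb))"
    obtain Y where Y: "\<Phi> Y = 0" "norm (X k - Xb - Y) \<le> c1 * norm (\<Phi> (X k - Xb))" using c1(2) by blast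
    define d where "d = norm (X k - (Xb + Y))"
    have AY: "\<A> Y = 0" "T Y = 0" using Y(1) by (simp_all add: \<Phi>_def zero_prod_def)
    have "norm Y \<le> norm (X k - Xb) + norm (X k - Xb - Y)"
      using norm_triangle_ineq4[of "X k - Xb" "X k - Xb - Y"] by simp
    then have "norm Y \<le> \<epsilon>" using Y(2) elim(2) by linarith
    then have opt: "obj (Xb + Y) \<le> obj Xb" by (intro \<epsilon>(2) AY)
    have Gdiff: "norm (G k - Gb) \<le> K * \<alpha>"
    proof -
      have "G k - Gb = adjoint \<A> (\<A> (X k - Xb))"
        by (simp add: G_def Gb_def grad_fit_def linear_diff[OF lin] flip: linear_diff[OF adjoint_linear[OF lin]])
      then show ?thesis using K(2)[of "\<A> (X k - Xb)"] by (simp add: \<alpha>_def mult.commute)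
    qed
    have \<Gamma>diff: "norm (\<Gamma> k - \<Gamma>b) \<le> (e + K * \<alpha>) / lam"
    proof -
      have "lam *\<^sub>R (\<Gamma> k - \<Gamma>b) = transpose (U k) ** Sr k ** V k - (G k - Gb)"
        by (simp add: G_eq Gb_eq scaleR_diff_right)
      then have "lam * norm (\<Gamma> k - \<Gamma>b) = norm (transpose (U k) ** Sr k ** V k - (G k - Gb))"
        using lam by (metis abs_of_pos norm_scaleR)
      also have "\<dots> \<le> e + K * \<alpha>"
        using norm_triangle_ineq4[of "transpose (U k) ** Sr k ** V k" "G k - Gb"] Gdiff by (simp add: e_def orth)
      finally show ?thesis using lam by (simp add: field_simps)
    qed
    have T: "norm (T (X k - Xb)) \<le> 2 * \<tau> k + 2 * (B * ((e + K * \<alpha>) / lam))"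
    proof -
      \<comment> \<open>\<open>T Xb = 0\<close>; the two occurrences of \<open>\<Gamma>b\<close> are
        exchanged for \<open>\<Gamma> k\<close> one at a time.\<close>
      have "T (X k - Xb) = (X k - \<Gamma> k ** transpose (X k) ** \<Gamma> k)
          + ((\<Gamma> k - \<Gamma>b) ** transpose (X k) ** \<Gamma> k + \<Gamma>b ** transpose (X k) ** (\<Gamma> k - \<Gamma>b))"
        unfolding linear_diff[OF linear_T] T_Xb by (simp add: T_def matrix_distribs)
      also have "norm \<dots> \<le> 2 * \<tau> k + (B * ((e + K * \<alpha>) / lam) + B * ((e + K * \<alpha>) / lam))"
      proof (intro norm_triangle_le add_mono)
        show "norm (X k - \<Gamma> k ** transpose (X k) ** \<Gamma> k) \<le> 2 * \<tau> k" by (rule fixed_point_defect[OF op])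
        have prod: "norm (\<Gamma> k - \<Gamma>b) * norm (X k) \<le> B * ((e + K * \<alpha>) / lam)"
          using mult_mono[OF \<Gamma>diff less_imp_le[OF elim(1)]] K(1) lam
          by (simp add: mult.commute e_def \<alpha>_def)
        have "norm ((\<Gamma> k - \<Gamma>b) ** transpose (X k) ** \<Gamma> k) \<le> norm (\<Gamma> k - \<Gamma>b) * norm (X k)"
          using norm_matmul_right[OF op_\<Gamma>[OF op], of "(\<Gamma> k - \<Gamma>b) ** transpose (X k)"]
            norm_matmul[of "\<Gamma> k - \<Gamma>b" "transpose (X k)"] by simp
        with prod show "norm ((\<Gamma> k - \<Gamma>b) ** transpose (X k) ** \<Gamma> k) \<le> B * ((e + K * \<alpha>) / lam)" by linarith
        have "norm (\<Gamma>b ** (transpose (X k) ** (\<Gamma> k - \<Gamma>b))) \<le> norm (\<Gamma> k - \<Gamma>b) * norm (X k)"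
          using norm_matmul_left[OF op_\<Gamma>b, of "transpose (X k) ** (\<Gamma> k - \<Gamma>b)"]
            norm_matmul[of "transpose (X k)" "\<Gamma> k - \<Gamma>b"] by (simp add: mult.commute)
        with prod show "norm (\<Gamma>b ** transpose (X k) ** (\<Gamma> k - \<Gamma>b)) \<le> B * ((e + K * \<alpha>) / lam)"
          by (simp add: matrix_mul_assoc)
      qed
      finally show ?thesis by simp
    qed
    have nn: "0 \<le> e" "0 \<le> d" "0 \<le> \<alpha>" "0 \<le> \<tau> k" by (simp_all add: e_def d_def \<alpha>_def \<tau>_nonneg)
    have "norm (\<Phi> (X k - Xb)) \<le> \<alpha> + norm (T (X k - Xb))"
      unfolding \<Phi>_def \<alpha>_def by (rule norm_Pair_le)
    also have "\<dots> \<le> (1 + 2 * B / lam * (1 + K) + 2) * (\<alpha> + e + \<tau> k)"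
    proof -
      have "2 * (B * ((e + K * \<alpha>) / lam)) = 2 * B / lam * (e + K * \<alpha>)" by simp
      also have "\<dots> \<le> 2 * B / lam * ((1 + K) * (\<alpha> + e + \<tau> k))"
      proof (rule mult_left_mono)
        have "0 \<le> K * e" "0 \<le> K * \<tau> k" using K(1) nn by simp_all
        then show "e + K * \<alpha> \<le> (1 + K) * (\<alpha> + e + \<tau> k)" using nn by (simp add: algebra_simps)
      qed (use B lam in simp)
      finally have "2 * (B * ((e + K * \<alpha>) / lam)) \<le> 2 * B / lam * (1 + K) * (\<alpha> + e + \<tau> k)" by (simp add: mult.assoc)
      moreover have "\<alpha> + 2 * \<tau> k \<le> 1 * (\<alpha> + e + \<tau> k) + 2 * (\<alpha> + e + \<tau> k)" using nn by simp
      ultimately show ?thesis using T unfolding distrib_right by linarith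
    qed
    finally have "c1 * norm (\<Phi> (X k - Xb)) \<le> c1 * ((1 + 2 * B / lam * (1 + K) + 2) * (\<alpha> + e + \<tau> k))"
      using c1(1) by (intro mult_left_mono) auto
    then have d: "d \<le> c * (\<alpha> + e + \<tau> k)"
      using Y(2) by (simp add: d_def c_def diff_diff_eq mult.assoc)
    have \<alpha>': "\<A> (Xb + Y - X k) = - \<A> (X k - Xb)"
      by (simp add: linear_add[OF lin] linear_diff[OF lin] AY)
    \<comment> \<open>The exact expansion of the loss keeps the curvature term
      \<open>\<alpha>\<^sup>2 / 2\<close>. As the left side is nonnegative, this term is bounded by
      the other two, which is the second hypothesis of \<open>error_bound_arith\<close>.\<close>
    have "obj (X k) - obj (Xb + Y) \<le> e * d + 2 * lam * \<tau> k - \<alpha>\<^sup>2 / 2"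
    proof -
      have f: "fit \<A> b (Xb + Y) = fit \<A> b (X k) + G k \<bullet> (Xb + Y - X k) + \<alpha>\<^sup>2 / 2"
        unfolding fit_expand[of "Xb + Y" "X k"] \<alpha>' by (simp add: G_def \<alpha>_def)
      have s1: "lam * (\<Gamma> k \<bullet> (Xb + Y)) \<le> lam * schatten1_norm (Xb + Y)"
        using lam by (intro mult_left_mono schatten1_ge[OF nm op_\<Gamma>[OF op]]) auto
      have s2: "lam * schatten1_norm (X k) \<le> lam * (\<Gamma> k \<bullet> X k + 2 * \<tau> k)"
        using lam by (intro mult_left_mono schatten_gap[OF op pos]) auto
      have "G k \<bullet> (Xb + Y - X k) + lam * (\<Gamma> k \<bullet> (Xb + Y - X k)) = (transpose (U k) ** Sr k ** V k) \<bullet> (Xb + Y - X k)"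
        by (simp add: G_eq inner_diff_left)
      also have "\<dots> \<ge> - (e * d)"
      proof -
        have "\<bar>(transpose (U k) ** Sr k ** V k) \<bullet> (Xb + Y - X k)\<bar> \<le> e * d"
          using Cauchy_Schwarz_ineq2[of "transpose (U k) ** Sr k ** V k" "Xb + Y - X k"]
          by (simp add: orth e_def d_def norm_minus_commute)
        then show ?thesis by linarith
      qed
      finally have "- (e * d) \<le> G k \<bullet> (Xb + Y - X k) + lam * (\<Gamma> k \<bullet> (Xb + Y - X k))" .
      then show ?thesis
        using f s1 s2 by (simp add: objective_def inner_diff_right distrib_left right_diff_distrib)
    qed
    moreover have "obj (Xb + Y) \<le> obj (X k)" "obj Xb \<le> obj (Xb + Y)"
      using opt minimal unfolding Xb_def by (auto intro: order_trans)
    ultimately have gap: "obj (X k) - obj Xb \<le> e * d + 2 * lam * \<tau> k"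
      and "\<alpha>\<^sup>2 \<le> 2 * (e * d) + 4 * lam * \<tau> k"
      using opt zero_le_power2[of \<alpha>] by linarith+
    then have "e * d + 2 * lam * \<tau> k \<le> C1 * e\<^sup>2 + C2 * \<tau> k"
      unfolding C1_def C2_def using nn d elim(3) by (intro error_bound_arith) auto
    also have "\<dots> \<le> C1 * (C3 * res k)\<^sup>2 + C2 * \<tau> k"
      using elim(4) res_bounds[of k] C1 nn
      by (intro add_right_mono mult_left_mono power_mono) (auto simp: e_def)
    also have "\<dots> \<le> C * ((res k)\<^sup>2 + \<tau> k)"
    proof -
      have "0 \<le> C1 * C3\<^sup>2 * \<tau> k" "0 \<le> C2 * (res k)\<^sup>2" using C1 C2 nn by simp_all
      then show ?thesis by (simp add: C_def power_mult_distrib algebra_simps)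
    qed
    finally show ?case using gap by linarith
  qed
  ultimately show thesis by (rule that)
qed

end

section \<open>The proximal step\<close>

definition soft :: "real \<Rightarrow> real \<Rightarrow> real"
  where "soft c u = (if c < u then u - c else if u < - c then u + c else 0)"

text \<open>The last square on the left is the strong convexity margin of the proximal objective. It
  yields uniqueness of the minimizer and the full constant in \<open>soft_gain\<close>.\<close>

lemma soft_minimizes:
  assumes "0 < t" "0 \<le> l"
  shows "(soft (t * l) u - u)\<^sup>2 / (2 * t) + l * \<bar>soft (t * l) u\<bar> + (y - soft (t * l) u)\<^sup>2 / (2 * t)
    \<le> (y - u)\<^sup>2 / (2 * t) + l * \<bar>y\<bar>"
proof -
  define p where "p = soft (t * l) u"
  have tl: "0 \<le> t * l" using assms by simp
  have "0 \<le> (y - p) * (p - u) + t * l * (\<bar>y\<bar> - \<bar>p\<bar>)"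
  proof -
    consider "t * l < u" | "u < - (t * l)" "\<not> t * l < u" | "\<bar>u\<bar> \<le> t * l" by linarith
    then show ?thesis
    proof cases
      case 1
      then have "(y - p) * (p - u) + t * l * (\<bar>y\<bar> - \<bar>p\<bar>) = t * l * (\<bar>y\<bar> - y)"
        by (simp add: p_def soft_def algebra_simps)
      then show ?thesis using tl by simp
    next
      case 2
      then have "(y - p) * (p - u) + t * l * (\<bar>y\<bar> - \<bar>p\<bar>) = t * l * (\<bar>y\<bar> + y)"
        by (simp add: p_def soft_def algebra_simps)
      also have "\<dots> \<ge> 0" by (rule mult_nonneg_nonneg[OF tl]) simp
      finally show ?thesis .
    next
      case 3
      then have "p = 0" by (auto simp: p_def soft_def)
      moreover have "y * u \<le> \<bar>y\<bar> * (t * l)"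
        using mult_left_mono[OF 3, of "\<bar>y\<bar>"] abs_ge_self[of "y * u"] by (simp add: abs_mult)
      ultimately show ?thesis by (simp add: mult.commute)
    qed
  qed
  then have "0 \<le> (2 * ((y - p) * (p - u)) + 2 * t * (l * (\<bar>y\<bar> - \<bar>p\<bar>))) / (2 * t)"
    using assms by (intro divide_nonneg_pos) (auto simp: mult.assoc)
  also have "\<dots> = ((y - u)\<^sup>2 - (p - u)\<^sup>2 - (y - p)\<^sup>2) / (2 * t) + l * (\<bar>y\<bar> - \<bar>p\<bar>)"
    using assms by (simp add: field_simps power2_eq_square)
  finally show ?thesis
    unfolding p_def[symmetric] by (simp add: diff_divide_distrib right_diff_distrib)
qed

text \<open>Comparing the minimizer with \<open>s\<close> gives half of the left side, the strong
  convexity margin the other half. The resulting factor \<open>1 / t\<close> instead of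
  \<open>1 / (2 * t)\<close> is what the explicit stepsizes rely on.\<close>

lemma soft_gain:
  fixes s g :: real
  assumes "0 < t" "0 \<le> l"
  defines "p \<equiv> soft (t * l) (s - t * g)"
  shows "(p - s)\<^sup>2 / t \<le> l * \<bar>s\<bar> - l * \<bar>p\<bar> - g * (p - s)"
proof -
  have "(p - (s - t * g))\<^sup>2 / (2 * t) = (p - s)\<^sup>2 / (2 * t) + g * (p - s) + (t * g)\<^sup>2 / (2 * t)"
    using assms(1) by (simp add: power2_eq_square field_simps)
  moreover have "(s - p)\<^sup>2 = (p - s)\<^sup>2" by (rule power2_commute)
  moreover have "(p - s)\<^sup>2 / t = (p - s)\<^sup>2 / (2 * t) + (p - s)\<^sup>2 / (2 * t)" by simp
  moreover have "(s - (s - t * g))\<^sup>2 = (t * g)\<^sup>2" by simp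
  ultimately show ?thesis
    using soft_minimizes[OF assms(1,2), of "s - t * g" s, folded p_def] by simp
qed

lemma prox_l1:
  fixes s g :: "real^'n"
  assumes t: "0 < t" and l: "0 \<le> l"
  shows "is_arg_min (\<lambda>x. (norm (x - s + t *\<^sub>R g))\<^sup>2 / (2 * t) + l * l1_norm x) (\<lambda>x. True) x
    \<longleftrightarrow> x = (\<chi> i. soft (t * l) (s $ i - t * g $ i))"
proof -
  define \<psi> where "\<psi> = (\<lambda>x. (norm (x - s + t *\<^sub>R g))\<^sup>2 / (2 * t) + l * l1_norm x)"
  define p where "p = (\<chi> i. soft (t * l) (s $ i - t * g $ i))"
  have \<psi>: "\<psi> x = (\<Sum>i\<in>UNIV. (x $ i - (s $ i - t * g $ i))\<^sup>2 / (2 * t) + l * \<bar>x $ i\<bar>)" for x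
    unfolding \<psi>_def norm_sq_cart l1_norm_def
    by (simp add: sum.distrib sum_distrib_left sum_divide_distrib algebra_simps)
  have strict: "\<psi> p + (norm (y - p))\<^sup>2 / (2 * t) \<le> \<psi> y" for y
    unfolding \<psi> norm_sq_cart sum_divide_distrib sum.distrib[symmetric]
    using soft_minimizes[OF t l] by (intro sum_mono) (simp add: p_def)
  have le: "\<psi> p \<le> \<psi> y" for y using strict[of y] t by (smt (verit) divide_nonneg_pos zero_le_power2)
  have "is_arg_min \<psi> (\<lambda>x. True) x \<longleftrightarrow> x = p"
  proof
    assume "is_arg_min \<psi> (\<lambda>x. True) x"
    then have "\<psi> x \<le> \<psi> p" by (auto simp: is_arg_min_def not_less)
    then have "(norm (x - p))\<^sup>2 / (2 * t) \<le> 0" using strict[of x] by linarith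
    then show "x = p" using t by (simp add: divide_le_0_iff)
  next
    show "x = p \<Longrightarrow> is_arg_min \<psi> (\<lambda>x. True) x"
      using le by (auto simp: is_arg_min_def not_less)
  qed
  then show ?thesis by (simp add: \<psi>_def p_def)
qed

lemma soft_moves_towards_zero:
  assumes "0 \<le> t" "\<bar>g\<bar> \<le> l"
  shows "\<bar>soft (t * l) (s - t * g) - s\<bar> \<le> \<bar>s\<bar>"
proof -
  have "t * \<bar>g\<bar> \<le> t * l" using assms by (intro mult_left_mono) auto
  then have "\<bar>t * g\<bar> \<le> t * l" using assms(1) by (simp add: abs_mult)
  then show ?thesis by (auto simp: soft_def)
qed

text \<open>A slack \<kappa> in the bound on the gradient widens the set of points that are
  thresholded to zero by \<open>t * \<kappa>\<close>.\<close>

lemma soft_eq_zero: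
  assumes "0 \<le> t" "\<bar>g\<bar> \<le> l - \<kappa>" "\<bar>s\<bar> \<le> t * \<kappa>"
  shows "soft (t * l) (s - t * g) = 0"
proof -
  have "t * \<bar>g\<bar> \<le> t * (l - \<kappa>)" using assms by (intro mult_left_mono) auto
  then have "\<bar>t * g\<bar> \<le> t * l - t * \<kappa>" using assms(1) by (simp add: abs_mult right_diff_distrib)
  then show ?thesis using assms(3) by (auto simp: soft_def)
qed

context dpga_limit
begin

section \<open>Steps near the limit\<close>

lemma norm_a_lim: "(\<lambda>k. \<Sum>i\<in>UNIV. \<bar>a k $ i\<bar>) \<longlonglongrightarrow> 0"
proof -
  have "(\<lambda>k. a k $ i) \<longlonglongrightarrow> 0" for i
  proof (cases "i \<in> I")
    case True
    have "(\<lambda>k. Gr k $ row_of i $ i + lam) \<longlonglongrightarrow> (- (lam *\<^sub>R (unit_block I + N))) $ row_of i $ i + lam"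
      by (intro tendsto_intros Gr_lim)
    also have "(- (lam *\<^sub>R (unit_block I + N))) $ row_of i $ i + lam = 0"
      using True N(1) by (simp add: unit_block_nth off_block_def[OF nm])
    finally show ?thesis using True by (simp add: a_def g_nth)
  qed (simp add: a_def)
  then have "(\<lambda>k. \<Sum>i\<in>UNIV. \<bar>a k $ i\<bar>) \<longlonglongrightarrow> (\<Sum>i\<in>(UNIV :: 'n set). \<bar>0\<bar>)"
    by (intro tendsto_intros) auto
  then show ?thesis by simp
qed

text \<open>At the limit the rotated gradient is a multiple of \<open>unit_block I + N\<close>.
  Products of the limiting diagonal with \<open>N\<close> vanish and those with the identity block
  are symmetric, so both skew parts are zero.\<close>

lemma \<beta>_lim: "\<beta> \<longlonglongrightarrow> 0"
proof -
  let ?D = "diag_matrix \<sigma>b :: ('m,'n) mat" and ?u = "unit_block I :: ('m,'n) mat"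
  have 0: "N ** transpose ?D = 0" "transpose ?D ** N = 0"
    using diag_off_block[OF nm N(1) \<sigma>b(2)] by simp_all
  have zt: "?D ** transpose N = 0" "transpose N ** ?D = 0"
    using arg_cong[OF 0(1), of transpose] arg_cong[OF 0(2), of transpose] by (simp_all add: matrix_transpose_mul)
  have u: "?D ** transpose ?u = ?u ** transpose ?D" "transpose ?D ** ?u = transpose ?u ** ?D"
    by (auto simp: vec_eq_iff matrix_matrix_mult_def transpose_def unit_block_nth diag_matrix_nth[OF nm] row_of_inject[OF nm] intro!: sum.cong)
  have "(\<lambda>k. U k ** gE k ** transpose (U k))
      \<longlonglongrightarrow> (1/2) *\<^sub>R (?D ** transpose (- (lam *\<^sub>R (?u + N))) - (- (lam *\<^sub>R (?u + N))) ** transpose ?D)"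
    unfolding gE_rot by (intro tendsto_intros diag_lim lims Gr_lim)
  also have "(1/2) *\<^sub>R (?D ** transpose (- (lam *\<^sub>R (?u + N))) - (- (lam *\<^sub>R (?u + N))) ** transpose ?D) = 0"
    by (simp add: transpose_minus transpose_scalar transpose_add matrix_distribs 0 zt u)
  finally have "(\<lambda>k. norm (U k ** gE k ** transpose (U k))) \<longlonglongrightarrow> 0"
    by (rule tendsto_norm_zero)
  then have E: "(\<lambda>k. norm (gE k)) \<longlonglongrightarrow> 0" by (simp add: orth)
  have "(\<lambda>k. V k ** gF k ** transpose (V k))
      \<longlonglongrightarrow> (1/2) *\<^sub>R (transpose ?D ** (- (lam *\<^sub>R (?u + N))) - transpose (- (lam *\<^sub>R (?u + N))) ** ?D)"
    unfolding gF_rot by (intro tendsto_intros diag_lim lims Gr_lim)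
  also have "(1/2) *\<^sub>R (transpose ?D ** (- (lam *\<^sub>R (?u + N))) - transpose (- (lam *\<^sub>R (?u + N))) ** ?D) = 0"
    by (simp add: transpose_minus transpose_scalar transpose_add matrix_distribs 0 zt u)
  finally have "(\<lambda>k. norm (V k ** gF k ** transpose (V k))) \<longlonglongrightarrow> 0"
    by (rule tendsto_norm_zero)
  then have F: "(\<lambda>k. norm (gF k)) \<longlonglongrightarrow> 0" by (simp add: orth)
  have "(\<lambda>k. sqrt ((norm (gE k))\<^sup>2 + (norm (gF k))\<^sup>2)) \<longlonglongrightarrow> sqrt (0\<^sup>2 + 0\<^sup>2)"
    by (intro tendsto_intros E F)
  then show ?thesis by (simp add: \<beta>_def[abs_def] norm_Pair)
qed

text \<open>Half of the distance between \<lambda>\<theta>, the limiting bound for the gradient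
  outside \<open>I\<close>, and \<lambda>; the other half absorbs the deviation from the
  limit.\<close>

definition \<kappa> :: real where "\<kappa> = lam * (1 - \<theta>) / 2"

lemma \<kappa>_pos: "0 < \<kappa>" using lam N(3) by (simp add: \<kappa>_def)

lemma g_off_eventually: "\<forall>\<^sub>F k in sequentially. \<forall>i\<in>- I. \<bar>g k $ i\<bar> < lam - \<kappa>"
proof (rule eventually_ball_finite)
  show "\<forall>i\<in>- I. \<forall>\<^sub>F k in sequentially. \<bar>g k $ i\<bar> < lam - \<kappa>"
  proof
    fix i assume i: "i \<in> - I"
    have "(\<lambda>k. \<bar>Gr k $ row_of i $ i\<bar>) \<longlonglongrightarrow> \<bar>(- (lam *\<^sub>R (unit_block I + N))) $ row_of i $ i\<bar>"
      by (intro tendsto_intros Gr_lim)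
    moreover have "\<bar>(- (lam *\<^sub>R (unit_block I + N))) $ row_of i $ i\<bar> < lam - \<kappa>"
    proof -
      have "\<bar>(- (lam *\<^sub>R (unit_block I + N))) $ row_of i $ i\<bar> = lam * \<bar>N $ row_of i $ i\<bar>"
        using i lam by (simp add: unit_block_nth abs_mult)
      also have "\<dots> \<le> lam * \<theta>" using lam op_bound_entry[OF N(2)] by (intro mult_left_mono) auto
      also have "\<dots> < lam - \<kappa>" using lam N(3) by (simp add: \<kappa>_def field_simps)
      finally show ?thesis .
    qed
    ultimately show "\<forall>\<^sub>F k in sequentially. \<bar>g k $ i\<bar> < lam - \<kappa>"
      unfolding g_nth by (rule order_tendstoD(2))
  qed
qed simp

definition prox where "prox k t = (\<chi> i. soft (t * lam) (\<sigma> k $ i - t * g k $ i))"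

text \<open>The statement is uniform in \<open>t\<close> so that trial stepsizes are covered.
  Entries outside \<open>I\<close> are set to zero only under a condition involving
  \<open>t\<close>, because small stepsizes cannot remove them at once.\<close>

lemma prox_identification:
  assumes "0 < tmax"
  shows "\<forall>\<^sub>F k in sequentially. \<forall>t. 0 < t \<and> t \<le> tmax \<longrightarrow>
    (\<forall>i\<in>I. prox k t $ i = \<sigma> k $ i - t * a k $ i) \<and>
    (\<forall>i\<in>- I. \<bar>prox k t $ i - \<sigma> k $ i\<bar> \<le> \<bar>\<sigma> k $ i\<bar> \<and> (\<bar>\<sigma> k $ i\<bar> \<le> t * \<kappa> \<longrightarrow> prox k t $ i = 0))"
proof -
  have "\<forall>\<^sub>F k in sequentially. \<forall>i\<in>I. tmax * (\<Sum>j\<in>UNIV. \<bar>a k $ j\<bar>) < \<sigma>b $ i / 2"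
  proof (rule eventually_ball_finite)
    have "(\<lambda>k. tmax * (\<Sum>j\<in>UNIV. \<bar>a k $ j\<bar>)) \<longlonglongrightarrow> tmax * 0" by (intro tendsto_intros norm_a_lim)
    then show "\<forall>i\<in>I. \<forall>\<^sub>F k in sequentially. tmax * (\<Sum>j\<in>UNIV. \<bar>a k $ j\<bar>) < \<sigma>b $ i / 2"
      using \<sigma>b(1) by (intro ballI order_tendstoD(2)) auto
  qed simp
  then show ?thesis using \<sigma>_pos_eventually g_off_eventually
  proof eventually_elim
    case (elim k)
    show ?case
    proof (intro allI impI conjI ballI)
      fix t i assume t: "0 < t \<and> t \<le> tmax" and i: "i \<in> I"
      have "t * a k $ i \<le> t * \<bar>a k $ i\<bar>" using t by (intro mult_left_mono) auto
      also have "\<dots> \<le> tmax * (\<Sum>j\<in>UNIV. \<bar>a k $ j\<bar>)"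
        using t by (intro mult_mono member_le_sum[where f = "\<lambda>j. \<bar>a k $ j\<bar>"]) auto
      finally have "t * a k $ i < \<sigma> k $ i" using elim(1,2) i by force
      then have "t * lam < \<sigma> k $ i - t * g k $ i" using i by (simp add: a_def algebra_simps)
      then show "prox k t $ i = \<sigma> k $ i - t * a k $ i"
        using i by (simp add: prox_def soft_def a_def algebra_simps)
    next
      fix t i assume t: "0 < t \<and> t \<le> tmax" and i: "i \<in> - I"
      have gi: "\<bar>g k $ i\<bar> \<le> lam - \<kappa>" using elim(3) i by force
      then show "\<bar>prox k t $ i - \<sigma> k $ i\<bar> \<le> \<bar>\<sigma> k $ i\<bar>"
        using t \<kappa>_pos by (simp add: prox_def soft_moves_towards_zero)
      show "prox k t $ i = 0" if "\<bar>\<sigma> k $ i\<bar> \<le> t * \<kappa>"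
        using t gi that by (simp add: prox_def soft_eq_zero)
    qed
  qed
qed

text \<open>The decrease in \<sigma> of the objective with its smooth part linearized; the proximal
  step makes it at least the squared step divided by \<open>t\<close>.\<close>

definition gain where "gain k x = (\<Sum>i\<in>UNIV. lam * \<bar>\<sigma> k $ i\<bar> - lam * \<bar>x $ i\<bar> - g k $ i * (x $ i - \<sigma> k $ i))"

lemma gain_eq: "gain k x = lam * l1_norm (\<sigma> k) - lam * l1_norm x - g k \<bullet> (x - \<sigma> k)"
  by (simp add: gain_def l1_norm_def sum_subtractf sum_distrib_left inner_vec_def)

lemma gain_component: "0 < t \<Longrightarrow> (prox k t $ i - \<sigma> k $ i)\<^sup>2 / t
    \<le> lam * \<bar>\<sigma> k $ i\<bar> - lam * \<bar>prox k t $ i\<bar> - g k $ i * (prox k t $ i - \<sigma> k $ i)"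
  using soft_gain[of t lam] lam by (simp add: prox_def)

lemma gain_prox: "0 < t \<Longrightarrow> (norm (prox k t - \<sigma> k))\<^sup>2 / t \<le> gain k (prox k t)"
  unfolding norm_sq_cart gain_def sum_divide_distrib
  by (intro sum_mono) (simp add: gain_component)

text \<open>Setting an entry outside \<open>I\<close> to zero gains at least \<kappa> times its
  size. The total gain thus dominates both the squared step over \<open>t\<close> and
  \<kappa>\<tau>, hence also their average.\<close>

lemma gain_identified:
  assumes t: "0 < t" and zero: "\<And>i. i \<notin> I \<Longrightarrow> prox k t $ i = 0"
    and g: "\<And>i. i \<notin> I \<Longrightarrow> \<bar>g k $ i\<bar> \<le> lam - \<kappa>"
  shows "(norm (prox k t - \<sigma> k))\<^sup>2 / (2 * t) + \<kappa> / 2 * \<tau> k \<le> gain k (prox k t)"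
proof -
  let ?c = "\<lambda>i. lam * \<bar>\<sigma> k $ i\<bar> - lam * \<bar>prox k t $ i\<bar> - g k $ i * (prox k t $ i - \<sigma> k $ i)"
  have "\<kappa> * \<tau> k = (\<Sum>i\<in>UNIV. if i \<in> - I then \<kappa> * \<bar>\<sigma> k $ i\<bar> else 0)"
    by (simp add: \<tau>_def sum_distrib_left sum.If_cases Compl_eq)
  also have "\<dots> \<le> (\<Sum>i\<in>UNIV. ?c i)"
  proof (rule sum_mono)
    fix i
    show "(if i \<in> - I then \<kappa> * \<bar>\<sigma> k $ i\<bar> else 0) \<le> ?c i"
    proof (cases "i \<in> I")
      case True
      have "0 \<le> (prox k t $ i - \<sigma> k $ i)\<^sup>2 / t" using t by simp
      then show ?thesis using True gain_component[OF t, of k i] by simp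
    next
      case False
      have "\<bar>g k $ i * \<sigma> k $ i\<bar> \<le> (lam - \<kappa>) * \<bar>\<sigma> k $ i\<bar>"
        unfolding abs_mult using g[OF False] by (intro mult_right_mono) auto
      then have "- (g k $ i * \<sigma> k $ i) \<le> lam * \<bar>\<sigma> k $ i\<bar> - \<kappa> * \<bar>\<sigma> k $ i\<bar>"
        by (simp add: left_diff_distrib)
      then show ?thesis using False zero[OF False] by simp
    qed
  qed
  finally have "\<kappa> * \<tau> k \<le> gain k (prox k t)" by (simp add: gain_def)
  moreover have "(norm (prox k t - \<sigma> k))\<^sup>2 / (2 * t) = (norm (prox k t - \<sigma> k))\<^sup>2 / t / 2" by simp
  ultimately show ?thesis using gain_prox[OF t, of k] by linarith
qed

lemma prox_dist:
  assumes t: "0 < t" "t \<le> tmax"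
    and on: "\<And>i. i \<in> I \<Longrightarrow> prox k t $ i = \<sigma> k $ i - t * a k $ i"
    and off: "\<And>i. i \<notin> I \<Longrightarrow> \<bar>prox k t $ i - \<sigma> k $ i\<bar> \<le> \<bar>\<sigma> k $ i\<bar>"
  shows "norm (prox k t - \<sigma> k) \<le> tmax * (\<Sum>i\<in>UNIV. \<bar>a k $ i\<bar>) + \<tau> k"
    and "t * norm (a k) \<le> norm (prox k t - \<sigma> k)"
proof -
  have "norm (prox k t - \<sigma> k) \<le> (\<Sum>i\<in>UNIV. \<bar>(prox k t - \<sigma> k) $ i\<bar>)" by (rule norm_le_l1_cart)
  also have "\<dots> \<le> (\<Sum>i\<in>UNIV. tmax * \<bar>a k $ i\<bar> + (if i \<in> - I then \<bar>\<sigma> k $ i\<bar> else 0))"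
  proof (rule sum_mono)
    show "\<bar>(prox k t - \<sigma> k) $ i\<bar> \<le> tmax * \<bar>a k $ i\<bar> + (if i \<in> - I then \<bar>\<sigma> k $ i\<bar> else 0)" for i
      using on[of i] off[of i] t by (cases "i \<in> I") (auto simp: abs_mult mult_right_mono a_def)
  qed
  also have "\<dots> = tmax * (\<Sum>i\<in>UNIV. \<bar>a k $ i\<bar>) + \<tau> k"
    by (simp add: sum.distrib sum_distrib_left \<tau>_def sum.If_cases Compl_eq)
  finally show "norm (prox k t - \<sigma> k) \<le> tmax * (\<Sum>i\<in>UNIV. \<bar>a k $ i\<bar>) + \<tau> k" .
  have "norm (t *\<^sub>R a k) \<le> norm (prox k t - \<sigma> k)"
  proof (rule norm_le_componentwise_cart)
    show "norm ((t *\<^sub>R a k) $ i) \<le> norm ((prox k t - \<sigma> k) $ i)" for i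
      using on[of i] t by (cases "i \<in> I") (auto simp: a_def)
  qed
  then show "t * norm (a k) \<le> norm (prox k t - \<sigma> k)" using t by simp
qed

section \<open>Descent uniform in the stepsizes\<close>

abbreviation lsig where "lsig k \<equiv> l_sigma \<A> b (\<sigma> k) (U k) (V k)"
abbreviation lome where "lome k \<equiv> l_Omega \<A> b (\<sigma> k) (U k) (V k)"

abbreviation step where
  "step k t s \<sigma>' U' V' \<equiv> dpga_step \<A> b lam t s (\<sigma> k) (U k) (V k) \<sigma>' U' V'"

lemma step_iff:
  assumes "0 < t"
  shows "step k t s \<sigma>' U' V' \<longleftrightarrow> \<sigma>' = prox k t \<and>
    (mat 1 + (1/2) *\<^sub>R (- (s *\<^sub>R gE k))) ** transpose U' = (mat 1 - (1/2) *\<^sub>R (- (s *\<^sub>R gE k))) ** transpose (U k) \<and>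
    (mat 1 + (1/2) *\<^sub>R (- (s *\<^sub>R gF k))) ** transpose V' = (mat 1 - (1/2) *\<^sub>R (- (s *\<^sub>R gF k))) ** transpose (V k)"
  using prox_l1[OF assms less_imp_le[OF lam], of "\<sigma> k" "g k" \<sigma>']
  by (simp add: dpga_step_def Let_def g_def gE_def gF_def prox_def)

lemma skew_steps: "transpose (- (s *\<^sub>R gE k)) = - (- (s *\<^sub>R gE k))" "transpose (- (s *\<^sub>R gF k)) = - (- (s *\<^sub>R gF k))"
  by (simp_all add: transpose_minus transpose_scalar gE_def gF_def transpose_grad_E transpose_grad_F)

text \<open>Uniqueness allows the existential quantifier in \<open>sufficient_descent\<close> to be
  replaced by any step at hand.\<close>

lemma step_exists_unique:
  assumes "0 < t"
  shows "\<exists>U' V'. \<forall>x P Q. step k t s x P Q \<longleftrightarrow> x = prox k t \<and> P = U' \<and> Q = V'"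
proof -
  obtain C where C: "\<And>Y Z :: ('m,'m) mat. (mat 1 + (1/2) *\<^sub>R (- (s *\<^sub>R gE k))) ** Y = (mat 1 - (1/2) *\<^sub>R (- (s *\<^sub>R gE k))) ** Z \<longleftrightarrow> Y = C ** Z"
    using cayley_exists[OF skew_steps(1) op_bound_norm] by blast
  obtain K where K: "\<And>Y Z :: ('n,'n) mat. (mat 1 + (1/2) *\<^sub>R (- (s *\<^sub>R gF k))) ** Y = (mat 1 - (1/2) *\<^sub>R (- (s *\<^sub>R gF k))) ** Z \<longleftrightarrow> Y = K ** Z"
    using cayley_exists[OF skew_steps(2) op_bound_norm] by blast
  have "transpose P = C ** transpose (U k) \<longleftrightarrow> P = transpose (C ** transpose (U k))" for P :: "('m,'m) mat"
    by (metis transpose_transpose)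
  moreover have "transpose Q = K ** transpose (V k) \<longleftrightarrow> Q = transpose (K ** transpose (V k))" for Q :: "('n,'n) mat"
    by (metis transpose_transpose)
  ultimately show ?thesis unfolding step_iff[OF assms] C K by blast
qed

lemma norm_step: "0 \<le> s \<Longrightarrow> norm (- (s *\<^sub>R gE k), - (s *\<^sub>R gF k)) = s * \<beta> k"
proof -
  assume "0 \<le> s"
  have "(- (s *\<^sub>R gE k), - (s *\<^sub>R gF k)) = (- s) *\<^sub>R (gE k, gF k)" by simp
  then show ?thesis using \<open>0 \<le> s\<close> by (simp only: norm_scaleR \<beta>_def) simp
qed

definition err where
  "err k \<delta> \<nu> = norm (G k) * \<delta> / 2 + lip * (2 * norm (\<sigma> k) * \<nu> + \<nu>\<^sup>2)"

lemma step_descent: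
  assumes t: "0 < t" and s: "0 < s" and st: "step k t s \<sigma>' U' V'"
  defines "\<delta> \<equiv> norm (\<sigma>' - \<sigma> k)"
  defines "\<nu> \<equiv> \<delta> + s * \<beta> k * norm \<sigma>' / 2"
  shows "orthogonal_matrix U'" "orthogonal_matrix V'"
    and "norm (assemble \<sigma>' U' V' - X k) \<le> \<delta> + (norm (\<sigma> k) + \<nu>) * (s * \<beta> k)"
    and "obj (assemble \<sigma>' U' V') \<le> obj (X k) - gain k \<sigma>' - s * (\<beta> k)\<^sup>2
      + lsig k * \<delta>\<^sup>2 + (lome k + err k \<delta> \<nu>) * (s * \<beta> k)\<^sup>2"
proof -
  note st' = st[unfolded step_iff[OF t]]
  note args = orth(1) orth(2) skew_steps(1) skew_steps(2) st'[THEN conjunct2, THEN conjunct1] st'[THEN conjunct2, THEN conjunct2]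
  note d = descent(3,4)[where \<sigma> = "\<sigma> k" and \<sigma>' = \<sigma>', OF args, unfolded norm_step[OF less_imp_le[OF s]],
      folded X_def \<delta>_def, folded \<nu>_def G_def g_def gE_def gF_def]
  show o: "orthogonal_matrix U'" "orthogonal_matrix V'"
    using descent(1,2)[OF args] by blast+
  show "norm (assemble \<sigma>' U' V' - X k) \<le> \<delta> + (norm (\<sigma> k) + \<nu>) * (s * \<beta> k)"
    by (rule d(1))
  have "gE k \<bullet> - (s *\<^sub>R gE k) + gF k \<bullet> - (s *\<^sub>R gF k) = - (s * (\<beta> k)\<^sup>2)"
    by (simp add: \<beta>_def norm_Pair power2_norm_eq_inner distrib_left)
  then show "obj (assemble \<sigma>' U' V') \<le> obj (X k) - gain k \<sigma>' - s * (\<beta> k)\<^sup>2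
      + lsig k * \<delta>\<^sup>2 + (lome k + err k \<delta> \<nu>) * (s * \<beta> k)\<^sup>2"
    using d(2) unfolding objective_assemble[OF o] X_def objective_assemble[OF orth] gain_eq err_def
    by (simp add: distrib_right)
qed

text \<open>Near the limit the possible displacement in \<sigma> is at most \<open>d k\<close>,
  whatever stepsizes within the bounds are tried. The remainder \<open>err\<close> is monotone in
  its two step sizes, so it falls below any fixed \<open>\<eta>\<close>.\<close>

lemma uniform_descent:
  assumes "0 < tmax" "0 < smax" "0 < \<eta>"
  shows "\<forall>\<^sub>F k in sequentially. \<forall>t s \<sigma>' U' V'. 0 < t \<and> t \<le> tmax \<and> 0 < s \<and> s \<le> smax \<and> step k t s \<sigma>' U' V' \<longrightarrow>
    obj (assemble \<sigma>' U' V') \<le> obj (X k) - gain k \<sigma>' - s * (\<beta> k)\<^sup>2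
      + lsig k * (norm (\<sigma>' - \<sigma> k))\<^sup>2 + (lome k + \<eta>) * (s * \<beta> k)\<^sup>2"
proof -
  define d where "d k = tmax * (\<Sum>i\<in>UNIV. \<bar>a k $ i\<bar>) + \<tau> k" for k
  define n where "n k = d k + smax * \<beta> k * (norm (\<sigma> k) + d k) / 2" for k
  have d: "d \<longlonglongrightarrow> tmax * 0 + 0" unfolding d_def[abs_def] by (intro tendsto_intros norm_a_lim \<tau>_lim)
  then have d: "d \<longlonglongrightarrow> 0" by simp
  have "n \<longlonglongrightarrow> 0 + smax * 0 * (norm \<sigma>b + 0) / 2"
    unfolding n_def[abs_def] by (intro tendsto_intros d \<beta>_lim lims) simp
  then have n: "n \<longlonglongrightarrow> 0" by simp
  have "(\<lambda>k. err k (d k) (n k)) \<longlonglongrightarrow> norm Gb * 0 / 2 + lip * (2 * norm \<sigma>b * 0 + 0\<^sup>2)"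
    unfolding err_def by (intro tendsto_intros d n G_lim lims) simp
  then have "\<forall>\<^sub>F k in sequentially. err k (d k) (n k) < \<eta>"
    using assms(3) by (intro order_tendstoD(2)) auto
  then show ?thesis using prox_identification[OF assms(1)]
  proof eventually_elim
    case (elim k)
    show ?case
    proof (intro allI impI)
      fix t s \<sigma>' U' V' assume *: "0 < t \<and> t \<le> tmax \<and> 0 < s \<and> s \<le> smax \<and> step k t s \<sigma>' U' V'"
      define \<delta> where "\<delta> = norm (\<sigma>' - \<sigma> k)"
      define \<nu> where "\<nu> = \<delta> + s * \<beta> k * norm \<sigma>' / 2"
      have \<sigma>': "\<sigma>' = prox k t" using * step_iff by blast
      have \<delta>: "\<delta> \<le> d k"
        unfolding \<delta>_def \<sigma>' d_def using * elim(2) by (intro prox_dist(1)[where t = t]) auto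
      have "norm \<sigma>' \<le> norm (\<sigma> k) + d k"
        using norm_triangle_sub[of \<sigma>' "\<sigma> k"] \<delta> by (simp add: \<delta>_def)
      then have "s * \<beta> k * norm \<sigma>' \<le> smax * \<beta> k * (norm (\<sigma> k) + d k)"
        using * \<beta>_bounds(3)[of k] by (intro mult_mono) auto
      then have \<nu>: "\<nu> \<le> n k" using \<delta> by (simp add: \<nu>_def n_def)
      have nn: "0 \<le> \<delta>" "0 \<le> \<nu>" using * \<beta>_bounds(3)[of k] by (simp_all add: \<delta>_def \<nu>_def)
      have "err k \<delta> \<nu> \<le> err k (d k) (n k)"
        unfolding err_def using nn \<delta> \<nu> lip_nonneg
        by (intro add_mono mult_left_mono divide_right_mono power_mono) auto
      then have "err k \<delta> \<nu> \<le> \<eta>" using elim(1) by simp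
      then have "(lome k + err k \<delta> \<nu>) * (s * \<beta> k)\<^sup>2
          \<le> (lome k + \<eta>) * (s * \<beta> k)\<^sup>2"
        by (intro mult_right_mono) auto
      then show "obj (assemble \<sigma>' U' V') \<le> obj (X k) - gain k \<sigma>' - s * (\<beta> k)\<^sup>2
        + lsig k * (norm (\<sigma>' - \<sigma> k))\<^sup>2 + (lome k + \<eta>) * (s * \<beta> k)\<^sup>2"
        using step_descent(4)[of t s k \<sigma>' U' V'] * by (simp add: \<delta>_def \<nu>_def)
    qed
  qed
qed

lemma l_sigma_eq: "lsig k = lip + 2 * norm (G k) + 2 * lip * norm (\<sigma> k)"
  by (simp add: l_sigma_def lip_def G_def X_def)

lemma l_Omega_eq: "lome k
    = lip * (norm (\<sigma> k))\<^sup>2 + (1/2 + norm (\<sigma> k)) * norm (G k) + norm (\<sigma> k) / 2"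
  by (simp add: l_Omega_def lip_def G_def X_def)

lemma l_sigma_convergent: "\<exists>c. (\<lambda>k. lsig k) \<longlonglongrightarrow> c"
  unfolding l_sigma_eq
  by (rule exI[of _ "lip + 2 * norm Gb + 2 * lip * norm \<sigma>b"], intro tendsto_intros lims G_lim)

lemma l_Omega_convergent: "\<exists>c. (\<lambda>k. lome k) \<longlonglongrightarrow> c"
  unfolding l_Omega_eq
  by (rule exI[of _ "lip * (norm \<sigma>b)\<^sup>2 + (1/2 + norm \<sigma>b) * norm Gb + norm \<sigma>b / 2"], intro tendsto_intros lims G_lim) simp

lemma l_nonneg: "0 \<le> lsig k" "0 \<le> lome k"
  unfolding l_sigma_eq l_Omega_eq using lip_nonneg by simp_all

end

section \<open>From sufficient descent to a linear rate\<close>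

text \<open>The finitely many initial terms are absorbed into the constant through
  \<open>M\<close>.\<close>

lemma converges_linearly_eventually:
  assumes q: "0 < q" "q < 1" and ev: "\<forall>\<^sub>F k in sequentially. norm (z k - zb) \<le> C * q ^ k"
  shows "converges_linearly z zb"
proof -
  obtain K where K: "\<And>k. K \<le> k \<Longrightarrow> norm (z k - zb) \<le> C * q ^ k"
    using ev by (auto simp: eventually_sequentially)
  define M where "M = (\<Sum>j<K. norm (z j - zb) / q ^ j)"
  have M: "0 \<le> M" using q by (auto simp: M_def intro!: sum_nonneg)
  have "norm (z k - zb) \<le> (\<bar>C\<bar> + 1 + M) * q ^ k" for k
  proof (cases "k < K")
    case True
    have "norm (z k - zb) / q ^ k \<le> M"
      unfolding M_def using True q by (intro member_le_sum[where f = "\<lambda>j. norm (z j - zb) / q ^ j"]) auto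
    then have "norm (z k - zb) / q ^ k \<le> \<bar>C\<bar> + 1 + M" by simp
    then show ?thesis using q by (simp add: pos_divide_le_eq)
  next
    case False
    then have "norm (z k - zb) \<le> C * q ^ k" by (intro K) simp
    also have "\<dots> \<le> (\<bar>C\<bar> + 1 + M) * q ^ k" using q M by (intro mult_right_mono) auto
    finally show ?thesis .
  qed
  moreover have "0 < \<bar>C\<bar> + 1 + M" using M by simp
  ultimately show ?thesis unfolding converges_linearly_def using q by blast
qed

text \<open>Descent and error bound together give a fixed contraction of the gap. The step length is
  of the order of the square root of the gap, so the steps form a geometric series with ratio
  \<open>sqrt \<rho>\<close>, whose tails bound the distance to the limit.\<close>

lemma linear_rate:
  fixes X :: "nat \<Rightarrow> 'a::real_normed_vector" and \<Phi> d :: "nat \<Rightarrow> real"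
  assumes X: "X \<longlonglongrightarrow> Xb" and nonneg: "\<And>k. 0 \<le> \<Phi> k" "\<And>k. 0 \<le> d k" and c: "0 < c"
    and descent: "\<forall>\<^sub>F k in sequentially. c * (d k)\<^sup>2 \<le> \<Phi> k - \<Phi> (Suc k)"
    and error: "\<forall>\<^sub>F k in sequentially. \<Phi> k \<le> C * (d k)\<^sup>2"
    and move: "\<forall>\<^sub>F k in sequentially. norm (X (Suc k) - X k) \<le> B * d k"
  shows "converges_linearly X Xb" "\<exists>D q. 0 < q \<and> q < 1 \<and> (\<forall>\<^sub>F k in sequentially. \<Phi> k \<le> D * q ^ k)"
proof -
  obtain K where K: "\<And>k. K \<le> k \<Longrightarrow> c * (d k)\<^sup>2 \<le> \<Phi> k - \<Phi> (Suc k)" "\<And>k. K \<le> k \<Longrightarrow> \<Phi> k \<le> C * (d k)\<^sup>2"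
    "\<And>k. K \<le> k \<Longrightarrow> norm (X (Suc k) - X k) \<le> B * d k"
    using eventually_conj[OF descent eventually_conj[OF error move]] by (auto simp: eventually_sequentially)
  \<comment> \<open>Enlarging the constant to at least \<open>2 * c\<close> keeps the ratio \<rho>
    positive.\<close>
  define C' where "C' = max C (2 * c)"
  define \<rho> where "\<rho> = 1 - c / C'"
  have C': "0 < C'" "2 * c \<le> C'" using c by (auto simp: C'_def)
  have \<rho>: "0 < \<rho>" "\<rho> < 1" using C' c by (auto simp: \<rho>_def field_simps)
  have contract: "\<Phi> (Suc k) \<le> \<rho> * \<Phi> k" if "K \<le> k" for k
  proof -
    have "\<Phi> k \<le> C' * (d k)\<^sup>2"
      using K(2)[OF that] mult_right_mono[of C C' "(d k)\<^sup>2"] by (simp add: C'_def)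
    then have "c / C' * \<Phi> k \<le> c / C' * (C' * (d k)\<^sup>2)" using c C' by (intro mult_left_mono) auto
    then have "c / C' * \<Phi> k \<le> c * (d k)\<^sup>2" using C' by simp
    then show ?thesis using K(1)[OF that] by (simp add: \<rho>_def left_diff_distrib)
  qed
  have geo: "\<Phi> (K + m) \<le> \<rho> ^ m * \<Phi> K" for m
  proof (induction m)
    case (Suc m)
    have "\<Phi> (K + Suc m) \<le> \<rho> * \<Phi> (K + m)" using contract[of "K + m"] by simp
    also have "\<dots> \<le> \<rho> * (\<rho> ^ m * \<Phi> K)" using Suc \<rho> by (intro mult_left_mono) auto
    finally show ?case by (simp add: mult.assoc)
  qed simp
  define M where "M = \<Phi> K / \<rho> ^ K"
  have M: "0 \<le> M" using nonneg \<rho> by (simp add: M_def)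
  have \<Phi>: "\<Phi> k \<le> M * \<rho> ^ k" if "K \<le> k" for k
    using geo[of "k - K"] that \<rho> by (simp add: M_def power_diff field_simps)
  then show "\<exists>D q. 0 < q \<and> q < 1 \<and> (\<forall>\<^sub>F k in sequentially. \<Phi> k \<le> D * q ^ k)"
    using \<rho> by (auto simp: eventually_sequentially)
  define r where "r = sqrt \<rho>"
  have r: "0 < r" "r < 1" using \<rho> by (simp_all add: r_def)
  define D where "D = \<bar>B\<bar> * sqrt (M / c)"
  have D: "0 \<le> D" using M c by (simp add: D_def)
  have step: "norm (X (Suc k) - X k) \<le> D * r ^ k" if "K \<le> k" for k
  proof -
    have "c * (d k)\<^sup>2 \<le> M * \<rho> ^ k" using K(1)[OF that] \<Phi>[OF that] nonneg(1)[of "Suc k"] by linarith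
    then have "(d k)\<^sup>2 \<le> M / c * \<rho> ^ k" using c by (simp add: field_simps)
    also have "\<dots> = (sqrt (M / c) * r ^ k)\<^sup>2"
      using M c \<rho> by (simp add: r_def power_mult_distrib real_sqrt_power[symmetric])
    finally have "d k \<le> sqrt (M / c) * r ^ k"
      by (rule power2_le_imp_le) (use M c r in simp)
    then have "\<bar>B\<bar> * d k \<le> D * r ^ k" by (simp add: D_def mult.assoc mult_left_mono)
    moreover have "B * d k \<le> \<bar>B\<bar> * d k" using nonneg(2) by (intro mult_right_mono) auto
    ultimately show ?thesis using K(3)[OF that] by linarith
  qed
  \<comment> \<open>The factor \<open>1 - r ^ m\<close> is the exact partial geometric sum; it makes
    the induction close.\<close>
  have far: "norm (X (m + k) - X k) \<le> D / (1 - r) * r ^ k * (1 - r ^ m)" if "K \<le> k" for k m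
  proof (induction m)
    case (Suc m)
    have "norm (X (Suc m + k) - X k) \<le> norm (X (Suc (m + k)) - X (m + k)) + norm (X (m + k) - X k)"
      using norm_triangle_ineq[of "X (Suc (m + k)) - X (m + k)" "X (m + k) - X k"] by simp
    also have "\<dots> \<le> D * r ^ (m + k) + D / (1 - r) * r ^ k * (1 - r ^ m)"
      using Suc step[of "m + k"] that by simp
    also have "\<dots> = D / (1 - r) * r ^ k * (1 - r ^ Suc m)"
    proof -
      define Q where "Q = D / (1 - r) * r ^ k"
      have "D * r ^ (m + k) = Q * (r ^ m * (1 - r))"
        using r by (simp add: Q_def power_add)
      then show ?thesis unfolding Q_def[symmetric] by (simp add: algebra_simps)
    qed
    finally show ?case .
  qed simp
  have "norm (X k - Xb) \<le> D / (1 - r) * r ^ k" if "K \<le> k" for k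
  proof -
    have "(\<lambda>m. norm (X (m + k) - X k)) \<longlonglongrightarrow> norm (Xb - X k)"
      by (intro tendsto_intros LIMSEQ_ignore_initial_segment X)
    moreover have "norm (X (m + k) - X k) \<le> D / (1 - r) * r ^ k" for m
    proof -
      have "D / (1 - r) * r ^ k * (1 - r ^ m) \<le> D / (1 - r) * r ^ k * 1"
        using D r by (intro mult_left_mono mult_nonneg_nonneg divide_nonneg_nonneg) auto
      then show ?thesis using far[OF that, of m] by simp
    qed
    ultimately have "norm (Xb - X k) \<le> D / (1 - r) * r ^ k"
      by (intro LIMSEQ_le_const2) auto
    then show ?thesis by (simp add: norm_minus_commute)
  qed
  then show "converges_linearly X Xb"
    by (intro converges_linearly_eventually[OF r, where C = "D / (1 - r)"]) (auto simp: eventually_sequentially)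
qed

locale dpga_run = dpga_limit +
  fixes t s :: "nat \<Rightarrow> real"
  assumes t_pos: "\<And>k. 0 < t k" and s_pos: "\<And>k. 0 < s k"
    and steps: "\<And>k. step k (t k) (s k) (\<sigma> (Suc k)) (U (Suc k)) (V (Suc k))"
begin

definition \<delta> where "\<delta> k = norm (\<sigma> (Suc k) - \<sigma> k)"
definition q where "q k = s k * \<beta> k"

lemma \<sigma>_Suc: "\<sigma> (Suc k) = prox k (t k)"
  using steps[of k] step_iff[OF t_pos] by blast

lemma q_nonneg: "0 \<le> q k" using s_pos[of k] \<beta>_bounds(3)[of k] by (simp add: q_def)

lemma objective_lim: "(\<lambda>k. obj (X k)) \<longlonglongrightarrow> obj Xb"
proof -
  have "(\<lambda>k. (norm (\<A> (X k) - b))\<^sup>2 / 2 + lam * (\<Sum>i\<in>UNIV. \<bar>\<sigma> k $ i\<bar>))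
      \<longlonglongrightarrow> (norm (\<A> Xb - b))\<^sup>2 / 2 + lam * (\<Sum>i\<in>UNIV. \<bar>\<sigma>b $ i\<bar>)"
    by (intro tendsto_intros A_lim X_lim lims) simp
  then show ?thesis
    unfolding X_def Xb_def objective_assemble[OF orth] objective_assemble[OF orth_limit] fit_def l1_norm_def .
qed

text \<open>The interface to the stepsize strategies: each has to provide descent proportional to
  the squared step and a residual controlled by that step.\<close>

lemma linear_convergence:
  assumes \<alpha>: "0 < \<alpha>"
    and descent: "\<forall>\<^sub>F k in sequentially. obj (X (Suc k)) + \<alpha> * ((\<delta> k)\<^sup>2 + (q k)\<^sup>2) \<le> obj (X k)"
    and residual: "\<forall>\<^sub>F k in sequentially. (res k)\<^sup>2 + \<tau> k \<le> C * ((\<delta> k)\<^sup>2 + (q k)\<^sup>2)"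
  shows "converges_linearly X Xb \<and> converges_linearly (\<lambda>k. obj (X k)) (obj Xb)"
proof -
  define \<Phi> where "\<Phi> k = obj (X k) - obj Xb" for k
  define d where "d k = sqrt ((\<delta> k)\<^sup>2 + (q k)\<^sup>2)" for k
  have d_sq: "(d k)\<^sup>2 = (\<delta> k)\<^sup>2 + (q k)\<^sup>2" for k by (simp add: d_def)
  have d: "\<delta> k \<le> d k" "q k \<le> d k" "0 \<le> d k" for k
    by (auto simp: d_def intro!: real_le_rsqrt)
  have \<Phi>0: "0 \<le> \<Phi> k" for k using minimal by (simp add: \<Phi>_def Xb_def)
  have des: "\<forall>\<^sub>F k in sequentially. \<alpha> * (d k)\<^sup>2 \<le> \<Phi> k - \<Phi> (Suc k)"
    using descent by eventually_elim (simp add: \<Phi>_def d_sq)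
  obtain C' where C': "0 < C'" "\<forall>\<^sub>F k in sequentially. \<Phi> k \<le> C' * ((res k)\<^sup>2 + \<tau> k)"
    using error_bound unfolding \<Phi>_def by blast
  have err: "\<forall>\<^sub>F k in sequentially. \<Phi> k \<le> (C' * C) * (d k)\<^sup>2"
    using C'(2) residual
  proof eventually_elim
    case (elim k)
    have "C' * ((res k)\<^sup>2 + \<tau> k) \<le> C' * (C * ((\<delta> k)\<^sup>2 + (q k)\<^sup>2))" using elim C' by (intro mult_left_mono) auto
    then show ?case using elim by (simp add: d_sq mult.assoc)
  qed
  \<comment> \<open>Vanishing decrease of the objective forces \<open>q k \<le> 1\<close>
    eventually, which bounds the higher-order part of the displacement.\<close>
  have Flim: "(\<lambda>k. (obj (X k) - obj (X (Suc k))) / \<alpha>) \<longlonglongrightarrow> (obj Xb - obj Xb) / \<alpha>"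
    using \<alpha> by (intro tendsto_intros objective_lim LIMSEQ_Suc) simp
  then have ev1: "\<forall>\<^sub>F k in sequentially. (obj (X k) - obj (X (Suc k))) / \<alpha> < 1"
    by (rule order_tendstoD(2)) simp
  define R where "R = norm \<sigma>b + 1"
  have ev2: "\<forall>\<^sub>F k in sequentially. norm (\<sigma> k) < R"
    by (rule order_tendstoD(2)[OF tendsto_norm[OF lims(1)]]) (simp add: R_def)
  have ev3: "\<forall>\<^sub>F k in sequentially. norm (\<sigma> (Suc k)) < R"
    by (rule order_tendstoD(2)[OF tendsto_norm[OF LIMSEQ_Suc[OF lims(1)]]]) (simp add: R_def)
  have "\<forall>\<^sub>F k in sequentially. norm (X (Suc k) - X k) \<le> (1 + (R + 2 * R + R / 2)) * d k"
    using ev1 ev2 ev3 descent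
  proof eventually_elim
    case (elim k)
    define \<nu> where "\<nu> = \<delta> k + q k * norm (\<sigma> (Suc k)) / 2"
    have R: "0 < R" by (simp add: R_def add_nonneg_pos)
    have "(q k)\<^sup>2 \<le> (obj (X k) - obj (X (Suc k))) / \<alpha>"
    proof -
      have "\<alpha> * (q k)\<^sup>2 \<le> \<alpha> * ((\<delta> k)\<^sup>2 + (q k)\<^sup>2)" using \<alpha> by (intro mult_left_mono) auto
      then have "\<alpha> * (q k)\<^sup>2 \<le> obj (X k) - obj (X (Suc k))"
        using elim(4) by linarith
      then show ?thesis using \<alpha> by (simp add: pos_le_divide_eq mult.commute)
    qed
    then have "(q k)\<^sup>2 \<le> 1\<^sup>2" using elim(1) by simp
    then have q1: "q k \<le> 1" by (rule power2_le_imp_le) simp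
    have "\<delta> k \<le> 2 * R"
      unfolding \<delta>_def using norm_triangle_ineq4[of "\<sigma> (Suc k)" "\<sigma> k"] elim(2,3) by simp
    moreover have "q k * norm (\<sigma> (Suc k)) \<le> 1 * R"
      using q1 q_nonneg[of k] elim(3) by (intro mult_mono) auto
    ultimately have \<nu>: "\<nu> \<le> 2 * R + R / 2" by (simp add: \<nu>_def)
    have "norm (X (Suc k) - X k) \<le> \<delta> k + (norm (\<sigma> k) + \<nu>) * q k"
      using step_descent(3)[OF t_pos s_pos steps] by (simp add: X_def[of "Suc k"] \<delta>_def q_def \<nu>_def)
    also have "\<dots> \<le> d k + (R + 2 * R + R / 2) * d k"
    proof (rule add_mono[OF d(1) mult_mono])
      show "norm (\<sigma> k) + \<nu> \<le> R + 2 * R + R / 2" using elim(2) \<nu> by linarith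
    qed (use d(2) q_nonneg R in auto)
    finally show ?case by (simp add: distrib_right)
  qed
  note rate = linear_rate[OF X_lim \<Phi>0 d(3) \<alpha> des err this]
  obtain D p where p: "0 < p" "p < 1" "\<forall>\<^sub>F k in sequentially. \<Phi> k \<le> D * p ^ k" using rate(2) by blast
  have "\<forall>\<^sub>F k in sequentially. norm (obj (X k) - obj Xb) \<le> D * p ^ k"
    using p(3) \<Phi>0 by (simp add: \<Phi>_def)
  from rate(1) converges_linearly_eventually[OF p(1,2) this] show ?thesis ..
qed

text \<open>
  Once a step with \<open>t\<^sub>k\<close> bounded below has set the vanishing entries of \<open>\<sigma>\<close> to zero, they stay zero.
\<close>

lemma residual_bound:
  assumes smin: "0 < smin" "\<forall>\<^sub>F k in sequentially. smin \<le> s k"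
    and tmin: "0 < tmin" and tmax: "\<forall>\<^sub>F k in sequentially. t k \<le> tmax"
    and alt: "\<forall>\<^sub>F k in sequentially. tmin \<le> t k \<or> (norm (a k))\<^sup>2 + \<tau> k \<le> C * (\<beta> k)\<^sup>2"
  obtains C' where "\<forall>\<^sub>F k in sequentially. (res k)\<^sup>2 + \<tau> k \<le> C' * ((\<delta> k)\<^sup>2 + (q k)\<^sup>2)"
proof -
  obtain k0 where "t k0 \<le> tmax" using tmax by (auto simp: eventually_sequentially)
  then have tmax0: "0 < tmax" using t_pos[of k0] by simp
  have "\<forall>\<^sub>F k in sequentially. \<tau> k < tmin * \<kappa>"
    using tmin \<kappa>_pos by (intro order_tendstoD(2)[OF \<tau>_lim]) simp
  from eventually_conj[OF eventually_conj[OF smin(2) tmax] eventually_conj[OF alt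
      eventually_conj[OF prox_identification[OF tmax0] this]]]
  obtain K where sK: "\<And>k. K \<le> k \<Longrightarrow> smin \<le> s k" and tK: "\<And>k. K \<le> k \<Longrightarrow> t k \<le> tmax"
    and altK: "\<And>k. K \<le> k \<Longrightarrow> tmin \<le> t k \<or> (norm (a k))\<^sup>2 + \<tau> k \<le> C * (\<beta> k)\<^sup>2"
    and prK: "\<And>k. K \<le> k \<Longrightarrow> \<forall>t. 0 < t \<and> t \<le> tmax \<longrightarrow>
      (\<forall>i\<in>I. prox k t $ i = \<sigma> k $ i - t * a k $ i) \<and>
      (\<forall>i\<in>- I. \<bar>prox k t $ i - \<sigma> k $ i\<bar> \<le> \<bar>\<sigma> k $ i\<bar> \<and> (\<bar>\<sigma> k $ i\<bar> \<le> t * \<kappa> \<longrightarrow> prox k t $ i = 0))"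
    and \<tau>K: "\<And>k. K \<le> k \<Longrightarrow> \<tau> k < tmin * \<kappa>"
    unfolding eventually_sequentially by blast
  \<comment> \<open>The first summand serves the case in which \<open>\<delta>\<close> controls
    \<open>a\<close>, the second the case in which \<open>\<beta>\<close> dominates
    everything.\<close>
  define C' where "C' = 2 / tmin\<^sup>2 + (2 * \<bar>C\<bar> + 2) / smin\<^sup>2"
  have \<beta>q: "(\<beta> k)\<^sup>2 \<le> (q k)\<^sup>2 / smin\<^sup>2" if "K \<le> k" for k
  proof -
    have "smin * \<beta> k \<le> q k" unfolding q_def using sK[OF that] \<beta>_bounds(3) by (intro mult_right_mono)
    then have "(smin * \<beta> k)\<^sup>2 \<le> (q k)\<^sup>2" using smin \<beta>_bounds(3) by (intro power_mono) auto
    then show ?thesis using smin by (simp add: power_mult_distrib pos_le_divide_eq mult.commute)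
  qed
  have ares: "(res k)\<^sup>2 \<le> 2 * (norm (a k))\<^sup>2 + 2 * (\<beta> k)\<^sup>2" for k
    unfolding res_def using sum_squares_bound[of "norm (a k)" "\<beta> k"] by (simp add: power2_sum)
  have bad: "(res k)\<^sup>2 + \<tau> k \<le> C' * ((\<delta> k)\<^sup>2 + (q k)\<^sup>2)"
    if k: "K \<le> k" and C: "(norm (a k))\<^sup>2 + \<tau> k \<le> C * (\<beta> k)\<^sup>2" for k
  proof -
    have "C * (\<beta> k)\<^sup>2 \<le> \<bar>C\<bar> * (\<beta> k)\<^sup>2" by (intro mult_right_mono) auto
    then have "(res k)\<^sup>2 + \<tau> k \<le> (2 * \<bar>C\<bar> + 2) * (\<beta> k)\<^sup>2"
      using ares[of k] C \<tau>_nonneg[of k] by (simp add: distrib_right)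
    also have "\<dots> \<le> (2 * \<bar>C\<bar> + 2) * ((q k)\<^sup>2 / smin\<^sup>2)" by (intro mult_left_mono \<beta>q k) auto
    also have "\<dots> = (2 * \<bar>C\<bar> + 2) / smin\<^sup>2 * (q k)\<^sup>2" by simp
    also have "\<dots> \<le> C' * ((\<delta> k)\<^sup>2 + (q k)\<^sup>2)"
      unfolding C'_def by (intro mult_mono) auto
    finally show ?thesis .
  qed
  have good: "(res k)\<^sup>2 + \<tau> k \<le> C' * ((\<delta> k)\<^sup>2 + (q k)\<^sup>2)"
    if k: "K \<le> k" and t: "tmin \<le> t k" and \<tau>: "\<tau> k = 0" for k
  proof -
    have "t k * norm (a k) \<le> \<delta> k"
      unfolding \<delta>_def \<sigma>_Suc using prK[OF k] tK[OF k] t_pos[of k] by (intro prox_dist(2)[of "t k" tmax]) auto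
    then have "tmin * norm (a k) \<le> \<delta> k" using mult_right_mono[OF t norm_ge_zero[of "a k"]] by linarith
    then have "(tmin * norm (a k))\<^sup>2 \<le> (\<delta> k)\<^sup>2" using tmin by (intro power_mono) auto
    then have "(norm (a k))\<^sup>2 \<le> (\<delta> k)\<^sup>2 / tmin\<^sup>2"
      using tmin by (simp add: power_mult_distrib pos_le_divide_eq mult.commute)
    then have "(res k)\<^sup>2 + \<tau> k \<le> 2 / tmin\<^sup>2 * (\<delta> k)\<^sup>2 + 2 / smin\<^sup>2 * (q k)\<^sup>2"
      using ares[of k] \<beta>q[OF k] \<tau> by simp
    also have "\<dots> \<le> C' * (\<delta> k)\<^sup>2 + C' * (q k)\<^sup>2"
    proof (intro add_mono mult_right_mono zero_le_power2)
      have "0 \<le> (2 * \<bar>C\<bar> + 2) / smin\<^sup>2" by simp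
      then show "2 / tmin\<^sup>2 \<le> C'" by (simp add: C'_def)
      have "2 / smin\<^sup>2 \<le> (2 * \<bar>C\<bar> + 2) / smin\<^sup>2" by (intro divide_right_mono) auto
      then show "2 / smin\<^sup>2 \<le> C'" unfolding C'_def by (simp add: add_increasing)
    qed
    finally show ?thesis by (simp add: distrib_left)
  qed
  \<comment> \<open>Either some late stepsize is at least \<open>tmin\<close>, and identification
    takes place there, or the second alternative of \<open>alt\<close> holds from \<open>K\<close>
    on.\<close>
  show thesis
  proof (cases "\<exists>k1\<ge>K. tmin \<le> t k1")
    case True
    then obtain k1 where k1: "K \<le> k1" "tmin \<le> t k1" by blast
    have zero: "\<forall>i\<in>- I. \<sigma> k $ i = 0" if "Suc k1 \<le> k" for k
      using that
    proof (induction k rule: dec_induct)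
      case base
      show ?case
      proof
        fix i assume i: "i \<in> - I"
        have "\<bar>\<sigma> k1 $ i\<bar> \<le> \<tau> k1"
          unfolding \<tau>_def using i by (intro member_le_sum[where f = "\<lambda>i. \<bar>\<sigma> k1 $ i\<bar>"]) auto
        also have "\<dots> \<le> t k1 * \<kappa>"
          using \<tau>K[OF k1(1)] mult_right_mono[OF k1(2) less_imp_le[OF \<kappa>_pos]] by linarith
        finally show "\<sigma> (Suc k1) $ i = 0"
          unfolding \<sigma>_Suc using prK[OF k1(1)] tK[OF k1(1)] t_pos[of k1] i by blast
      qed
    next
      case (step k)
      then have k: "K \<le> k" using k1 by simp
      show ?case
      proof
        fix i assume i: "i \<in> - I"
        \<comment> \<open>A zero entry meets the thresholding condition for every positive stepsize,
          however small.\<close>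
        then have "\<bar>\<sigma> k $ i\<bar> \<le> t k * \<kappa>" using step t_pos[of k] \<kappa>_pos by simp
        then show "\<sigma> (Suc k) $ i = 0"
          unfolding \<sigma>_Suc using prK[OF k] tK[OF k] t_pos[of k] i by blast
      qed
    qed
    have "(res k)\<^sup>2 + \<tau> k \<le> C' * ((\<delta> k)\<^sup>2 + (q k)\<^sup>2)" if k: "Suc k1 \<le> k" for k
    proof -
      have K: "K \<le> k" using k k1 by simp
      have "\<tau> k = 0" using zero[OF k] by (simp add: \<tau>_def)
      then show ?thesis using altK[OF K] good[OF K] bad[OF K] by blast
    qed
    then show thesis using that unfolding eventually_sequentially by blast
  next
    case False
    then have "(res k)\<^sup>2 + \<tau> k \<le> C' * ((\<delta> k)\<^sup>2 + (q k)\<^sup>2)" if "K \<le> k" for k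
      using altK[OF that] bad[OF that] that by blast
    then show thesis using that unfolding eventually_sequentially by blast
  qed
qed

end

section \<open>The stepsize strategies\<close>

context dpga_run
begin

lemma norm_step_triple: "0 \<le> s' \<Longrightarrow>
    (norm (\<sigma>' - \<sigma> k, - (s' *\<^sub>R gE k), - (s' *\<^sub>R gF k)))\<^sup>2 = (norm (\<sigma>' - \<sigma> k))\<^sup>2 + (s' * \<beta> k)\<^sup>2"
  by (simp only: norm_Pair[of "\<sigma>' - \<sigma> k"] norm_step) simp

lemma sufficient_descent_iff:
  assumes "0 < t'" "0 \<le> s'" and step': "step k t' s' \<sigma>' U' V'"
  shows "sufficient_descent \<A> b lam \<alpha> t' s' (\<sigma> k) (U k) (V k) \<longleftrightarrow>
    obj (assemble \<sigma>' U' V') + \<alpha> * ((norm (\<sigma>' - \<sigma> k))\<^sup>2 + (s' * \<beta> k)\<^sup>2) \<le> obj (X k)"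
proof -
  obtain P Q where PQ: "\<And>x A B. step k t' s' x A B \<longleftrightarrow> x = prox k t' \<and> A = P \<and> B = Q"
    using step_exists_unique[OF assms(1)] by metis
  have "\<sigma>' = prox k t'" "U' = P" "V' = Q" using step' PQ by blast+
  then show ?thesis
    unfolding sufficient_descent_def PQ gE_def[symmetric] gF_def[symmetric] norm_step_triple[OF assms(2)] X_def[symmetric]
    by simp
qed

lemma l_bounds:
  obtains L where "0 < L"
    "\<forall>\<^sub>F k in sequentially. lsig k \<le> L \<and> lome k \<le> L"
proof -
  obtain c1 c2 where c: "(\<lambda>k. lsig k) \<longlonglongrightarrow> c1" "(\<lambda>k. lome k) \<longlonglongrightarrow> c2"
    using l_sigma_convergent l_Omega_convergent by blast
  show thesis
  proof (rule that)
    show "0 < \<bar>c1\<bar> + \<bar>c2\<bar> + 1" by simp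
    have "\<forall>\<^sub>F k in sequentially. lsig k < \<bar>c1\<bar> + \<bar>c2\<bar> + 1"
      by (rule order_tendstoD(2)[OF c(1)]) linarith
    moreover have "\<forall>\<^sub>F k in sequentially. lome k < \<bar>c1\<bar> + \<bar>c2\<bar> + 1"
      by (rule order_tendstoD(2)[OF c(2)]) linarith
    ultimately show "\<forall>\<^sub>F k in sequentially. lsig k \<le> \<bar>c1\<bar> + \<bar>c2\<bar> + 1
        \<and> lome k \<le> \<bar>c1\<bar> + \<bar>c2\<bar> + 1"
      by eventually_elim simp
  qed
qed

text \<open>
  For \<open>\<rho>\<^sub>s < 1\<close> a fixed small pair of stepsizes is eventually admissible, so both stepsizes stay away
  from zero. Nothing forbids \<open>\<rho>\<^sub>s \<ge> 1\<close>, and then \<open>t\<^sub>k\<close> may tend to zero; but then \<open>s\<^sub>k \<ge> 1\<close>, and a fixed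
  pair is rejected only if the residual in \<open>\<sigma>\<close> is dominated by the one in \<open>(E, F)\<close>.
\<close>

lemma backtracking_convergence:
  assumes \<alpha>: "0 < \<alpha>" and bt: "backtracking_stepsizes \<A> b lam \<alpha> \<sigma> U V t s"
  shows "converges_linearly X Xb \<and> converges_linearly (\<lambda>k. obj (X k)) (obj Xb)"
proof -
  obtain \<rho>t \<rho>s where \<rho>: "0 < \<rho>t" "\<rho>t < 1" "0 < \<rho>s"
    and sel: "\<And>k. \<exists>i j. t k = \<rho>t ^ i \<and> s k = \<rho>s ^ j \<and> sufficient_descent \<A> b lam \<alpha> (t k) (s k) (\<sigma> k) (U k) (V k)"
    and max: "\<And>k i. sufficient_descent \<A> b lam \<alpha> (\<rho>t ^ i) (\<rho>s ^ i) (\<sigma> k) (U k) (V k) \<Longrightarrow> \<rho>t ^ i \<le> t k \<and> \<rho>s ^ i \<le> s k"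
  proof -
    from bt obtain \<rho>t \<rho>s where \<rho>: "0 < \<rho>t" "\<rho>t < 1" "0 < \<rho>s"
      and *: "\<And>k. (t k, s k) \<in> {(\<rho>t ^ i, \<rho>s ^ j) | i j. i \<le> j \<and> j \<le> i + 1 \<and>
          sufficient_descent \<A> b lam \<alpha> (\<rho>t ^ i) (\<rho>s ^ j) (\<sigma> k) (U k) (V k)}"
        "\<And>k. \<forall>(t', s') \<in> {(\<rho>t ^ i, \<rho>s ^ j) | i j. i \<le> j \<and> j \<le> i + 1 \<and>
          sufficient_descent \<A> b lam \<alpha> (\<rho>t ^ i) (\<rho>s ^ j) (\<sigma> k) (U k) (V k)}. t' \<le> t k \<and> s' \<le> s k"
      unfolding backtracking_stepsizes_def Let_def by blast
    show thesis
    proof (rule that[OF \<rho>])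
      show "\<exists>i j. t k = \<rho>t ^ i \<and> s k = \<rho>s ^ j \<and> sufficient_descent \<A> b lam \<alpha> (t k) (s k) (\<sigma> k) (U k) (V k)" for k
        using *(1)[of k] by auto
      show "\<rho>t ^ i \<le> t k \<and> \<rho>s ^ i \<le> s k"
        if "sufficient_descent \<A> b lam \<alpha> (\<rho>t ^ i) (\<rho>s ^ i) (\<sigma> k) (U k) (V k)" for k i
      proof -
        have "(\<rho>t ^ i, \<rho>s ^ i) \<in> {(\<rho>t ^ i, \<rho>s ^ j) | i j. i \<le> j \<and> j \<le> i + 1 \<and>
            sufficient_descent \<A> b lam \<alpha> (\<rho>t ^ i) (\<rho>s ^ j) (\<sigma> k) (U k) (V k)}"
          using that by (intro CollectI exI[of _ i] conjI) auto
        from bspec[OF *(2)[of k] this] show ?thesis by simp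
      qed
    qed
  qed
  have t1: "t k \<le> 1" for k using sel[of k] \<rho> by (auto simp: power_le_one less_imp_le)
  have desc: "\<forall>\<^sub>F k in sequentially. obj (X (Suc k)) + \<alpha> * ((\<delta> k)\<^sup>2 + (q k)\<^sup>2) \<le> obj (X k)"
    using sel sufficient_descent_iff[OF t_pos less_imp_le[OF s_pos] steps, where \<alpha> = \<alpha>]
    by (intro always_eventually allI) (auto simp: \<delta>_def q_def X_def[of "Suc _"])
  obtain L where L: "0 < L"
    "\<forall>\<^sub>F k in sequentially. lsig k \<le> L \<and> lome k \<le> L"
    using l_bounds by blast
  \<comment> \<open>\<open>L\<close> bounds the curvature constants, 1 is the slack granted in
    \<open>uniform_descent\<close>, and \<open>\<alpha>\<close> accounts for the required
    descent.\<close>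
  define L0 where "L0 = L + 1 + \<alpha>"
  have L0: "0 < L0" using L \<alpha> by (simp add: L0_def)
  \<comment> \<open>The bound \<open>1 / (4 * L0)\<close> makes the gain at least
    \<open>2 * L0 * D\<close>: one half pays for the quadratic term, the other remains as surplus.
    The bound \<open>1 / L0\<close> lets the first-order decrease pay for
    \<open>L0 * R\<close>.\<close>
  have "\<exists>i. \<rho>t ^ i \<le> 1 / (4 * L0) \<and> (\<rho>s < 1 \<longrightarrow> \<rho>s ^ i \<le> 1 / L0)"
  proof -
    obtain i1 where i1: "\<rho>t ^ i1 < 1 / (4 * L0)" using real_arch_pow_inv[of "1 / (4 * L0)" \<rho>t] L0 \<rho> by auto
    obtain i2 where i2: "\<rho>s < 1 \<longrightarrow> \<rho>s ^ i2 < 1 / L0" using real_arch_pow_inv[of "1 / L0" \<rho>s] L0 by auto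
    have "\<rho>t ^ (i1 + i2) \<le> \<rho>t ^ i1" using \<rho> by (intro power_decreasing) auto
    moreover have "\<rho>s < 1 \<longrightarrow> \<rho>s ^ (i1 + i2) \<le> \<rho>s ^ i2" using \<rho> by (intro impI power_decreasing) auto
    ultimately show ?thesis using i1 i2 by (intro exI[of _ "i1 + i2"]) auto
  qed
  then obtain i where i: "\<rho>t ^ i \<le> 1 / (4 * L0)" "\<rho>s < 1 \<longrightarrow> \<rho>s ^ i \<le> 1 / L0" by blast
  define T0 where "T0 = \<rho>t ^ i"
  define S0 where "S0 = \<rho>s ^ i"
  have T0: "0 < T0" "T0 \<le> 1" and S0: "0 < S0" using \<rho> by (auto simp: T0_def S0_def power_le_one)
  define C where "C = L0 * S0\<^sup>2 / (L0 * T0\<^sup>2) + L0 * S0\<^sup>2 / (\<kappa> / 2)"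
  have "\<forall>\<^sub>F k in sequentially. \<tau> k < T0 * \<kappa>"
    using T0 \<kappa>_pos by (intro order_tendstoD(2)[OF \<tau>_lim]) simp
  then have alt: "\<forall>\<^sub>F k in sequentially. (T0 \<le> t k \<and> S0 \<le> s k) \<or> (1 \<le> \<rho>s \<and> (norm (a k))\<^sup>2 + \<tau> k \<le> C * (\<beta> k)\<^sup>2)"
    using uniform_descent[OF zero_less_one S0 zero_less_one] prox_identification[OF zero_less_one] g_off_eventually L(2)
  proof eventually_elim
    case (elim k)
    obtain P Q where PQ: "step k T0 S0 (prox k T0) P Q"
      using step_exists_unique[OF T0(1)] by blast
    define D where "D = (norm (prox k T0 - \<sigma> k))\<^sup>2"
    define R where "R = (S0 * \<beta> k)\<^sup>2"
    have D: "0 \<le> D" and R: "0 \<le> R" by (simp_all add: D_def R_def)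
    have small: "\<bar>\<sigma> k $ i\<bar> \<le> T0 * \<kappa>" if "i \<notin> I" for i
    proof -
      have "\<bar>\<sigma> k $ i\<bar> \<le> \<tau> k"
        unfolding \<tau>_def using that by (intro member_le_sum[where f = "\<lambda>i. \<bar>\<sigma> k $ i\<bar>"]) auto
      then show ?thesis using elim(1) by simp
    qed
    have "(norm (prox k T0 - \<sigma> k))\<^sup>2 / (2 * T0) + \<kappa> / 2 * \<tau> k \<le> gain k (prox k T0)"
      using elim(3,4) T0 small by (intro gain_identified) (auto simp: less_imp_le)
    moreover have "2 * L0 * D \<le> D / (2 * T0)"
    proof -
      have "2 * L0 * (2 * T0) \<le> 1" using i(1) L0 by (simp add: T0_def field_simps)
      then have "(2 * L0 * (2 * T0)) * D \<le> 1 * D" by (intro mult_right_mono D)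
      then show ?thesis using T0 by (simp add: pos_le_divide_eq mult_ac)
    qed
    ultimately have gain: "2 * L0 * D + \<kappa> / 2 * \<tau> k \<le> gain k (prox k T0)" by (simp add: D_def)
    have "obj (assemble (prox k T0) P Q) \<le> obj (X k) - gain k (prox k T0) - S0 * (\<beta> k)\<^sup>2
        + lsig k * D + (lome k + 1) * R"
      using elim(2) PQ T0 S0 unfolding D_def R_def by blast
    also have "\<dots> \<le> obj (X k) - gain k (prox k T0) - S0 * (\<beta> k)\<^sup>2 + (L0 - \<alpha>) * D + (L0 - \<alpha>) * R"
      using elim(5) D R by (intro add_mono mult_right_mono) (auto simp: L0_def)
    finally have des: "obj (assemble (prox k T0) P Q) + \<alpha> * (D + R)
        \<le> obj (X k) - (L0 * D + \<kappa> / 2 * \<tau> k) - S0 * (\<beta> k)\<^sup>2 + L0 * R"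
      using gain by (simp add: algebra_simps)
    \<comment> \<open>If the fixed pair fails the test, \<open>L0 * R\<close> exceeds the surplus in
      \<open>D\<close> and \<tau>. Since \<open>R\<close> is a multiple of
      \<open>(\<beta> k)\<^sup>2\<close>, this bounds both the residual \<open>a\<close> and
      \<tau>.\<close>
    show ?case
    proof (cases "L0 * R \<le> S0 * (\<beta> k)\<^sup>2 + (L0 * D + \<kappa> / 2 * \<tau> k)")
      case True
      then have "sufficient_descent \<A> b lam \<alpha> T0 S0 (\<sigma> k) (U k) (V k)"
        using des sufficient_descent_iff[OF T0(1) less_imp_le[OF S0] PQ, of \<alpha>] by (simp add: D_def R_def)
      then show ?thesis using max[of i k] by (simp add: T0_def S0_def)
    next
      case False
      have nn: "0 \<le> L0 * D" "0 \<le> \<kappa> / 2 * \<tau> k" "0 \<le> S0 * (\<beta> k)\<^sup>2"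
        using L0 D \<kappa>_pos \<tau>_nonneg[of k] S0 by simp_all
      have "1 \<le> \<rho>s"
      proof (rule ccontr)
        assume "\<not> 1 \<le> \<rho>s"
        then have "L0 * S0 \<le> 1" using i(2) L0 by (simp add: S0_def field_simps)
        then have "(L0 * S0) * (S0 * (\<beta> k)\<^sup>2) \<le> 1 * (S0 * (\<beta> k)\<^sup>2)" by (intro mult_right_mono nn)
        then have "L0 * R \<le> S0 * (\<beta> k)\<^sup>2" by (simp add: R_def power_mult_distrib power2_eq_square mult_ac)
        then show False using False nn by linarith
      qed
      moreover have "(norm (a k))\<^sup>2 + \<tau> k \<le> C * (\<beta> k)\<^sup>2"
      proof -
        have "T0 * norm (a k) \<le> norm (prox k T0 - \<sigma> k)"
          using elim(3) T0 by (intro prox_dist(2)[of T0 1]) auto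
        then have "(T0 * norm (a k))\<^sup>2 \<le> D" unfolding D_def using T0 by (intro power_mono) auto
        then have "L0 * (T0\<^sup>2 * (norm (a k))\<^sup>2) \<le> L0 * D"
          using L0 by (intro mult_left_mono) (auto simp: power_mult_distrib)
        then have "L0 * T0\<^sup>2 * (norm (a k))\<^sup>2 \<le> L0 * S0\<^sup>2 * (\<beta> k)\<^sup>2"
          using False nn by (simp add: R_def power_mult_distrib mult.assoc)
        moreover have "0 < L0 * T0\<^sup>2" using L0 T0 by simp
        ultimately have "(norm (a k))\<^sup>2 \<le> L0 * S0\<^sup>2 / (L0 * T0\<^sup>2) * (\<beta> k)\<^sup>2"
          unfolding times_divide_eq_left by (subst pos_le_divide_eq) (simp_all only: mult.commute)
        moreover have "\<kappa> / 2 * \<tau> k \<le> L0 * S0\<^sup>2 * (\<beta> k)\<^sup>2"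
          using False nn by (simp add: R_def power_mult_distrib mult.assoc)
        then have "\<tau> k \<le> L0 * S0\<^sup>2 / (\<kappa> / 2) * (\<beta> k)\<^sup>2"
          using \<kappa>_pos by (simp add: field_simps)
        ultimately show ?thesis unfolding C_def distrib_right by linarith
      qed
      ultimately show ?thesis by blast
    qed
  qed
  obtain C' where C': "\<forall>\<^sub>F k in sequentially. (res k)\<^sup>2 + \<tau> k \<le> C' * ((\<delta> k)\<^sup>2 + (q k)\<^sup>2)"
  proof (rule residual_bound[of "min 1 S0" T0 1 C])
    \<comment> \<open>Powers of a base that is at least 1 are at least 1, so in the second
      alternative of \<open>alt\<close> the stepsize for the rotations is bounded below as
      well.\<close>
    have s1: "1 \<le> s k" if "1 \<le> \<rho>s" for k using sel[of k] that by auto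
    show "\<forall>\<^sub>F k in sequentially. min 1 S0 \<le> s k"
      using alt by eventually_elim (use s1 in \<open>auto simp: min_le_iff_disj\<close>)
    show "\<forall>\<^sub>F k in sequentially. T0 \<le> t k \<or> (norm (a k))\<^sup>2 + \<tau> k \<le> C * (\<beta> k)\<^sup>2"
      using alt by eventually_elim blast
  qed (use S0 T0 t1 in auto)
  show ?thesis by (rule linear_convergence[OF \<alpha> desc C'])
qed

text \<open>With infinite quotients a vanishing denominator gives no upper restriction and cannot
  supply the finite lower bound on \<open>s'\<close>. A vanishing \<open>l\<close> would put an
  infinite number below \<open>t'\<close>, so \<open>l\<close> is positive.\<close>

lemma explicit_stepsize_bounds:
  assumes \<mu>: "0 < \<mu>" "\<mu> \<le> 1/2" and nonneg: "0 \<le> l" "0 \<le> D" "0 \<le> e" "0 \<le> f"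
    and t: "ereal \<mu> / ereal l \<le> ereal t'" "ereal t' \<le> ereal (1 - \<mu>) / ereal l"
    and s: "Min {1, ereal \<mu> * (2 / ereal D), 1 / ereal e, 1 / ereal f} \<le> ereal s'"
      "ereal s' \<le> Min {ereal (1 / \<mu>), ereal (1 - \<mu>) * (2 / ereal D), 1 / ereal e, 1 / ereal f}"
  shows "0 < l" "\<mu> / l \<le> t'" "t' \<le> (1 - \<mu>) / l" "s' \<le> 1 / \<mu>" "s' * D \<le> 2 * (1 - \<mu>)"
    and "1 \<le> s' \<or> 2 * \<mu> / D \<le> s' \<and> 0 < D \<or> 1 / e \<le> s' \<and> 0 < e \<or> 1 / f \<le> s' \<and> 0 < f"
proof -
  show l: "0 < l"
  proof (rule ccontr)
    assume "\<not> 0 < l"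
    then have "l = 0" using nonneg(1) by simp
    then show False using t(1) \<mu> by (simp add: divide_ereal_def)
  qed
  show "\<mu> / l \<le> t'" "t' \<le> (1 - \<mu>) / l"
    using t l by (simp_all add: divide_ereal_def field_simps)
  have s2: "ereal s' \<le> ereal (1 / \<mu>)" "ereal s' \<le> ereal (1 - \<mu>) * (2 / ereal D)"
    using s(2) by simp_all
  show "s' \<le> 1 / \<mu>" using s2(1) by simp
  have two: "(2 :: ereal) = ereal 2" by simp
  show "s' * D \<le> 2 * (1 - \<mu>)"
  proof (cases "D = 0")
    case False
    then show ?thesis using s2(2) nonneg(2) unfolding two by (simp add: divide_ereal_def field_simps)
  qed (use \<mu> in simp)
  have inv: "0 < x \<and> c / x \<le> s'" if "ereal c / ereal x \<le> ereal s'" "0 \<le> x" "0 < c" for x c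
    using that by (cases "x = 0") (auto simp: divide_ereal_def field_simps)
  have "1 \<le> ereal s' \<or> ereal \<mu> * (2 / ereal D) \<le> ereal s' \<or> 1 / ereal e \<le> ereal s' \<or> 1 / ereal f \<le> ereal s'"
    using s(1) by (subst (asm) Min_le_iff) auto
  moreover have "ereal \<mu> * (2 / ereal D) = ereal (2 * \<mu>) / ereal D"
    unfolding two divide_ereal_def by (simp add: mult.assoc[symmetric] mult.commute)
  ultimately show "1 \<le> s' \<or> 2 * \<mu> / D \<le> s' \<and> 0 < D \<or> 1 / e \<le> s' \<and> 0 < e \<or> 1 / f \<le> s' \<and> 0 < f"
    using inv[of "2 * \<mu>" D] inv[of 1 e] inv[of 1 f] nonneg \<mu> by (auto simp: one_ereal_def)
qed

text \<open>For \<sigma>, \<open>t k * l k \<le> 1 - \<mu>\<close> makes the gain at least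
  \<open>(1 + \<mu>) * l k\<close> times the squared step. For the rotations,
  \<open>s k * w k \<le> 1 - \<mu>\<close> and \<open>\<mu> * s k \<le> 1\<close> leave a surplus of
  \<open>\<mu>\<^sup>2 * (q k)\<^sup>2\<close>.\<close>

lemma explicit_convergence:
  assumes ex: "explicit_stepsizes \<A> b \<sigma> U V t s"
  shows "converges_linearly X Xb \<and> converges_linearly (\<lambda>k. obj (X k)) (obj Xb)"
proof -
  define l where "l k = lsig k" for k
  define w where "w k = lome k" for k
  define c where "c k = c_bound \<A> b (\<sigma> k) (U k) (V k) (\<sigma> (Suc k))" for k
  define D where "D k = sqrt ((w k)\<^sup>2 + 2 * c k) + w k" for k
  have c_eq: "c k = (lip * (norm (\<sigma> (Suc k)))\<^sup>2 + norm (adjoint \<A> b) * norm (\<sigma> (Suc k))) * (norm (gE k) + norm (gF k))" for k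
    by (simp add: c_def c_bound_def lip_def gE_def gF_def)
  have c0: "0 \<le> c k" for k unfolding c_eq using lip_nonneg by simp
  have w0: "0 \<le> w k" and l0: "0 \<le> l k" for k using l_nonneg by (simp_all add: w_def l_def)
  have D2: "2 * w k \<le> D k" for k
  proof -
    have "w k \<le> sqrt ((w k)\<^sup>2 + 2 * c k)" using c0[of k] by (intro real_le_rsqrt) simp
    then show ?thesis by (simp add: D_def)
  qed
  have D0: "0 \<le> D k" for k using D2[of k] w0[of k] by linarith
  obtain \<mu> where \<mu>: "0 < \<mu>" "\<mu> \<le> 1/2"
    and tt: "\<And>k. ereal \<mu> / ereal (l k) \<le> ereal (t k)" "\<And>k. ereal (t k) \<le> ereal (1 - \<mu>) / ereal (l k)"
    and ss: "\<And>k. Min {1, ereal \<mu> * (2 / ereal (D k)), 1 / ereal (norm (gE k)), 1 / ereal (norm (gF k))} \<le> ereal (s k)"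
      "\<And>k. ereal (s k) \<le> Min {ereal (1 / \<mu>), ereal (1 - \<mu>) * (2 / ereal (D k)), 1 / ereal (norm (gE k)), 1 / ereal (norm (gF k))}"
    using ex unfolding explicit_stepsizes_def Let_def s_bar_def l_def D_def w_def c_def gE_def gF_def by blast
  note bounds = explicit_stepsize_bounds[OF \<mu> l0 D0 norm_ge_zero norm_ge_zero tt ss]
  \<comment> \<open>If \<open>\<A>\<close> vanished, so would the gradient and hence
    \<open>l_sigma\<close>, which the stepsize bounds exclude.\<close>
  have lip_pos: "0 < lip"
  proof (rule ccontr)
    assume "\<not> 0 < lip"
    then have lip0: "lip = 0" using lip_nonneg by simp
    then have "\<A> Z = 0" for Z using norm_A_sq[of Z] by simp
    then have "G 0 \<bullet> G 0 = 0" unfolding G_def inner_grad_fit by simp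
    then have "l 0 = 0" by (simp add: l_def l_sigma_eq lip0)
    then show False using bounds(1)[of 0] by simp
  qed
  have lip_le: "lip \<le> l k" for k unfolding l_def l_sigma_eq using lip_nonneg by simp
  obtain L where L: "0 < L" "\<forall>\<^sub>F k in sequentially. l k \<le> L \<and> w k \<le> L"
    using l_bounds unfolding l_def w_def by blast
  have t_le: "t k \<le> 1 / lip" for k
  proof -
    have "t k \<le> (1 - \<mu>) / l k" by (rule bounds(3))
    also have "\<dots> \<le> 1 / lip" using \<mu> lip_pos lip_le[of k] by (intro frac_le) auto
    finally show ?thesis .
  qed
  have s_le: "s k \<le> 1 / \<mu>" for k by (rule bounds(4))
  have sw: "s k * w k \<le> 1 - \<mu>" for k
    using bounds(5)[of k] mult_left_mono[OF D2[of k] less_imp_le[OF s_pos[of k]]] by simp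
  \<comment> \<open>Half of the rotational surplus is spent on the remainder allowed in
    \<open>uniform_descent\<close>; the other half is the second argument of the minimum.\<close>
  define \<alpha> where "\<alpha> = min (\<mu> * lip) (\<mu>\<^sup>2 / 2)"
  have \<alpha>: "0 < \<alpha>" using \<mu> lip_pos by (simp add: \<alpha>_def)
  have desc: "\<forall>\<^sub>F k in sequentially. obj (X (Suc k)) + \<alpha> * ((\<delta> k)\<^sup>2 + (q k)\<^sup>2) \<le> obj (X k)"
    using uniform_descent[of "1 / lip" "1 / \<mu>" "\<mu>\<^sup>2 / 2", OF divide_pos_pos[OF zero_less_one lip_pos]
        divide_pos_pos[OF zero_less_one \<mu>(1)] half_gt_zero[OF zero_less_power[OF \<mu>(1)]]]
  proof eventually_elim
    case (elim k)
    have des: "obj (X (Suc k)) \<le> obj (X k) - gain k (\<sigma> (Suc k)) - s k * (\<beta> k)\<^sup>2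
        + l k * (\<delta> k)\<^sup>2 + (w k + \<mu>\<^sup>2 / 2) * (q k)\<^sup>2"
      using elim[rule_format, of "t k" "s k" "\<sigma> (Suc k)" "U (Suc k)" "V (Suc k)"] t_pos[of k] s_pos[of k] t_le[of k] s_le[of k] steps[of k]
      by (simp add: X_def[of "Suc k"] l_def w_def \<delta>_def q_def)
    have "l k * (\<delta> k)\<^sup>2 + \<mu> * lip * (\<delta> k)\<^sup>2 \<le> gain k (\<sigma> (Suc k))"
    proof -
      have lk: "0 < l k" by (rule bounds(1))
      have "t k * l k \<le> 1 - \<mu>" using bounds(3)[of k] lk by (simp add: pos_le_divide_eq)
      then have "(t k * l k) * (1 + \<mu>) \<le> (1 - \<mu>) * (1 + \<mu>)" using \<mu> by (intro mult_right_mono) auto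
      also have "\<dots> \<le> 1" by (simp add: algebra_simps)
      finally have "(l k * (1 + \<mu>)) * t k \<le> 1" by (simp add: mult_ac)
      then have "(l k * (1 + \<mu>)) * t k * (\<delta> k)\<^sup>2 \<le> 1 * (\<delta> k)\<^sup>2" by (intro mult_right_mono) auto
      then have "(l k * (1 + \<mu>)) * (\<delta> k)\<^sup>2 \<le> (\<delta> k)\<^sup>2 / t k" using t_pos[of k] by (simp add: pos_le_divide_eq mult_ac)
      also have "\<dots> \<le> gain k (\<sigma> (Suc k))" unfolding \<delta>_def \<sigma>_Suc by (rule gain_prox[OF t_pos])
      finally have "l k * (\<delta> k)\<^sup>2 + \<mu> * l k * (\<delta> k)\<^sup>2 \<le> gain k (\<sigma> (Suc k))" by (simp add: algebra_simps)
      moreover have "\<mu> * lip * (\<delta> k)\<^sup>2 \<le> \<mu> * l k * (\<delta> k)\<^sup>2"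
        using lip_le[of k] \<mu> by (intro mult_right_mono mult_left_mono) auto
      ultimately show ?thesis by linarith
    qed
    moreover have "w k * (q k)\<^sup>2 + \<mu>\<^sup>2 * (q k)\<^sup>2 \<le> s k * (\<beta> k)\<^sup>2"
    proof -
      have "\<mu> * s k \<le> 1" using s_le[of k] \<mu> by (simp add: pos_le_divide_eq mult.commute)
      then have "\<mu> * (\<mu> * s k) \<le> \<mu> * 1" using \<mu> by (intro mult_left_mono) auto
      then have "s k * w k + \<mu>\<^sup>2 * s k \<le> 1" using sw[of k] by (simp add: power2_eq_square mult.assoc)
      then have "(s k * w k + \<mu>\<^sup>2 * s k) * (s k * (\<beta> k)\<^sup>2) \<le> 1 * (s k * (\<beta> k)\<^sup>2)"
        using s_pos[of k] by (intro mult_right_mono) auto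
      then show ?thesis by (simp add: q_def power_mult_distrib power2_eq_square algebra_simps)
    qed
    moreover have "\<alpha> \<le> \<mu> * lip" "\<alpha> \<le> \<mu>\<^sup>2 / 2" by (simp_all add: \<alpha>_def)
    then have "\<alpha> * (\<delta> k)\<^sup>2 \<le> \<mu> * lip * (\<delta> k)\<^sup>2" "\<alpha> * (q k)\<^sup>2 \<le> \<mu>\<^sup>2 / 2 * (q k)\<^sup>2"
      by (intro mult_right_mono; simp)+
    moreover have "(w k + \<mu>\<^sup>2 / 2) * (q k)\<^sup>2 = w k * (q k)\<^sup>2 + \<mu>\<^sup>2 / 2 * (q k)\<^sup>2" by (simp add: distrib_right)
    moreover have "\<mu>\<^sup>2 * (q k)\<^sup>2 = \<mu>\<^sup>2 / 2 * (q k)\<^sup>2 + \<mu>\<^sup>2 / 2 * (q k)\<^sup>2" by simp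
    ultimately show ?case using des unfolding distrib_left by linarith
  qed
  have gEF: "norm (gE k) \<le> \<beta> k" "norm (gF k) \<le> \<beta> k" for k by (rule \<beta>_bounds)+
  define R where "R = norm \<sigma>b + 1"
  have ev\<sigma>: "\<forall>\<^sub>F k in sequentially. norm (\<sigma> (Suc k)) < R"
    by (rule order_tendstoD(2)[OF tendsto_norm[OF LIMSEQ_Suc[OF lims(1)]]]) (simp add: R_def)
  have ev\<beta>: "\<forall>\<^sub>F k in sequentially. \<beta> k < 1" by (rule order_tendstoD(2)[OF \<beta>_lim]) simp
  define c1 where "c1 = (lip * R\<^sup>2 + norm (adjoint \<A> b) * R) * 2"
  define D1 where "D1 = sqrt (L\<^sup>2 + 2 * c1) + L"
  have R: "0 < R" by (simp add: R_def add_nonneg_pos)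
  have c1: "0 \<le> c1" using R lip_nonneg by (simp add: c1_def)
  have D1: "0 < D1" using L c1 by (auto simp: D1_def intro!: add_nonneg_pos)
  define smin where "smin = min 1 (2 * \<mu> / D1)"
  have smin: "0 < smin" using \<mu> D1 by (simp add: smin_def)
  have ev_s: "\<forall>\<^sub>F k in sequentially. smin \<le> s k"
    using ev\<sigma> ev\<beta> L(2)
  proof eventually_elim
    case (elim k)
    have "c k \<le> c1"
      unfolding c_eq c1_def
    proof (rule mult_mono)
      show "lip * (norm (\<sigma> (Suc k)))\<^sup>2 + norm (adjoint \<A> b) * norm (\<sigma> (Suc k)) \<le> lip * R\<^sup>2 + norm (adjoint \<A> b) * R"
        using elim(1) lip_nonneg by (intro add_mono mult_left_mono power_mono) auto
      show "norm (gE k) + norm (gF k) \<le> 2" using gEF[of k] elim(2) by linarith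
    qed (use R lip_nonneg in auto)
    then have "D k \<le> D1"
      unfolding D_def D1_def using elim(3) w0[of k]
      by (intro add_mono real_sqrt_le_mono power_mono mult_left_mono) auto
    then have "0 < D k \<Longrightarrow> 2 * \<mu> / D1 \<le> 2 * \<mu> / D k" using \<mu> by (intro divide_left_mono) auto
    \<comment> \<open>If the lower bound on \<open>s k\<close> stems from the reciprocal of a skew
      gradient, it is at least 1, because these gradients tend to zero.\<close>
    moreover have "1 \<le> 1 / x" if "0 < x" "x \<le> \<beta> k" for x using that elim(2) by simp
    ultimately show ?case
      using bounds(6)[of k] gEF[of k] unfolding smin_def by (smt (verit) min.coboundedI1 min.coboundedI2)
  qed
  have tmin: "0 < \<mu> / L" using \<mu> L by simp
  \<comment> \<open>The stepsizes for \<sigma> stay above \<open>\<mu> / L\<close>, so the first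
    alternative always holds and the constant 0 serves in the second.\<close>
  have ev_t: "\<forall>\<^sub>F k in sequentially. \<mu> / L \<le> t k \<or> (norm (a k))\<^sup>2 + \<tau> k \<le> 0 * (\<beta> k)\<^sup>2"
    using L(2)
  proof eventually_elim
    case (elim k)
    have "\<mu> / L \<le> \<mu> / l k" using elim \<mu> bounds(1)[of k] by (intro divide_left_mono) auto
    then show ?case using bounds(2)[of k] by linarith
  qed
  obtain C' where C': "\<forall>\<^sub>F k in sequentially. (res k)\<^sup>2 + \<tau> k \<le> C' * ((\<delta> k)\<^sup>2 + (q k)\<^sup>2)"
    using residual_bound[OF smin ev_s tmin always_eventually[OF allI[OF t_le]] ev_t] by blast
  show ?thesis by (rule linear_convergence[OF \<alpha> desc C'])
qed

end

lemma (in ls_problem) step_orthogonal: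
  assumes UV: "orthogonal_matrix U" "orthogonal_matrix V" and st: "dpga_step \<A> b lam t s \<sigma> U V \<sigma>' U' V'"
  shows "orthogonal_matrix U'" "orthogonal_matrix V'"
proof -
  have skew: "transpose (- (s *\<^sub>R grad_E \<A> b \<sigma> U V)) = - (- (s *\<^sub>R grad_E \<A> b \<sigma> U V))"
    "transpose (- (s *\<^sub>R grad_F \<A> b \<sigma> U V)) = - (- (s *\<^sub>R grad_F \<A> b \<sigma> U V))"
    by (simp_all add: transpose_minus transpose_scalar transpose_grad_E transpose_grad_F)
  show "orthogonal_matrix U'" "orthogonal_matrix V'"
    using descent(1,2)[OF UV skew] st unfolding dpga_step_def Let_def by blast+
qed

theorem theorem4p14:
  fixes \<A> :: "('m::{finite,linorder},'n::{finite,linorder}) mat \<Rightarrow> 'l::finite rvec"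
    and b :: "'l rvec"
    and lam :: real
    and t s :: "nat \<Rightarrow> real"
    and \<sigma> :: "nat \<Rightarrow> 'n rvec"
    and U :: "nat \<Rightarrow> ('m,'m) mat"
    and V :: "nat \<Rightarrow> ('n,'n) mat"
    and \<sigma>bar :: "'n rvec"
    and Ubar :: "('m,'m) mat"
    and Vbar :: "('n,'n) mat"
    and X :: "nat \<Rightarrow> ('m,'n) mat"
    and Xbar :: "('m,'n) mat"
    and r :: nat
  assumes "CARD('n) \<le> CARD('m)"
    and "linear \<A>"
    and "0 < lam"
    and "dpga_sequence \<A> b lam t s \<sigma> U V"
    and "(\<exists>\<alpha>>0. backtracking_stepsizes \<A> b lam \<alpha> \<sigma> U V t s) \<or> explicit_stepsizes \<A> b \<sigma> U V t s"
    and "\<sigma> \<longlonglongrightarrow> \<sigma>bar" and "U \<longlonglongrightarrow> Ubar" and "V \<longlonglongrightarrow> Vbar"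
    and "\<And>k. X k = assemble (\<sigma> k) (U k) (V k)"
    and "Xbar = assemble \<sigma>bar Ubar Vbar"
    and "inj_on (\<lambda>i. \<sigma>bar $ i) {i. \<sigma>bar $ i \<noteq> 0}"
    and "r \<le> CARD('n)"
    and "\<And>i j. i < j \<Longrightarrow> index_pos j < r \<Longrightarrow> \<sigma>bar $ j < \<sigma>bar $ i"
    and "\<And>i. index_pos i < r \<Longrightarrow> 0 < \<sigma>bar $ i"
    and "\<And>i. r \<le> index_pos i \<Longrightarrow> \<sigma>bar $ i = 0"
    and "0 \<in> rel_interior (subdifferential (objective \<A> b lam) Xbar)"
  shows "converges_linearly X Xbar \<and>
    converges_linearly (\<lambda>k. objective \<A> b lam (X k)) (objective \<A> b lam Xbar)"
proof -
  interpret ls: ls_problem \<A> b lam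
    by (rule ls_problem.intro) (rule assms)+
  have run: "\<And>k. 0 < t k" "\<And>k. 0 < s k"
    "\<And>k. dpga_step \<A> b lam (t k) (s k) (\<sigma> k) (U k) (V k) (\<sigma> (Suc k)) (U (Suc k)) (V (Suc k))"
    using assms(4) by (auto simp: dpga_sequence_def)
  have orth: "orthogonal_matrix (U k) \<and> orthogonal_matrix (V k)" for k
  proof (induction k)
    case 0
    show ?case using assms(4) by (simp add: dpga_sequence_def)
  next
    case (Suc k)
    then show ?case using ls.step_orthogonal run(3) by blast
  qed
  have orth_bar: "orthogonal_matrix Ubar" "orthogonal_matrix Vbar"
    using orthogonal_matrix_limit orth assms(7,8) by blast+
  define I where "I = {i :: 'n. index_pos i < r}"
  have I: "i \<in> I \<Longrightarrow> 0 < \<sigma>bar $ i" "i \<notin> I \<Longrightarrow> \<sigma>bar $ i = 0" for i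
    using assms(14,15) by (auto simp: I_def)
  have "\<exists>\<theta> N. \<theta> < 1 \<and> op_bound \<theta> N \<and> (\<forall>i\<in>I. \<forall>j. N $ row_of i $ j = 0) \<and> (\<forall>i\<in>I. \<forall>p. N $ p $ i = 0) \<and>
    Ubar ** grad_fit \<A> b (assemble \<sigma>bar Ubar Vbar) ** transpose Vbar = - (lam *\<^sub>R (diag_matrix (ls.indicator_vec I) + N))"
    by (rule ls.strict_complementarity[OF assms(16)[unfolded assms(10)] orth_bar]) (simp_all add: I)
  then obtain \<theta> N where \<theta>: "\<theta> < 1" and N: "op_bound \<theta> N"
    "\<forall>i\<in>I. \<forall>j. N $ row_of i $ j = 0" "\<forall>i\<in>I. \<forall>p. N $ p $ i = 0"
    and grad: "Ubar ** grad_fit \<A> b (assemble \<sigma>bar Ubar Vbar) ** transpose Vbar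
      = - (lam *\<^sub>R (diag_matrix (ls.indicator_vec I) + N))"
    by (elim exE conjE) (rule that)
  have "0 \<in> subdifferential (objective \<A> b lam) Xbar"
    using assms(16) rel_interior_subset by blast
  then have minimal: "objective \<A> b lam Xbar \<le> objective \<A> b lam Y" for Y
    by (simp add: subdifferential_def)
  interpret dpga_run \<A> b lam \<sigma> U V \<sigma>bar Ubar Vbar I \<theta> N t s
  proof unfold_locales
    show "inj_on (($) \<sigma>bar) I"
      by (rule inj_on_subset[OF assms(11)]) (use I(1) in force)
    show "objective \<A> b lam (assemble \<sigma>bar Ubar Vbar) \<le> objective \<A> b lam Y" for Y
      using minimal by (simp add: assms(10))
    show "off_block I N" using N by (simp add: off_block_def[OF assms(1)])
    show "Ubar ** grad_fit \<A> b (assemble \<sigma>bar Ubar Vbar) ** transpose Vbar = - (lam *\<^sub>R (unit_block I + N))"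
      using grad by (simp add: unit_block_def[OF assms(1)] ls.indicator_vec_def)
  qed (use orth I \<theta> N run assms(6-8) in auto)
  have "X = dpga_limit.X \<sigma> U V" "Xbar = dpga_limit.Xb \<sigma>bar Ubar Vbar"
    using X_def Xb_def assms(9,10) by auto
  then show ?thesis
    using assms(5) backtracking_convergence explicit_convergence by auto
qed

end
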